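(* Let $k$ be an algebraically closed field of characteristic $2$. Then $kA_5$ has exactly two blocks. The projective indecomposable modules $P_1,P_2,P_3$ belong to the same block, which is the principal block $B_0(kA_5)$, and $P_4$ belongs to the other block. Explicitly, if $1=\sum_i f_i$ is an expression of $1\in kA_5$ as a sum of primitive orthogonal idempotents, then $$e_1=\sum_{kA_5f_i\cong P_1,\,P_2\text{ or }P_3}f_i,\qquad e_2=\sum_{kA_5f_i\cong P_4}f_i$$ are the primitive central orthogonal idempotents of $kA_5$, the decomposition of $kA_5$ into blocks is $kA_5= kA_5e_1\oplus kA_5e_2$, and $B_0(kA_5)=kA_5e_1$.
   Context: For a finite-dimensional algebra $A$, write $1=e_1+\cdots+e_n$ as the (unique) sum of primitive central orthogonal idempotents; the blocks of $A$ are the two-sided ideals $Ae_1,\dots,Ae_n$. An indecomposable left $A$-module $M$ belongs to the block $Ae_i$ if $M=e_iM$. The principal block $B_0(kG)$ is the block to which the trivial module belongs. The simple left $kA_5$-modules are $S_1,S_2,S_3,S_4$: $S_1=k_{A_5}$ is the trivial module; $S_2$ is the two-dimensional module obtained from an isomorphism $A_5\cong SL_2(\mathbb F_4)$ and the natural action on $\mathbb F_4^2$, extending scalars from $\mathbb F_4\subseteq k$ to $k$; $S_3$ is obtained from $S_2$ by applying the nontrivial automorphism of $\mathbb F_4$ to the matrix entries; $S_4$ is the four-dimensional submodule, consisting of vectors with coordinate sum $0$, of the permutation module $k^5$ of $A_5$ acting on $\{1,\dots,5\}$. $P_i$ denotes the projective cover of $S_i$. *)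

theory Defs
  imports
    "HOL-Analysis.Analysis"
    "HOL-Algebra.Algebra"
    "HOL-Algebra.Algebraic_Closure_Type"
    "HOL-Library.Function_Algebras"
begin

section \<open>Left modules over a (not necessarily commutative) ring\<close>

text \<open>The library locale \<open>module\<close> requires a commutative ring of scalars. The same record
  type is used here; its fields \<open>mult\<close> and \<open>one\<close> carry no meaning for a module.\<close>

locale left_module = R?: ring R + M?: abelian_group M
  for R :: "('a, 'c) ring_scheme" (structure) and M :: "('a, 'b, 'd) module_scheme" (structure) +
  assumes smult_closed:
      "\<lbrakk>a \<in> carrier R; x \<in> carrier M\<rbrakk> \<Longrightarrow> a \<odot>\<^bsub>M\<^esub> x \<in> carrier M"
    and smult_l_distr:
      "\<lbrakk>a \<in> carrier R; b \<in> carrier R; x \<in> carrier M\<rbrakk> \<Longrightarrow>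
        (a \<oplus>\<^bsub>R\<^esub> b) \<odot>\<^bsub>M\<^esub> x = a \<odot>\<^bsub>M\<^esub> x \<oplus>\<^bsub>M\<^esub> b \<odot>\<^bsub>M\<^esub> x"
    and smult_r_distr:
      "\<lbrakk>a \<in> carrier R; x \<in> carrier M; y \<in> carrier M\<rbrakk> \<Longrightarrow>
        a \<odot>\<^bsub>M\<^esub> (x \<oplus>\<^bsub>M\<^esub> y) = a \<odot>\<^bsub>M\<^esub> x \<oplus>\<^bsub>M\<^esub> a \<odot>\<^bsub>M\<^esub> y"
    and smult_assoc1:
      "\<lbrakk>a \<in> carrier R; b \<in> carrier R; x \<in> carrier M\<rbrakk> \<Longrightarrow>
        (a \<otimes>\<^bsub>R\<^esub> b) \<odot>\<^bsub>M\<^esub> x = a \<odot>\<^bsub>M\<^esub> (b \<odot>\<^bsub>M\<^esub> x)"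
    and smult_one: "x \<in> carrier M \<Longrightarrow> \<one>\<^bsub>R\<^esub> \<odot>\<^bsub>M\<^esub> x = x"

definition module_hom ::
    "('a, 'c) ring_scheme \<Rightarrow> ('a, 'm) module \<Rightarrow> ('a, 'n) module \<Rightarrow> ('m \<Rightarrow> 'n) set" where
  "module_hom R M N = {h \<in> carrier M \<rightarrow> carrier N.
     (\<forall>x\<in>carrier M. \<forall>y\<in>carrier M. h (x \<oplus>\<^bsub>M\<^esub> y) = h x \<oplus>\<^bsub>N\<^esub> h y) \<and>
     (\<forall>r\<in>carrier R. \<forall>x\<in>carrier M. h (r \<odot>\<^bsub>M\<^esub> x) = r \<odot>\<^bsub>N\<^esub> h x)}"

definition module_isomorphic ::
    "('a, 'c) ring_scheme \<Rightarrow> ('a, 'm) module \<Rightarrow> ('a, 'n) module \<Rightarrow> bool" where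
  "module_isomorphic R M N \<longleftrightarrow> (\<exists>h \<in> module_hom R M N. bij_betw h (carrier M) (carrier N))"

definition internal_direct_sum ::
    "('a, 'c) ring_scheme \<Rightarrow> ('a, 'm) module \<Rightarrow> 'm set \<Rightarrow> 'm set \<Rightarrow> bool" where
  "internal_direct_sum R M U V \<longleftrightarrow> submodule U R M \<and> submodule V R M \<and>
     U <+>\<^bsub>M\<^esub> V = carrier M \<and> U \<inter> V = {\<zero>\<^bsub>M\<^esub>}"

definition indecomposable_module :: "('a, 'c) ring_scheme \<Rightarrow> ('a, 'm) module \<Rightarrow> bool" where
  "indecomposable_module R M \<longleftrightarrow> left_module R M \<and> carrier M \<noteq> {\<zero>\<^bsub>M\<^esub>} \<and>
     (\<forall>U V. internal_direct_sum R M U V \<longrightarrow> U = {\<zero>\<^bsub>M\<^esub>} \<or> V = {\<zero>\<^bsub>M\<^esub>})"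

definition free_module :: "('a, 'c) ring_scheme \<Rightarrow> 'i set \<Rightarrow> ('a, 'i \<Rightarrow> 'a) module" where
  "free_module R I = \<lparr>
     carrier = {x. (\<forall>i\<in>I. x i \<in> carrier R) \<and> (\<forall>i. i \<notin> I \<longrightarrow> x i = \<zero>\<^bsub>R\<^esub>) \<and>
                   finite {i. x i \<noteq> \<zero>\<^bsub>R\<^esub>}},
     monoid.mult = undefined, monoid.one = undefined,
     ring.zero = (\<lambda>i. \<zero>\<^bsub>R\<^esub>), ring.add = (\<lambda>x y i. x i \<oplus>\<^bsub>R\<^esub> y i),
     smult = (\<lambda>r x i. r \<otimes>\<^bsub>R\<^esub> x i)\<rparr>"

text \<open>Projective modules are direct summands of free modules. Basis sets inside the carrier
  type of \<open>P\<close> suffice: a projective module is a summand of the free module on its own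
  underlying set.\<close>

definition projective_module :: "('a, 'c) ring_scheme \<Rightarrow> ('a, 'p) module \<Rightarrow> bool" where
  "projective_module R P \<longleftrightarrow> left_module R P \<and>
     (\<exists>(I :: 'p set) U V. internal_direct_sum R (free_module R I) U V \<and>
        module_isomorphic R P ((free_module R I)\<lparr>carrier := U\<rparr>))"

text \<open>An essential epimorphism is a surjection under which no proper submodule of the source
  maps onto the target.\<close>

definition essential_epi ::
    "('a, 'c) ring_scheme \<Rightarrow> ('a, 'm) module \<Rightarrow> ('a, 'n) module \<Rightarrow> ('m \<Rightarrow> 'n) \<Rightarrow> bool" where
  "essential_epi R M N h \<longleftrightarrow> h \<in> module_hom R M N \<and> h ` carrier M = carrier N \<and>
     (\<forall>U. submodule U R M \<and> h ` U = carrier N \<longrightarrow> U = carrier M)"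

definition projective_cover ::
    "('a, 'c) ring_scheme \<Rightarrow> ('a, 'p) module \<Rightarrow> ('a, 's) module \<Rightarrow> bool" where
  "projective_cover R P S \<longleftrightarrow>
     left_module R S \<and> projective_module R P \<and> (\<exists>h. essential_epi R P S h)"

definition regular_module :: "('a, 'c) ring_scheme \<Rightarrow> ('a, 'a) module" where
  "regular_module R = \<lparr>carrier = carrier R, monoid.mult = monoid.mult R, monoid.one = monoid.one R,
     ring.zero = ring.zero R, ring.add = ring.add R, smult = monoid.mult R\<rparr>"


section \<open>Idempotents and blocks\<close>

text \<open>\<open>PIdl\<^bsub>R\<^esub> a\<close> unfolds to the set of all \<open>x \<otimes> a\<close>, i.e. the left ideal \<open>Ra\<close>, also when
  \<open>R\<close> is not commutative; it is two-sided when \<open>a\<close> is central.\<close>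

abbreviation left_ideal_module :: "('a, 'c) ring_scheme \<Rightarrow> 'a \<Rightarrow> ('a, 'a) module" where
  "left_ideal_module R a \<equiv> (regular_module R)\<lparr>carrier := PIdl\<^bsub>R\<^esub> a\<rparr>"

definition idempotent :: "('a, 'c) ring_scheme \<Rightarrow> 'a \<Rightarrow> bool" where
  "idempotent R e \<longleftrightarrow> e \<in> carrier R \<and> e \<otimes>\<^bsub>R\<^esub> e = e"

definition primitive_idempotent :: "('a, 'c) ring_scheme \<Rightarrow> 'a \<Rightarrow> bool" where
  "primitive_idempotent R e \<longleftrightarrow> idempotent R e \<and> e \<noteq> \<zero>\<^bsub>R\<^esub> \<and>
     \<not> (\<exists>a b. idempotent R a \<and> idempotent R b \<and> a \<noteq> \<zero>\<^bsub>R\<^esub> \<and> b \<noteq> \<zero>\<^bsub>R\<^esub> \<and>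
          a \<otimes>\<^bsub>R\<^esub> b = \<zero>\<^bsub>R\<^esub> \<and> b \<otimes>\<^bsub>R\<^esub> a = \<zero>\<^bsub>R\<^esub> \<and> e = a \<oplus>\<^bsub>R\<^esub> b)"

text \<open>A set suffices to index the summands: orthogonal nonzero idempotents are distinct.\<close>

definition primitive_decomposition :: "('a, 'c) ring_scheme \<Rightarrow> 'a set \<Rightarrow> bool" where
  "primitive_decomposition R E \<longleftrightarrow> finite E \<and> (\<forall>e\<in>E. primitive_idempotent R e) \<and>
     (\<forall>e\<in>E. \<forall>f\<in>E. e \<noteq> f \<longrightarrow> e \<otimes>\<^bsub>R\<^esub> f = \<zero>\<^bsub>R\<^esub>) \<and>
     \<one>\<^bsub>R\<^esub> = (\<Oplus>\<^bsub>R\<^esub>e\<in>E. e)"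

definition ring_center :: "('a, 'c) ring_scheme \<Rightarrow> ('a, 'c) ring_scheme" where
  "ring_center R = R\<lparr>carrier := {z \<in> carrier R. \<forall>a\<in>carrier R. z \<otimes>\<^bsub>R\<^esub> a = a \<otimes>\<^bsub>R\<^esub> z}\<rparr>"

text \<open>The primitive central idempotents of \<open>R\<close> are the primitive idempotents of its centre.\<close>

definition blocks :: "('a, 'c) ring_scheme \<Rightarrow> 'a set set" where
  "blocks R = {PIdl\<^bsub>R\<^esub> e | E e. primitive_decomposition (ring_center R) E \<and> e \<in> E}"

definition belongs_to_block ::
    "('a, 'c) ring_scheme \<Rightarrow> ('a, 'm) module \<Rightarrow> 'a set \<Rightarrow> bool" where
  "belongs_to_block R M B \<longleftrightarrow> indecomposable_module R M \<and>
     (\<exists>E e. primitive_decomposition (ring_center R) E \<and> e \<in> E \<and> B = PIdl\<^bsub>R\<^esub> e \<and>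
        carrier M = (\<lambda>m. e \<odot>\<^bsub>M\<^esub> m) ` carrier M)"


section \<open>Group algebras of finite groups and modules from linear actions\<close>

text \<open>Elements of \<open>kG\<close> are functions supported on the finite group \<open>G\<close>, with convolution
  as product.\<close>

definition group_algebra :: "('g, 'c) monoid_scheme \<Rightarrow> ('g \<Rightarrow> 'k::field) ring" where
  "group_algebra G = \<lparr>
     carrier = {a. \<forall>g. g \<notin> carrier G \<longrightarrow> a g = 0},
     monoid.mult = (\<lambda>a b g. \<Sum>(x, y) \<in> {(x, y). x \<in> carrier G \<and> y \<in> carrier G \<and> x \<otimes>\<^bsub>G\<^esub> y = g}.
               a x * b y),
     monoid.one = (\<lambda>g. if g = \<one>\<^bsub>G\<^esub> then 1 else 0),
     ring.zero = (\<lambda>g. 0),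
     ring.add = (\<lambda>a b g. a g + b g)\<rparr>"

text \<open>The \<open>kG\<close>-module given by a \<open>k\<close>-space \<open>V\<close> with scaling \<open>sc\<close> and a linear action
  \<open>act\<close> of \<open>G\<close>.\<close>

definition linear_module ::
    "('g, 'c) monoid_scheme \<Rightarrow> 'v set \<Rightarrow> ('k::field \<Rightarrow> 'v \<Rightarrow> 'v) \<Rightarrow> ('g \<Rightarrow> 'v \<Rightarrow> 'v) \<Rightarrow>
     ('g \<Rightarrow> 'k, 'v::ab_group_add) module" where
  "linear_module G V sc act = \<lparr>carrier = V, monoid.mult = undefined, monoid.one = undefined,
     ring.zero = 0, ring.add = (+), smult = (\<lambda>a v. \<Sum>g\<in>carrier G. sc (a g) (act g v))\<rparr>"

definition trivial_module :: "('g, 'c) monoid_scheme \<Rightarrow> ('g \<Rightarrow> 'k, 'k::field) module" where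
  "trivial_module G = linear_module G UNIV (*) (\<lambda>g x. x)"

definition matrix_module ::
    "('g, 'c) monoid_scheme \<Rightarrow> ('g \<Rightarrow> 'k^'n^'n) \<Rightarrow> ('g \<Rightarrow> 'k, 'k::field^'n) module" where
  "matrix_module G \<rho> = linear_module G UNIV (*s) (\<lambda>g v. \<rho> g *v v)"

text \<open>For a group of permutations of \<open>\<Omega>\<close>, the space \<open>k^\<Omega>\<close> with \<open>g\<close> sending the basis
  vector at \<open>x\<close> to the one at \<open>g x\<close>.\<close>

definition permutation_module ::
    "('x \<Rightarrow> 'x, 'c) monoid_scheme \<Rightarrow> 'x set \<Rightarrow> (('x \<Rightarrow> 'x) \<Rightarrow> 'k, 'x \<Rightarrow> 'k::field) module" where
  "permutation_module G \<Omega> = linear_module G {v. \<forall>x. x \<notin> \<Omega> \<longrightarrow> v x = 0}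
     (\<lambda>c v x. c * v x) (\<lambda>g v x. v ((inv\<^bsub>G\<^esub> g) x))"

definition sum_zero_module ::
    "('x \<Rightarrow> 'x, 'c) monoid_scheme \<Rightarrow> 'x set \<Rightarrow> (('x \<Rightarrow> 'x) \<Rightarrow> 'k, 'x \<Rightarrow> 'k::field) module" where
  "sum_zero_module G \<Omega> = (permutation_module G \<Omega>)
     \<lparr>carrier := {v \<in> carrier (permutation_module G \<Omega>). (\<Sum>x\<in>\<Omega>. v x) = 0}\<rparr>"

definition principal_block :: "('g, 'c) monoid_scheme \<Rightarrow> ('g \<Rightarrow> 'k::field) set" where
  "principal_block G =
     (THE B. belongs_to_block (group_algebra G) (trivial_module G :: ('g \<Rightarrow> 'k, 'k) module) B)"


section \<open>The group \<open>SL\<^sub>2(F)\<close> for a subfield \<open>F\<close> of \<open>k\<close>\<close>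

abbreviation subfield_ring :: "'k::field set \<Rightarrow> 'k ring" where
  "subfield_ring F \<equiv> ring_of_type_algebra\<lparr>carrier := F\<rparr>"

definition SL2 :: "'k::field set \<Rightarrow> ('k^2^2) monoid" where
  "SL2 F = \<lparr>carrier = {A. (\<forall>i j. A $ i $ j \<in> F) \<and> det A = 1}, monoid.mult = (**), monoid.one = mat 1\<rparr>"

end

theory Submission
  imports Defs
begin

text \<open>
  Write \<open>A = kA\<^sub>5\<close> and let \<open>e = \<Sum>\<^sub>u (fix(u) + 1) u\<close>, where \<open>fix(u)\<close> is the number of fixed points of
  \<open>u\<close> on \<open>{1,...,5}\<close>. The coefficients are those of the block idempotent of the character
  \<open>fix - 1\<close> of degree 4, which has defect zero at the prime 2. The element \<open>e\<close> is a central
  idempotent (\<open>block_idem_central\<close>) which acts as the identity on \<open>S\<^sub>4\<close> and as zero on \<open>S\<^sub>1\<close>, \<open>S\<^sub>2\<close>, \<open>S\<^sub>3\<close>.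
  The structure constants of the class sums modulo 2 show that the only central idempotents are
  \<open>0\<close>, \<open>1\<close>, \<open>e\<close>, \<open>1 - e\<close> (\<open>class_function_idempotent\<close>). Hence there are exactly two blocks, \<open>Ae\<close> and
  \<open>A(1 - e)\<close>, and the second is the principal one.

  A projective cover \<open>P\<close> of a simple module \<open>S\<close> is indecomposable, so a central idempotent acts on \<open>P\<close>
  as zero or as one, and it acts on \<open>S\<close> in the same way. This places \<open>P\<^sub>1\<close>, \<open>P\<^sub>2\<close>, \<open>P\<^sub>3\<close> and \<open>P\<^sub>4\<close>.

  It remains to see that for a primitive idempotent \<open>f\<close> the module \<open>Af\<close> is one of the \<open>P\<^sub>i\<close>. If \<open>f\<close> acts
  nontrivially on \<open>S\<^sub>i\<close>, then \<open>Af\<close> is isomorphic to \<open>P\<^sub>i\<close> (\<open>primitive_ideal_is_cover\<close>). So what has to be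
  shown is that an idempotent \<open>f\<close> which annihilates all the \<open>S\<^sub>i\<close> is zero (\<open>idempotent_detected\<close>);
  in other words, that \<open>S\<^sub>1,...,S\<^sub>4\<close> are all the simple modules. Let \<open>U\<close> be the stabilizer in
  \<open>SL\<^sub>2(F\<^sub>4)\<close> of a nonzero vector, a Sylow 2-subgroup. The module of functions on \<open>F\<^sub>4\<^sup>2\<close> has a filtration by
  degree whose factors are among the \<open>S\<^sub>i\<close>: monomials are treated one at a time, using that an idempotent
  which maps a function into a space it annihilates also annihilates that function (\<open>killed_step\<close>).
  The functions that are constant on lines come from the permutation module on five points, since
  the stabilizer of a point stabilizes a line (\<open>line_stabilizer\<close>). So \<open>f\<close> annihilates all
  functions on \<open>F\<^sub>4\<^sup>2\<close> (\<open>all_killed\<close>), hence every module generated by a vector fixed by \<open>U\<close>. But if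
  \<open>f\<close> were nonzero, then \<open>Af\<close> would contain a nonzero vector fixed by the 2-group \<open>U\<close>, so \<open>f\<close> would
  annihilate a nonzero submodule of \<open>Af\<close>, which the symmetry of the trace form
  \<open>(a, b) \<mapsto> (ab)(1)\<close> forbids (\<open>f_zero\<close>).
\<close>

no_notation Formal_Power_Series.fps_nth (infixl "$" 75)

section \<open>Group algebras and modules from linear actions\<close>

locale finite_group = group G for G (structure) +
  assumes fin: "finite (carrier G)"
begin

lemma bij_translate:
  assumes "x \<in> carrier G"
  shows "bij_betw (\<lambda>y. x \<otimes> y) (carrier G) (carrier G)"
  using assms
  by (intro bij_betw_byWitness[where f' = "\<lambda>y. inv x \<otimes> y"]) (auto simp: m_assoc[symmetric])

lemma sum_translate:
  assumes "x \<in> carrier G"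
  shows "(\<Sum>y\<in>carrier G. f (x \<otimes> y)) = (\<Sum>y\<in>carrier G. f y)"
  by (rule sum.reindex_bij_betw[OF bij_translate[OF assms]])

lemma bij_inv: "bij_betw (\<lambda>x. inv x) (carrier G) (carrier G)"
  by (intro bij_betw_byWitness[where f' = "\<lambda>y. inv y"]) auto

abbreviation KG :: "('a \<Rightarrow> 'k::field) ring" where "KG \<equiv> group_algebra G"

lemma KG_simps:
  "carrier KG = {a. \<forall>g. g \<notin> carrier G \<longrightarrow> a g = 0}"
  "a \<oplus>\<^bsub>KG\<^esub> b = a + b" "\<zero>\<^bsub>KG\<^esub> = 0"
  "\<one>\<^bsub>KG\<^esub> = (\<lambda>g. if g = \<one> then 1 else 0)"
  by (auto simp: group_algebra_def fun_eq_iff)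

lemma KG_mult:
  "(a \<otimes>\<^bsub>KG\<^esub> b) g = (if g \<in> carrier G then \<Sum>x\<in>carrier G. a x * b (inv x \<otimes> g) else (0::'k::field))"
proof (cases "g \<in> carrier G")
  case True
  then have "{(x, y). x \<in> carrier G \<and> y \<in> carrier G \<and> x \<otimes> y = g} = (\<lambda>x. (x, inv x \<otimes> g)) ` carrier G"
    by (auto simp: m_assoc[symmetric] image_iff)
  moreover have "inj_on (\<lambda>x. (x, inv x \<otimes> g)) (carrier G)"
    by (auto intro: inj_onI)
  ultimately show ?thesis
    using True by (simp add: group_algebra_def sum.reindex)
next
  case False
  then have "{(x, y). x \<in> carrier G \<and> y \<in> carrier G \<and> x \<otimes> y = g} = {}" by auto
  then have "(\<Sum>(x, y)\<in>{(x, y). x \<in> carrier G \<and> y \<in> carrier G \<and> x \<otimes> y = g}. a x * b y) = 0"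
    by (simp only: sum.empty)
  then show ?thesis using False by (simp add: group_algebra_def)
qed

text \<open>A linear extension of a function on the group turns convolution into a double sum. All
  associativity laws below, for the algebra and for its modules, are instances of this identity.\<close>

lemma KG_sum_mult:
  fixes sc :: "'k::field \<Rightarrow> 'v::ab_group_add \<Rightarrow> 'v"
  assumes "vector_space sc"
  shows "(\<Sum>u\<in>carrier G. sc ((a \<otimes>\<^bsub>KG\<^esub> b) u) (v u)) =
    (\<Sum>x\<in>carrier G. \<Sum>y\<in>carrier G. sc (a x * b y) (v (x \<otimes> y)))"
proof -
  interpret vector_space sc by fact
  have "(\<Sum>u\<in>carrier G. sc ((a \<otimes>\<^bsub>KG\<^esub> b) u) (v u)) =
      (\<Sum>u\<in>carrier G. \<Sum>x\<in>carrier G. sc (a x * b (inv x \<otimes> u)) (v u))"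
    by (intro sum.cong refl) (simp add: KG_mult scale_sum_left)
  also have "\<dots> = (\<Sum>x\<in>carrier G. \<Sum>u\<in>carrier G. sc (a x * b (inv x \<otimes> u)) (v u))"
    by (rule sum.swap)
  also have "\<dots> = (\<Sum>x\<in>carrier G. \<Sum>y\<in>carrier G. sc (a x * b y) (v (x \<otimes> y)))"
  proof (rule sum.cong[OF refl])
    fix x assume x: "x \<in> carrier G"
    have "(\<Sum>u\<in>carrier G. sc (a x * b (inv x \<otimes> u)) (v u)) =
      (\<Sum>y\<in>carrier G. sc (a x * b (inv x \<otimes> (x \<otimes> y))) (v (x \<otimes> y)))"
      by (rule sum_translate[OF x, symmetric])
    also have "\<dots> = (\<Sum>y\<in>carrier G. sc (a x * b y) (v (x \<otimes> y)))"
      using x by (intro sum.cong refl) (simp add: m_assoc[symmetric])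
    finally show "(\<Sum>u\<in>carrier G. sc (a x * b (inv x \<otimes> u)) (v u)) =
      (\<Sum>y\<in>carrier G. sc (a x * b y) (v (x \<otimes> y)))" .
  qed
  finally show ?thesis .
qed

lemma vector_space_mult: "vector_space ((*) :: 'k::field \<Rightarrow> 'k \<Rightarrow> 'k)"
  by unfold_locales (auto simp: algebra_simps)

lemma sum_delta_one: "(\<Sum>x\<in>carrier G. (if x = \<one> then 1 else 0) * f x) = (f \<one> :: 'k::field)"
  using fin by (simp add: if_distrib[of "\<lambda>c. c * _"] cong: if_cong)

lemma KG_ring: "ring (KG :: ('a \<Rightarrow> 'k::field) ring)"
proof (rule ringI)
  show "abelian_group (KG :: ('a \<Rightarrow> 'k::field) ring)"
  proof (rule abelian_groupI)
    fix x :: "'a \<Rightarrow> 'k" assume "x \<in> carrier KG"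
    then show "\<exists>y\<in>carrier KG. y \<oplus>\<^bsub>KG\<^esub> x = \<zero>\<^bsub>KG\<^esub>"
      by (intro bexI[of _ "- x"]) (auto simp: KG_simps)
  qed (auto simp: KG_simps algebra_simps)
  show "monoid (KG :: ('a \<Rightarrow> 'k::field) ring)"
  proof (rule monoidI)
    fix a b c :: "'a \<Rightarrow> 'k" assume abc: "a \<in> carrier KG" "b \<in> carrier KG" "c \<in> carrier KG"
    show "a \<otimes>\<^bsub>KG\<^esub> b \<in> carrier KG" by (simp add: KG_simps KG_mult)
    show "a \<otimes>\<^bsub>KG\<^esub> b \<otimes>\<^bsub>KG\<^esub> c = a \<otimes>\<^bsub>KG\<^esub> (b \<otimes>\<^bsub>KG\<^esub> c)"
    proof
      fix g show "(a \<otimes>\<^bsub>KG\<^esub> b \<otimes>\<^bsub>KG\<^esub> c) g = (a \<otimes>\<^bsub>KG\<^esub> (b \<otimes>\<^bsub>KG\<^esub> c)) g"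
      proof (cases "g \<in> carrier G")
        case True
        have "(a \<otimes>\<^bsub>KG\<^esub> b \<otimes>\<^bsub>KG\<^esub> c) g = (\<Sum>u\<in>carrier G. (a \<otimes>\<^bsub>KG\<^esub> b) u * c (inv u \<otimes> g))"
          by (subst KG_mult) (simp add: True)
        also have "\<dots> = (\<Sum>x\<in>carrier G. \<Sum>y\<in>carrier G. a x * b y * c (inv (x \<otimes> y) \<otimes> g))"
          by (rule KG_sum_mult[OF vector_space_mult])
        also have "\<dots> = (\<Sum>x\<in>carrier G. a x * (\<Sum>y\<in>carrier G. b y * c (inv y \<otimes> (inv x \<otimes> g))))"
          unfolding sum_distrib_left using True
          by (intro sum.cong refl) (simp add: inv_mult_group m_assoc)
        also have "\<dots> = (a \<otimes>\<^bsub>KG\<^esub> (b \<otimes>\<^bsub>KG\<^esub> c)) g"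
          unfolding KG_mult using True by (auto intro!: sum.cong)
        finally show ?thesis .
      qed (simp add: KG_mult)
    qed
  next
    fix a :: "'a \<Rightarrow> 'k" assume a: "a \<in> carrier KG"
    show "\<one>\<^bsub>KG\<^esub> \<otimes>\<^bsub>KG\<^esub> a = a"
      using a by (auto simp: fun_eq_iff KG_mult KG_simps sum_delta_one)
    show "a \<otimes>\<^bsub>KG\<^esub> \<one>\<^bsub>KG\<^esub> = a"
    proof
      fix g show "(a \<otimes>\<^bsub>KG\<^esub> \<one>\<^bsub>KG\<^esub>) g = a g"
      proof (cases "g \<in> carrier G")
        case True
        then have "inv x \<otimes> g = \<one> \<longleftrightarrow> x = g" if "x \<in> carrier G" for x
          using that by (metis inv_closed inv_inv inv_equality l_inv)
        then have "(a \<otimes>\<^bsub>KG\<^esub> \<one>\<^bsub>KG\<^esub>) g = (\<Sum>x\<in>carrier G. a x * (if x = g then 1 else 0))"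
          using True by (auto simp: KG_mult KG_simps intro!: sum.cong)
        also have "\<dots> = a g" using True fin by (simp add: if_distrib[of "\<lambda>c. _ * c"] cong: if_cong)
        finally show ?thesis .
      qed (use a in \<open>auto simp: KG_mult KG_simps\<close>)
    qed
  qed (auto simp: KG_simps)
qed (auto simp: KG_simps KG_mult fun_eq_iff algebra_simps sum.distrib)

definition basis :: "'a \<Rightarrow> 'a \<Rightarrow> 'k::field" where
  "basis g h = (if h = g then 1 else 0)"

lemma basis_closed: "g \<in> carrier G \<Longrightarrow> basis g \<in> carrier KG"
  by (auto simp: KG_simps basis_def)

lemma basis_mult_left:
  assumes "g \<in> carrier G" "a \<in> carrier KG"
  shows "basis g \<otimes>\<^bsub>KG\<^esub> a = (\<lambda>h. if h \<in> carrier G then a (inv g \<otimes> h) else (0::'k::field))"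
  using assms fin by (auto simp: KG_mult fun_eq_iff basis_def if_distrib[of "\<lambda>c. c * _"] cong: if_cong)

lemma mult_basis_right:
  assumes "g \<in> carrier G" "a \<in> carrier KG"
  shows "a \<otimes>\<^bsub>KG\<^esub> basis g = (\<lambda>h. if h \<in> carrier G then a (h \<otimes> inv g) else (0::'k::field))"
proof
  fix h show "(a \<otimes>\<^bsub>KG\<^esub> basis g) h = (if h \<in> carrier G then a (h \<otimes> inv g) else (0::'k::field))"
  proof (cases "h \<in> carrier G")
    case True
    have "inv x \<otimes> h = g \<longleftrightarrow> x = h \<otimes> inv g" if "x \<in> carrier G" for x
      using that True assms(1) by (metis inv_closed inv_solve_left inv_solve_right m_closed)
    then have "(a \<otimes>\<^bsub>KG\<^esub> basis g) h = (\<Sum>x\<in>carrier G. a x * (if x = h \<otimes> inv g then 1 else 0))"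
      using True by (auto simp: KG_mult basis_def intro!: sum.cong)
    also have "\<dots> = a (h \<otimes> inv g)"
      using True assms(1) fin by (simp add: if_distrib[of "\<lambda>c. _ * c"] cong: if_cong)
    finally show ?thesis using True by simp
  qed (simp add: KG_mult)
qed

text \<open>The coefficient at \<open>\<one>\<close> is a trace on the group algebra; it makes the algebra symmetric.\<close>

lemma KG_symmetric:
  "(a \<otimes>\<^bsub>KG\<^esub> b) \<one> = (b \<otimes>\<^bsub>KG\<^esub> a) \<one>"
proof -
  have "(a \<otimes>\<^bsub>KG\<^esub> b) \<one> = (\<Sum>x\<in>carrier G. a x * b (inv x))"
    by (simp add: KG_mult)
  also have "\<dots> = (\<Sum>x\<in>carrier G. a (inv x) * b (inv (inv x)))"
    by (rule sum.reindex_bij_betw[OF bij_inv, symmetric])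
  also have "\<dots> = (b \<otimes>\<^bsub>KG\<^esub> a) \<one>" by (simp add: KG_mult mult.commute)
  finally show ?thesis .
qed

end

text \<open>The scalars act on the whole type \<open>'v\<close> and the module may be a proper subspace \<open>V\<close>; the
  sum zero vectors inside all functions need this.\<close>

locale linear_rep = finite_group G + vs: vector_space sc
  for G :: "('a, 'c) monoid_scheme" (structure) and sc :: "'k::field \<Rightarrow> 'v::ab_group_add \<Rightarrow> 'v" +
  fixes V :: "'v set" and act :: "'a \<Rightarrow> 'v \<Rightarrow> 'v"
  assumes subspace: "vs.subspace V"
    and act_closed: "g \<in> carrier G \<Longrightarrow> v \<in> V \<Longrightarrow> act g v \<in> V"
    and act_add: "g \<in> carrier G \<Longrightarrow> act g (v + w) = act g v + act g w"
    and act_scale: "g \<in> carrier G \<Longrightarrow> act g (sc c v) = sc c (act g v)"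
    and act_mult: "g \<in> carrier G \<Longrightarrow> h \<in> carrier G \<Longrightarrow> act (g \<otimes> h) v = act g (act h v)"
    and act_one: "act \<one> v = v"
begin

abbreviation M :: "('a \<Rightarrow> 'k, 'v) module" where "M \<equiv> linear_module G V sc act"

lemma M_simps:
  "carrier M = V" "x \<oplus>\<^bsub>M\<^esub> y = x + y" "\<zero>\<^bsub>M\<^esub> = 0"
  "a \<odot>\<^bsub>M\<^esub> v = (\<Sum>g\<in>carrier G. sc (a g) (act g v))"
  by (simp_all add: linear_module_def)

lemma act_sum: "g \<in> carrier G \<Longrightarrow> act g (\<Sum>i\<in>I. f i) = (\<Sum>i\<in>I. act g (f i))"
proof (induction I rule: infinite_finite_induct)
  have z: "g \<in> carrier G \<Longrightarrow> act g 0 = 0" using act_add[of g 0 0] by simp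
  case (infinite A) then show ?case using z by simp
next
  case empty
  then show ?case using act_add[of g 0 0] by simp
qed (auto simp: act_add)

lemma abelian_group_M: "abelian_group M"
proof (rule abelian_groupI)
  fix x assume "x \<in> carrier M"
  then show "\<exists>y\<in>carrier M. y \<oplus>\<^bsub>M\<^esub> x = \<zero>\<^bsub>M\<^esub>"
    by (intro bexI[of _ "- x"]) (auto simp: M_simps vs.subspace_neg[OF subspace])
qed (auto simp: M_simps vs.subspace_add[OF subspace] vs.subspace_0[OF subspace] algebra_simps)

lemma smult_closed_M: "v \<in> V \<Longrightarrow> a \<odot>\<^bsub>M\<^esub> v \<in> V"
  unfolding M_simps
  by (intro vs.subspace_sum[OF subspace] vs.subspace_scale[OF subspace] act_closed)

lemma left_module_M: "left_module (group_algebra G) M"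
proof -
  interpret R: ring "KG :: ('a \<Rightarrow> 'k) ring" by (rule KG_ring)
  interpret N: abelian_group M by (rule abelian_group_M)
  show ?thesis
  proof (intro left_module.intro left_module_axioms.intro R.ring_axioms N.abelian_group_axioms)
    fix a b :: "'a \<Rightarrow> 'k" and x y
    show "x \<in> carrier M \<Longrightarrow> a \<odot>\<^bsub>M\<^esub> x \<in> carrier M"
      using smult_closed_M by (simp add: M_simps(1))
    show "(a \<oplus>\<^bsub>KG\<^esub> b) \<odot>\<^bsub>M\<^esub> x = a \<odot>\<^bsub>M\<^esub> x \<oplus>\<^bsub>M\<^esub> b \<odot>\<^bsub>M\<^esub> x"
      by (simp add: M_simps KG_simps vs.scale_left_distrib sum.distrib)
    show "a \<odot>\<^bsub>M\<^esub> (x \<oplus>\<^bsub>M\<^esub> y) = a \<odot>\<^bsub>M\<^esub> x \<oplus>\<^bsub>M\<^esub> a \<odot>\<^bsub>M\<^esub> y"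
      by (simp add: M_simps act_add vs.scale_right_distrib sum.distrib)
    show "(a \<otimes>\<^bsub>KG\<^esub> b) \<odot>\<^bsub>M\<^esub> x = a \<odot>\<^bsub>M\<^esub> (b \<odot>\<^bsub>M\<^esub> x)"
      unfolding M_simps KG_sum_mult[OF vs.vector_space_axioms]
      by (intro sum.cong refl) (simp add: act_sum act_mult act_scale vs.scale_sum_right)
    show "\<one>\<^bsub>KG\<^esub> \<odot>\<^bsub>M\<^esub> x = x"
    proof -
      have "\<one>\<^bsub>KG\<^esub> \<odot>\<^bsub>M\<^esub> x = (\<Sum>g\<in>carrier G. if g = \<one> then act g x else 0)"
        unfolding M_simps KG_simps by (intro sum.cong refl) auto
      then show ?thesis using fin by (simp add: act_one)
    qed
  qed
qed

lemma basis_smult: "g \<in> carrier G \<Longrightarrow> basis g \<odot>\<^bsub>M\<^esub> v = act g v"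
proof -
  assume g: "g \<in> carrier G"
  have "basis g \<odot>\<^bsub>M\<^esub> v = (\<Sum>h\<in>carrier G. if h = g then act h v else 0)"
    unfolding M_simps basis_def by (intro sum.cong refl) auto
  then show ?thesis using fin g by simp
qed

lemma scalar_smult: "(\<lambda>h. if h = \<one> then c else 0) \<odot>\<^bsub>M\<^esub> v = sc c v"
proof -
  have "(\<lambda>h. if h = \<one> then c else 0) \<odot>\<^bsub>M\<^esub> v = (\<Sum>h\<in>carrier G. if h = \<one> then sc c (act h v) else 0)"
    unfolding M_simps by (intro sum.cong refl) auto
  then show ?thesis using fin by (simp add: act_one)
qed

text \<open>Submodules are subspaces because the group algebra contains the scalars, and they are invariant
  because it contains the group.\<close>

lemma submodule_invariant:
  assumes "submodule U (group_algebra G) M"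
  shows "U \<subseteq> V" "vs.subspace U" "\<And>g v. g \<in> carrier G \<Longrightarrow> v \<in> U \<Longrightarrow> act g v \<in> U"
    "\<And>a v. a \<in> carrier KG \<Longrightarrow> v \<in> U \<Longrightarrow> a \<odot>\<^bsub>M\<^esub> v \<in> U"
proof -
  interpret submodule U "group_algebra G" M by fact
  show sub: "U \<subseteq> V" using subset by (simp add: M_simps)
  show sm: "\<And>a v. a \<in> carrier KG \<Longrightarrow> v \<in> U \<Longrightarrow> a \<odot>\<^bsub>M\<^esub> v \<in> U"
    using smult_closed by blast
  show "\<And>g v. g \<in> carrier G \<Longrightarrow> v \<in> U \<Longrightarrow> act g v \<in> U"
    using sm basis_smult basis_closed by metis
  show "vs.subspace U"
  proof (rule vs.subspaceI)
    show "0 \<in> U" using one_closed by (simp add: M_simps)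
    show "\<And>x y. x \<in> U \<Longrightarrow> y \<in> U \<Longrightarrow> x + y \<in> U" using m_closed by (simp add: M_simps)
    show "sc c x \<in> U" if "x \<in> U" for c x
      using sm[of "\<lambda>h. if h = \<one> then c else 0" x] that one_closed 
      by (auto simp: scalar_smult KG_simps)
  qed
qed

end

lemma (in finite_group) basis_mult:
  assumes "g \<in> carrier G" "h \<in> carrier G"
  shows "basis g \<otimes>\<^bsub>KG\<^esub> basis h = (basis (g \<otimes> h) :: 'a \<Rightarrow> 'k::field)"
proof -
  have "inv g \<otimes> u = h \<longleftrightarrow> u = g \<otimes> h" if "u \<in> carrier G" for u
    using inv_solve_left[of h g u] assms that by auto
  then show ?thesis
    using assms by (auto simp: basis_mult_left basis_closed fun_eq_iff basis_def)
qed

lemma (in finite_group) basis_one: "basis \<one> = \<one>\<^bsub>KG\<^esub>"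
  by (auto simp: KG_simps basis_def fun_eq_iff)

section \<open>Simple modules and projective covers\<close>

lemma (in left_module) smult_zero_right:
  assumes "a \<in> carrier R" shows "a \<odot>\<^bsub>M\<^esub> \<zero>\<^bsub>M\<^esub> = \<zero>\<^bsub>M\<^esub>"
proof -
  have "a \<odot>\<^bsub>M\<^esub> \<zero>\<^bsub>M\<^esub> \<oplus>\<^bsub>M\<^esub> a \<odot>\<^bsub>M\<^esub> \<zero>\<^bsub>M\<^esub> = a \<odot>\<^bsub>M\<^esub> \<zero>\<^bsub>M\<^esub>"
    using smult_r_distr[OF assms, of "\<zero>\<^bsub>M\<^esub>" "\<zero>\<^bsub>M\<^esub>"] by simp
  then show ?thesis using smult_closed[OF assms, of "\<zero>\<^bsub>M\<^esub>"]
    by (metis M.add.r_cancel_one' M.zero_closed)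
qed

lemma (in left_module) smult_zero_left:
  assumes "x \<in> carrier M" shows "\<zero>\<^bsub>R\<^esub> \<odot>\<^bsub>M\<^esub> x = \<zero>\<^bsub>M\<^esub>"
proof -
  have "\<zero>\<^bsub>R\<^esub> \<odot>\<^bsub>M\<^esub> x \<oplus>\<^bsub>M\<^esub> \<zero>\<^bsub>R\<^esub> \<odot>\<^bsub>M\<^esub> x = \<zero>\<^bsub>R\<^esub> \<odot>\<^bsub>M\<^esub> x"
    using smult_l_distr[of "\<zero>\<^bsub>R\<^esub>" "\<zero>\<^bsub>R\<^esub>" x] assms by simp
  then show ?thesis using smult_closed[of "\<zero>\<^bsub>R\<^esub>" x] assms
    by (metis M.add.r_cancel_one' R.zero_closed)
qed

lemma (in left_module) submodule_criterion:
  assumes "H \<subseteq> carrier M" "\<zero>\<^bsub>M\<^esub> \<in> H" "\<And>x y. x \<in> H \<Longrightarrow> y \<in> H \<Longrightarrow> x \<oplus>\<^bsub>M\<^esub> y \<in> H"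
    "\<And>a x. a \<in> carrier R \<Longrightarrow> x \<in> H \<Longrightarrow> a \<odot>\<^bsub>M\<^esub> x \<in> H"
  shows "submodule H R M"
proof (intro submodule.intro subgroup.intro submodule_axioms.intro)
  fix x assume x: "x \<in> H"
  have xc: "x \<in> carrier M" using x assms(1) by blast
  have "(\<ominus>\<^bsub>R\<^esub> \<one>\<^bsub>R\<^esub>) \<odot>\<^bsub>M\<^esub> x \<oplus>\<^bsub>M\<^esub> x = (\<ominus>\<^bsub>R\<^esub> \<one>\<^bsub>R\<^esub> \<oplus>\<^bsub>R\<^esub> \<one>\<^bsub>R\<^esub>) \<odot>\<^bsub>M\<^esub> x"
    using smult_l_distr[of "\<ominus>\<^bsub>R\<^esub> \<one>\<^bsub>R\<^esub>" "\<one>\<^bsub>R\<^esub>" x] smult_one xc by simp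
  also have "\<dots> = \<zero>\<^bsub>M\<^esub>" by (simp add: R.l_neg smult_zero_left xc)
  finally have "\<ominus>\<^bsub>M\<^esub> x = (\<ominus>\<^bsub>R\<^esub> \<one>\<^bsub>R\<^esub>) \<odot>\<^bsub>M\<^esub> x"
    using xc smult_closed by (intro M.minus_equality) auto
  then have "\<ominus>\<^bsub>M\<^esub> x \<in> H" using assms(4)[OF _ x] by simp
  then show "inv\<^bsub>add_monoid M\<^esub> x \<in> H" by (simp add: a_inv_def)
qed (use assms in auto)

lemma left_module_hom_zero:
  assumes "left_module R M" "left_module R N" "h \<in> module_hom R M N"
  shows "h \<zero>\<^bsub>M\<^esub> = \<zero>\<^bsub>N\<^esub>"
proof -
  interpret M: left_module R M by fact
  interpret N: left_module R N by fact
  have "h (\<zero>\<^bsub>R\<^esub> \<odot>\<^bsub>M\<^esub> \<zero>\<^bsub>M\<^esub>) = \<zero>\<^bsub>R\<^esub> \<odot>\<^bsub>N\<^esub> h \<zero>\<^bsub>M\<^esub>"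
    using assms(3) by (auto simp: module_hom_def)
  moreover have "h \<zero>\<^bsub>M\<^esub> \<in> carrier N" using assms(3) by (auto simp: module_hom_def)
  ultimately show ?thesis by (simp add: M.smult_zero_left N.smult_zero_left)
qed

lemma submodule_image:
  assumes "left_module R M" "left_module R N" "h \<in> module_hom R M N" "submodule U R M"
  shows "submodule (h ` U) R N"
proof -
  interpret M: left_module R M by fact
  interpret N: left_module R N by fact
  interpret U: submodule U R M by fact
  have Uc: "U \<subseteq> carrier M" using U.subset by simp
  show ?thesis
  proof (rule N.submodule_criterion)
    show "h ` U \<subseteq> carrier N" using Uc assms(3) by (auto simp: module_hom_def)
    show "\<zero>\<^bsub>N\<^esub> \<in> h ` U" 
      using left_module_hom_zero[OF assms(1-3)] U.one_closed by (auto intro!: image_eqI[of _ _ "\<zero>\<^bsub>M\<^esub>"])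
    fix x y assume "x \<in> h ` U" "y \<in> h ` U"
    then obtain u v where uv: "x = h u" "y = h v" "u \<in> U" "v \<in> U" by blast
    then have "x \<oplus>\<^bsub>N\<^esub> y = h (u \<oplus>\<^bsub>M\<^esub> v)" using assms(3) subsetD[OF Uc] by (simp add: module_hom_def)
    then show "x \<oplus>\<^bsub>N\<^esub> y \<in> h ` U" using U.m_closed[OF uv(3,4)] by simp
  next
    fix a x assume a: "a \<in> carrier R" "x \<in> h ` U"
    then obtain u where u: "x = h u" "u \<in> U" by blast
    then have "a \<odot>\<^bsub>N\<^esub> x = h (a \<odot>\<^bsub>M\<^esub> u)" using assms(3) subsetD[OF Uc] a by (simp add: module_hom_def)
    then show "a \<odot>\<^bsub>N\<^esub> x \<in> h ` U" using U.smult_closed[OF a(1) u(2)] by simp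
  qed
qed

definition simple_module :: "('a, 'c) ring_scheme \<Rightarrow> ('a, 'm) module \<Rightarrow> bool" where
  "simple_module R S \<longleftrightarrow> left_module R S \<and> carrier S \<noteq> {\<zero>\<^bsub>S\<^esub>} \<and>
     (\<forall>U. submodule U R S \<longrightarrow> U = {\<zero>\<^bsub>S\<^esub>} \<or> U = carrier S)"

lemma submodule_zero_mem: "submodule U R M \<Longrightarrow> \<zero>\<^bsub>M\<^esub> \<in> U"
  using subgroup.one_closed[OF submodule.axioms(1)] by fastforce

lemma submodule_subset: "submodule U R M \<Longrightarrow> U \<subseteq> carrier M"
  using subgroup.subset[OF submodule.axioms(1)] by fastforce

text \<open>If \<open>P = U \<oplus> V\<close>, one of the two summands has nonzero image in the simple module, hence full image,
  hence is all of \<open>P\<close> because the epimorphism is essential.\<close>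

lemma projective_cover_simple_indecomposable:
  assumes "simple_module R S" "projective_cover R P S"
  shows "indecomposable_module R P"
proof -
  obtain h where h: "essential_epi R P S h" and P: "left_module R P"
    using assms(2) by (auto simp: projective_cover_def projective_module_def)
  have S: "left_module R S" using assms(1) by (simp add: simple_module_def)
  interpret P: left_module R P by fact
  interpret S: left_module R S by fact
  have hh: "h \<in> module_hom R P S" "h ` carrier P = carrier S" using h by (auto simp: essential_epi_def)
  have h0: "h \<zero>\<^bsub>P\<^esub> = \<zero>\<^bsub>S\<^esub>" by (rule left_module_hom_zero[OF P S hh(1)])
  show ?thesis
    unfolding indecomposable_module_def
  proof (intro conjI allI impI P)
    show "carrier P \<noteq> {\<zero>\<^bsub>P\<^esub>}"
    proof
      assume "carrier P = {\<zero>\<^bsub>P\<^esub>}"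
      then have "carrier S = {\<zero>\<^bsub>S\<^esub>}" using hh(2) h0 by simp
      then show False using assms(1) by (simp add: simple_module_def)
    qed
    fix U V assume "internal_direct_sum R P U V"
    then have UV: "submodule U R P" "submodule V R P" "U <+>\<^bsub>P\<^esub> V = carrier P" "U \<inter> V = {\<zero>\<^bsub>P\<^esub>}"
      by (auto simp: internal_direct_sum_def)
    have full: "W = carrier P" if "submodule W R P" "h ` W \<noteq> {\<zero>\<^bsub>S\<^esub>}" for W
      using that submodule_image[OF P S hh(1) that(1)] assms(1) h
      unfolding simple_module_def essential_epi_def by metis
    show "U = {\<zero>\<^bsub>P\<^esub>} \<or> V = {\<zero>\<^bsub>P\<^esub>}"
    proof (cases "h ` U = {\<zero>\<^bsub>S\<^esub>} \<and> h ` V = {\<zero>\<^bsub>S\<^esub>}")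
      case False
      then have "U = carrier P \<or> V = carrier P" using full UV by blast
      then show ?thesis using UV submodule_subset by blast
    next
      case True
      have "x = \<zero>\<^bsub>S\<^esub>" if x: "x \<in> carrier S" for x
      proof -
        obtain p where p: "p \<in> carrier P" "x = h p" using x hh(2) by blast
        then obtain u v where uv: "u \<in> U" "v \<in> V" "p = u \<oplus>\<^bsub>P\<^esub> v"
          using UV(3) unfolding set_add_def set_mult_def by fastforce
        then have "h p = h u \<oplus>\<^bsub>S\<^esub> h v"
          using hh(1) subsetD[OF submodule_subset[OF UV(1)]] subsetD[OF submodule_subset[OF UV(2)]]
          by (simp add: module_hom_def)
        also have "\<dots> = \<zero>\<^bsub>S\<^esub>"
        proof -
          have "h u = \<zero>\<^bsub>S\<^esub>" "h v = \<zero>\<^bsub>S\<^esub>" using True uv by auto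
          then show ?thesis by simp
        qed
        finally show ?thesis using p by simp
      qed
      then have "carrier S = {\<zero>\<^bsub>S\<^esub>}" by auto
      then show ?thesis using assms(1) by (simp add: simple_module_def)
    qed
  qed
qed

lemma carrier_left_ideal_module: "carrier (left_ideal_module R a) = PIdl\<^bsub>R\<^esub> a"
  by (simp add: regular_module_def)

lemma (in ring) PIdl_idempotent:
  assumes "idempotent R f"
  shows "PIdl\<^bsub>R\<^esub> f = {x \<in> carrier R. x \<otimes> f = x}"
  using assms by (force simp: cgenideal_def idempotent_def m_assoc)

lemma free_module_simps:
  "x \<oplus>\<^bsub>free_module R I\<^esub> y = (\<lambda>i. x i \<oplus>\<^bsub>R\<^esub> y i)" "\<zero>\<^bsub>free_module R I\<^esub> = (\<lambda>i. \<zero>\<^bsub>R\<^esub>)"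
  "r \<odot>\<^bsub>free_module R I\<^esub> x = (\<lambda>i. r \<otimes>\<^bsub>R\<^esub> x i)"
  by (simp_all add: free_module_def)

lemma (in ring) free_module_left_module: "left_module R (free_module R I)"
proof -
  let ?F = "free_module R I"
  have fin: "finite {i. x i \<oplus> y i \<noteq> \<zero>}" if "x \<in> carrier ?F" "y \<in> carrier ?F" for x y
    by (rule finite_subset[of _ "{i. x i \<noteq> \<zero>} \<union> {i. y i \<noteq> \<zero>}"])
       (use that in \<open>auto simp: free_module_def\<close>)
  have carr: "x i \<in> carrier R" if "x \<in> carrier ?F" for x i
    using that by (cases "i \<in> I") (auto simp: free_module_def)
  interpret F: abelian_group ?F
  proof (rule abelian_groupI)
    show "\<And>x y. x \<in> carrier ?F \<Longrightarrow> y \<in> carrier ?F \<Longrightarrow> x \<oplus>\<^bsub>?F\<^esub> y \<in> carrier ?F"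
      using fin by (auto simp: free_module_def)
    show "\<zero>\<^bsub>?F\<^esub> \<in> carrier ?F" by (auto simp: free_module_def)
    fix x assume x: "x \<in> carrier ?F"
    have "finite {i. \<ominus> x i \<noteq> \<zero>}"
      by (rule finite_subset[of _ "{i. x i \<noteq> \<zero>}"]) (use x in \<open>auto simp: free_module_def\<close>)
    then show "\<exists>y\<in>carrier ?F. y \<oplus>\<^bsub>?F\<^esub> x = \<zero>\<^bsub>?F\<^esub>"
      using x carr[OF x] by (intro bexI[of _ "\<lambda>i. \<ominus> x i"]) (auto simp: free_module_def l_neg)
  qed (auto simp: free_module_simps fun_eq_iff carr a_ac)
  show ?thesis
  proof (intro left_module.intro left_module_axioms.intro ring_axioms F.abelian_group_axioms)
    fix a x assume a: "a \<in> carrier R" "x \<in> carrier ?F"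
    have "finite {i. a \<otimes> x i \<noteq> \<zero>}"
      by (rule finite_subset[of _ "{i. x i \<noteq> \<zero>}"]) (use a in \<open>auto simp: free_module_def\<close>)
    then show "a \<odot>\<^bsub>?F\<^esub> x \<in> carrier ?F" using a by (auto simp: free_module_def)
  qed (auto simp: free_module_simps fun_eq_iff carr l_distr r_distr m_assoc)
qed

text \<open>A dual basis for a cyclic projective module \<open>Rq\<close>. Embed it as a direct summand of a free module; the
  \<open>x i\<close> are the coordinates of \<open>q\<close>, and the projections of the basis vectors to the summand are
  multiples \<open>a i\<close> of \<open>q\<close>. Expanding \<open>q\<close> in the basis and projecting gives the last
  equation, coordinate by coordinate. Only the finitely many indices with \<open>x i \<noteq> 0\<close> matter.\<close>

lemma (in ring) projective_cyclic_coordinates: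
  fixes P :: "('a, 'p) module"
  assumes P: "projective_module R P" and q: "q \<in> carrier P"
    and gen: "carrier P = (\<lambda>a. a \<odot>\<^bsub>P\<^esub> q) ` carrier R"
  obtains J :: "'p set" and x a where "finite J" "\<And>i. i \<in> J \<Longrightarrow> x i \<in> carrier R" "\<And>i. i \<in> J \<Longrightarrow> a i \<in> carrier R"
    "\<And>b. b \<in> carrier R \<Longrightarrow> b \<odot>\<^bsub>P\<^esub> q = \<zero>\<^bsub>P\<^esub> \<longleftrightarrow> (\<forall>i\<in>J. b \<otimes> x i = \<zero>)"
    "\<And>b. b \<in> carrier R \<Longrightarrow> b \<odot>\<^bsub>P\<^esub> q = q \<Longrightarrow> \<forall>i\<in>J. b \<otimes> x i = x i"
    "\<And>i. i \<in> J \<Longrightarrow> x i = (\<Oplus>j\<in>J. x j \<otimes> a j) \<otimes> x i"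
proof -
  interpret P: left_module R P using P by (simp add: projective_module_def)
  obtain I :: "'p set" and U V \<theta> where ids: "internal_direct_sum R (free_module R I) U V"
    and \<theta>: "\<theta> \<in> module_hom R P ((free_module R I)\<lparr>carrier := U\<rparr>)" "bij_betw \<theta> (carrier P) U"
    using P unfolding projective_module_def module_isomorphic_def by auto
  let ?F = "free_module R I"
  interpret F: left_module R ?F by (rule free_module_left_module)
  have UV: "submodule U R ?F" "submodule V R ?F" "U <+>\<^bsub>?F\<^esub> V = carrier ?F" "U \<inter> V = {\<zero>\<^bsub>?F\<^esub>}"
    using ids by (auto simp: internal_direct_sum_def)
  interpret U: submodule U R ?F by fact
  interpret V: submodule V R ?F by fact
  have Uc: "U \<subseteq> carrier ?F" and Vc: "V \<subseteq> carrier ?F"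
    by (rule submodule_subset[OF UV(1)], rule submodule_subset[OF UV(2)])
  have carr: "y i \<in> carrier R" if "y \<in> carrier ?F" for y i
    using that by (cases "i \<in> I") (auto simp: free_module_def)
  define x where "x = \<theta> q"
  have xU: "x \<in> U" using \<theta>(2) q by (auto simp: x_def bij_betw_def)
  have xc: "x \<in> carrier ?F" using xU Uc by blast
  define J where "J = {i. x i \<noteq> \<zero>}"
  have J: "finite J" "J \<subseteq> I" using xc by (auto simp: J_def free_module_def)
  have \<theta>_smult: "\<theta> (b \<odot>\<^bsub>P\<^esub> q) = (\<lambda>i. b \<otimes> x i)" if "b \<in> carrier R" for b
    using \<theta>(1) q that by (auto simp: module_hom_def x_def free_module_simps)
  have "\<exists>u v. u \<in> U \<and> v \<in> V \<and> (\<lambda>j. if j = i then \<one> else \<zero>) = (\<lambda>j. u j \<oplus> v j)" if "i \<in> J" for i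
  proof -
    have "(\<lambda>j. if j = i then \<one> else \<zero>) \<in> carrier ?F" 
      using that J by (auto simp: free_module_def)
    then show ?thesis unfolding UV(3)[symmetric]
      by (auto simp: set_add_def set_mult_def free_module_simps)
  qed
  then obtain u v where u: "\<And>i. i \<in> J \<Longrightarrow> u i \<in> U" and v: "\<And>i. i \<in> J \<Longrightarrow> v i \<in> V"
    and uv: "\<And>i. i \<in> J \<Longrightarrow> (\<lambda>j. if j = i then \<one> else \<zero>) = (\<lambda>j. u i j \<oplus> v i j)"
    by metis
  have uc: "u i j \<in> carrier R" and vc: "v i j \<in> carrier R" if "i \<in> J" for i j
    using u v that Uc Vc carr by blast+
  have xcr: "x i \<in> carrier R" for i using carr xc by blast
  have comb: "(\<lambda>j. \<Oplus>i\<in>K. x i \<otimes> w i j) \<in> W"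
    if W: "submodule W R ?F" "\<And>i. i \<in> J \<Longrightarrow> w i \<in> W" and K: "K \<subseteq> J" for K W w
  proof -
    have "finite K" using K J finite_subset by blast
    then show ?thesis using K
    proof (induction K)
      case empty
      then show ?case using submodule_zero_mem[OF W(1)] by (simp add: free_module_simps)
    next
      case (insert i K)
      interpret W: submodule W R ?F by fact
      have Wc: "W \<subseteq> carrier ?F" by (rule submodule_subset[OF W(1)])
      have c: "x i \<otimes> w i j \<in> carrier R" if "i \<in> J" for i j using xcr carr W(2) Wc that by blast
      have "(\<lambda>j. \<Oplus>i\<in>insert i K. x i \<otimes> w i j) = x i \<odot>\<^bsub>?F\<^esub> w i \<oplus>\<^bsub>?F\<^esub> (\<lambda>j. \<Oplus>i\<in>K. x i \<otimes> w i j)"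
        unfolding free_module_simps using insert c by (intro ext finsum_insert) auto
      moreover have "x i \<odot>\<^bsub>?F\<^esub> w i \<in> W" using W.smult_closed[OF xcr W(2)] insert.prems by blast
      ultimately show ?case using W.m_closed insert by simp
    qed
  qed
  define xu where "xu = (\<lambda>j. \<Oplus>i\<in>J. x i \<otimes> u i j)"
  define xv where "xv = (\<lambda>j. \<Oplus>i\<in>J. x i \<otimes> v i j)"
  have xuU: "xu \<in> U" and xvV: "xv \<in> V" unfolding xu_def xv_def using comb UV u v by auto
  have x_split: "x j = xu j \<oplus> xv j" for j
  proof -
    have "xu j \<oplus> xv j = (\<Oplus>i\<in>J. x i \<otimes> u i j \<oplus> x i \<otimes> v i j)"
      unfolding xu_def xv_def using xcr uc vc by (intro finsum_addf[symmetric]) auto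
    also have "\<dots> = (\<Oplus>i\<in>J. if i = j then x i else \<zero>)"
    proof (rule finsum_cong')
      fix i assume i: "i \<in> J"
      have "x i \<otimes> u i j \<oplus> x i \<otimes> v i j = x i \<otimes> (u i j \<oplus> v i j)"
        using xcr uc vc i by (simp add: r_distr)
      also have "u i j \<oplus> v i j = (if j = i then \<one> else \<zero>)" using fun_cong[OF uv[OF i], of j] by simp
      finally show "x i \<otimes> u i j \<oplus> x i \<otimes> v i j = (if i = j then x i else \<zero>)" using xcr by auto
    qed (use xcr in auto)
    also have "\<dots> = x j"
    proof (cases "j \<in> J")
      case True
      then show ?thesis using finsum_singleton[OF True J(1), of x] xcr by (simp add: eq_commute)
    next
      case False
      then have "(\<Oplus>i\<in>J. if i = j then x i else \<zero>) = (\<Oplus>i\<in>J. \<zero>)"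
        by (intro finsum_cong') auto
      then show ?thesis using False by (simp add: J_def)
    qed
    finally show ?thesis by simp
  qed
  (* the difference lies in both summands *)
  have x_eq: "xu = x"
  proof -
    have "xv = x \<oplus>\<^bsub>?F\<^esub> (\<ominus>\<^bsub>R\<^esub> \<one>) \<odot>\<^bsub>?F\<^esub> xu"
    proof
      fix j
      have c: "xu j \<in> carrier R" "xv j \<in> carrier R" using xuU xvV Uc Vc carr by blast+
      then show "xv j = (x \<oplus>\<^bsub>?F\<^esub> (\<ominus>\<^bsub>R\<^esub> \<one>) \<odot>\<^bsub>?F\<^esub> xu) j"
        unfolding free_module_simps x_split by (simp add: l_minus a_assoc a_comm[of "xv j"] r_neg1 r_neg2)
    qed
    moreover have "(\<ominus>\<^bsub>R\<^esub> \<one>) \<odot>\<^bsub>?F\<^esub> xu \<in> U" using U.smult_closed xuU by simp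
    ultimately have "xv \<in> U" using U.m_closed xU by simp
    then have "xv = (\<lambda>i. \<zero>)" using xvV UV(4) by (auto simp: free_module_simps)
    then have "x j = xu j" for j using x_split[of j] xuU Uc carr by auto
    then show ?thesis by auto
  qed
  have "\<exists>a\<in>carrier R. u i = (\<lambda>j. a \<otimes> x j)" if i: "i \<in> J" for i
  proof -
    obtain p where p: "p \<in> carrier P" "u i = \<theta> p" using u[OF i] \<theta>(2) by (auto simp: bij_betw_def)
    then obtain a where a: "a \<in> carrier R" "p = a \<odot>\<^bsub>P\<^esub> q" using gen by blast
    then show ?thesis using \<theta>_smult p by auto
  qed
  then obtain a where a: "\<And>i. i \<in> J \<Longrightarrow> a i \<in> carrier R" "\<And>i. i \<in> J \<Longrightarrow> u i = (\<lambda>j. a i \<otimes> x j)"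
    by metis
  show thesis
  proof (rule that[of J x a])
    show "finite J" by (rule J(1))
    show "x i \<in> carrier R" for i by (rule xcr)
    show "a i \<in> carrier R" if "i \<in> J" for i by (rule a(1)[OF that])
    have \<theta>0: "\<theta> \<zero>\<^bsub>P\<^esub> = (\<lambda>i. \<zero>)"
      using \<theta>_smult[of \<zero>] P.smult_zero_left q xcr by simp
    fix b assume b: "b \<in> carrier R"
    have "b \<odot>\<^bsub>P\<^esub> q = \<zero>\<^bsub>P\<^esub> \<longleftrightarrow> \<theta> (b \<odot>\<^bsub>P\<^esub> q) = \<theta> \<zero>\<^bsub>P\<^esub>"
      using \<theta>(2) P.smult_closed[OF b q] P.M.zero_closed by (metis bij_betw_imp_inj_on inj_on_eq_iff)
    also have "\<dots> \<longleftrightarrow> (\<forall>i. b \<otimes> x i = \<zero>)" by (auto simp: \<theta>_smult[OF b] \<theta>0 fun_eq_iff)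
    also have "\<dots> \<longleftrightarrow> (\<forall>i\<in>J. b \<otimes> x i = \<zero>)" using b r_null by (fastforce simp: J_def)
    finally show "b \<odot>\<^bsub>P\<^esub> q = \<zero>\<^bsub>P\<^esub> \<longleftrightarrow> (\<forall>i\<in>J. b \<otimes> x i = \<zero>)" .
    show "b \<odot>\<^bsub>P\<^esub> q = q \<Longrightarrow> \<forall>i\<in>J. b \<otimes> x i = x i"
      using \<theta>_smult[OF b] by (auto simp: x_def fun_eq_iff)
  next
    fix i assume i: "i \<in> J"
    have "x i = (\<Oplus>j\<in>J. x j \<otimes> u j i)" using x_eq by (simp add: xu_def fun_eq_iff)
    also have "\<dots> = (\<Oplus>j\<in>J. (x j \<otimes> a j) \<otimes> x i)"
      using a xcr by (intro finsum_cong') (auto simp: m_assoc)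
    also have "\<dots> = (\<Oplus>j\<in>J. x j \<otimes> a j) \<otimes> x i"
      using a xcr J by (intro finsum_ldistr[symmetric]) auto
    finally show "x i = (\<Oplus>j\<in>J. x j \<otimes> a j) \<otimes> x i" .
  qed
qed

lemma (in ring) center_simps:
  "carrier (ring_center R) = {z \<in> carrier R. \<forall>a\<in>carrier R. z \<otimes> a = a \<otimes> z}"
  "monoid.mult (ring_center R) = monoid.mult R" "ring.add (ring_center R) = ring.add R"
  "ring.zero (ring_center R) = \<zero>" "monoid.one (ring_center R) = \<one>"
  by (simp_all add: ring_center_def)

text \<open>The Peirce decomposition \<open>P = eP \<oplus> (1 - e)P\<close> is trivial on an indecomposable module.\<close>

lemma central_idempotent_indecomposable:
  assumes P: "indecomposable_module R P" and e: "idempotent (ring_center R) e"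
  shows "(\<forall>p\<in>carrier P. e \<odot>\<^bsub>P\<^esub> p = p) \<or> (\<forall>p\<in>carrier P. e \<odot>\<^bsub>P\<^esub> p = \<zero>\<^bsub>P\<^esub>)"
proof -
  interpret left_module R P using P by (simp add: indecomposable_module_def)
  have e': "e \<in> carrier R" "e \<otimes>\<^bsub>R\<^esub> e = e" "\<And>a. a \<in> carrier R \<Longrightarrow> e \<otimes>\<^bsub>R\<^esub> a = a \<otimes>\<^bsub>R\<^esub> e"
    using e by (auto simp: idempotent_def R.center_simps)
  define U where "U = {p \<in> carrier P. e \<odot>\<^bsub>P\<^esub> p = p}"
  define V where "V = {p \<in> carrier P. e \<odot>\<^bsub>P\<^esub> p = \<zero>\<^bsub>P\<^esub>}"
  have comm: "e \<odot>\<^bsub>P\<^esub> (a \<odot>\<^bsub>P\<^esub> x) = a \<odot>\<^bsub>P\<^esub> (e \<odot>\<^bsub>P\<^esub> x)" if "a \<in> carrier R" "x \<in> carrier P" for a x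
    using smult_assoc1[OF e'(1) that] smult_assoc1[OF that(1) e'(1) that(2)] e'(3)[OF that(1)] by simp
  have "submodule U R P"
    by (rule submodule_criterion) (auto simp: U_def e'(1,2) smult_zero_right smult_r_distr comm smult_closed)
  moreover have "submodule V R P"
    by (rule submodule_criterion) (auto simp: V_def e'(1,2) smult_zero_right smult_r_distr comm smult_closed)
  moreover have "U <+>\<^bsub>P\<^esub> V = carrier P"
  proof
    show "U <+>\<^bsub>P\<^esub> V \<subseteq> carrier P" by (auto simp: set_add_def set_mult_def U_def V_def)
    show "carrier P \<subseteq> U <+>\<^bsub>P\<^esub> V"
    proof
      fix p assume p: "p \<in> carrier P"
      let ?f = "\<one>\<^bsub>R\<^esub> \<ominus>\<^bsub>R\<^esub> e"
      have "e \<odot>\<^bsub>P\<^esub> (e \<odot>\<^bsub>P\<^esub> p) = e \<odot>\<^bsub>P\<^esub> p" using e'(1,2) p by (simp flip: smult_assoc1)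
      then have 1: "e \<odot>\<^bsub>P\<^esub> p \<in> U" using e'(1,2) p smult_closed by (simp add: U_def)
      have "e \<otimes>\<^bsub>R\<^esub> ?f = \<zero>\<^bsub>R\<^esub>" using e'(1,2) by (simp add: R.minus_eq R.r_distr R.r_minus R.r_neg)
      then have "e \<odot>\<^bsub>P\<^esub> (?f \<odot>\<^bsub>P\<^esub> p) = \<zero>\<^bsub>P\<^esub>" using e'(1,2) p by (simp add: smult_zero_left flip: smult_assoc1)
      then have 2: "?f \<odot>\<^bsub>P\<^esub> p \<in> V" using e'(1,2) p smult_closed by (simp add: V_def)
      have "p = e \<odot>\<^bsub>P\<^esub> p \<oplus>\<^bsub>P\<^esub> ?f \<odot>\<^bsub>P\<^esub> p"
      proof -
        have "e \<oplus>\<^bsub>R\<^esub> ?f = \<one>\<^bsub>R\<^esub>" using e'(1)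
          by (simp add: R.minus_eq R.a_comm[of e] R.a_assoc R.l_neg)
        then show ?thesis using smult_l_distr[of e ?f p] smult_one[OF p] e'(1) p by simp
      qed
      then show "p \<in> U <+>\<^bsub>P\<^esub> V" using 1 2 by (auto simp: set_add_def set_mult_def)
    qed
  qed
  moreover have "U \<inter> V = {\<zero>\<^bsub>P\<^esub>}"
    by (auto simp: U_def V_def e'(1,2) smult_zero_right)
  ultimately have "U = {\<zero>\<^bsub>P\<^esub>} \<or> V = {\<zero>\<^bsub>P\<^esub>}"
    and sum: "U <+>\<^bsub>P\<^esub> V = carrier P"
    using P by (auto simp: indecomposable_module_def internal_direct_sum_def)
  then show ?thesis
  proof (elim disjE)
    assume U: "U = {\<zero>\<^bsub>P\<^esub>}"
    have "p \<in> V" if "p \<in> carrier P" for p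
      using that sum U unfolding set_add_def set_mult_def by (auto simp: V_def)
    then show ?thesis by (simp add: V_def)
  next
    assume V: "V = {\<zero>\<^bsub>P\<^esub>}"
    have "p \<in> U" if "p \<in> carrier P" for p
      using that sum V unfolding set_add_def set_mult_def by (auto simp: U_def)
    then show ?thesis by (simp add: U_def)
  qed
qed

text \<open>Since \<open>f\<close> moves some vector of \<open>S\<close>, the cover is generated by a vector \<open>q = fq\<close>. The dual basis
  of \<open>P = Rq\<close> provides \<open>t\<close> with \<open>ft = t\<close> and \<open>t x i = x i\<close>, and then \<open>u = tf\<close> is a nonzero idempotent
  of \<open>fRf\<close>. As \<open>f\<close> is primitive, \<open>u = f\<close>. If \<open>b = bf\<close> annihilates \<open>q\<close>, then it annihilates
  the \<open>x i\<close>, hence \<open>t\<close>, hence \<open>bf = btf = 0\<close>: right multiplication by \<open>q\<close> is injective on \<open>Rf\<close>.\<close>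

lemma (in ring) primitive_ideal_is_cover:
  fixes P :: "('a, 'p) module" and S :: "('a, 's) module"
  assumes f: "primitive_idempotent R f" and S: "simple_module R S"
    and cov: "projective_cover R P S" and s: "s \<in> carrier S" "f \<odot>\<^bsub>S\<^esub> s \<noteq> \<zero>\<^bsub>S\<^esub>"
  shows "module_isomorphic R (left_ideal_module R f) P"
proof -
  have fc: "f \<in> carrier R" "f \<otimes> f = f" and fid: "idempotent R f"
    using f by (auto simp: primitive_idempotent_def idempotent_def)
  have Pp: "projective_module R P" and Pl: "left_module R P" and Sl: "left_module R S"
    using cov by (auto simp: projective_cover_def projective_module_def)
  interpret P: left_module R P by fact
  interpret S: left_module R S by fact
  obtain h where h: "essential_epi R P S h" using cov by (auto simp: projective_cover_def)
  have hh: "h \<in> module_hom R P S" "h ` carrier P = carrier S" using h by (auto simp: essential_epi_def)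
  have hsm: "h (r \<odot>\<^bsub>P\<^esub> x) = r \<odot>\<^bsub>S\<^esub> h x" if "r \<in> carrier R" "x \<in> carrier P" for r x
    using hh(1) that by (simp add: module_hom_def)
  obtain p where p: "p \<in> carrier P" "s = h p" using s(1) hh(2) by blast
  define q where "q = f \<odot>\<^bsub>P\<^esub> p"
  have q: "q \<in> carrier P" "f \<odot>\<^bsub>P\<^esub> q = q"
    using P.smult_closed[OF fc(1) p(1)] P.smult_assoc1[OF fc(1) fc(1) p(1)] fc by (auto simp: q_def)
  have hq: "h q \<noteq> \<zero>\<^bsub>S\<^esub>" using s p fc by (simp add: q_def hsm)
  define U where "U = (\<lambda>a. a \<odot>\<^bsub>P\<^esub> q) ` carrier R"
  have U: "submodule U R P"
  proof (rule P.submodule_criterion)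
    show "U \<subseteq> carrier P" using q P.smult_closed by (auto simp: U_def)
    show "\<zero>\<^bsub>P\<^esub> \<in> U" using P.smult_zero_left[OF q(1)] by (force simp: U_def)
    show "\<And>x y. x \<in> U \<Longrightarrow> y \<in> U \<Longrightarrow> x \<oplus>\<^bsub>P\<^esub> y \<in> U"
      using q by (auto simp: U_def simp flip: P.smult_l_distr)
    show "\<And>a x. a \<in> carrier R \<Longrightarrow> x \<in> U \<Longrightarrow> a \<odot>\<^bsub>P\<^esub> x \<in> U"
      using q by (auto simp: U_def simp flip: P.smult_assoc1)
  qed
  have "q \<in> U" using P.smult_one[OF q(1)] by (force simp: U_def)
  then have "h ` U \<noteq> {\<zero>\<^bsub>S\<^esub>}" using hq by blast
  then have "h ` U = carrier S"
    using submodule_image[OF Pl Sl hh(1) U] S by (auto simp: simple_module_def)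
  then have gen: "carrier P = (\<lambda>a. a \<odot>\<^bsub>P\<^esub> q) ` carrier R"
    using h U by (auto simp: essential_epi_def U_def)
  obtain J :: "'p set" and x a where J: "finite J" and x: "\<And>i. i \<in> J \<Longrightarrow> x i \<in> carrier R"
    and a: "\<And>i. i \<in> J \<Longrightarrow> a i \<in> carrier R"
    and ann: "\<And>b. b \<in> carrier R \<Longrightarrow> b \<odot>\<^bsub>P\<^esub> q = \<zero>\<^bsub>P\<^esub> \<longleftrightarrow> (\<forall>i\<in>J. b \<otimes> x i = \<zero>)"
    and fix_q: "\<And>b. b \<in> carrier R \<Longrightarrow> b \<odot>\<^bsub>P\<^esub> q = q \<Longrightarrow> \<forall>i\<in>J. b \<otimes> x i = x i"
    and dual: "\<And>i. i \<in> J \<Longrightarrow> x i = (\<Oplus>j\<in>J. x j \<otimes> a j) \<otimes> x i"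
    by (rule projective_cyclic_coordinates[OF Pp q(1) gen]) (rule that; assumption)
  define t where "t = (\<Oplus>j\<in>J. x j \<otimes> a j)"
  have tc: "t \<in> carrier R" unfolding t_def using x a by (intro finsum_closed) auto
  have left_t: "b \<otimes> t = (\<Oplus>j\<in>J. (b \<otimes> x j) \<otimes> a j)" if "b \<in> carrier R" for b
  proof -
    have "b \<otimes> t = (\<Oplus>j\<in>J. b \<otimes> (x j \<otimes> a j))"
      unfolding t_def using x a J that by (intro finsum_rdistr) auto
    also have "\<dots> = (\<Oplus>j\<in>J. (b \<otimes> x j) \<otimes> a j)"
      using x a that by (intro finsum_cong') (auto simp: m_assoc)
    finally show ?thesis .
  qed
  have fx: "f \<otimes> x i = x i" and tx: "t \<otimes> x i = x i" if "i \<in> J" for i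
    using fix_q[OF fc(1) q(2)] dual that by (auto simp: t_def)
  have ft: "f \<otimes> t = t" unfolding left_t[OF fc(1)] using fx x a unfolding t_def
    by (intro finsum_cong') auto
  have tt: "t \<otimes> t = t" unfolding left_t[OF tc] using tx x a unfolding t_def
    by (intro finsum_cong') auto
  (* t itself need not satisfy t f = t *)
  define u where "u = t \<otimes> f"
  have uc: "u \<in> carrier R" using tc fc by (simp add: u_def)
  have fu: "f \<otimes> u = u" using ft tc fc by (simp add: u_def flip: m_assoc)
  have uf: "u \<otimes> f = u" using tc fc by (simp add: u_def m_assoc)
  have uu: "u \<otimes> u = u"
  proof -
    have "u \<otimes> u = t \<otimes> (f \<otimes> t) \<otimes> f" using tc fc by (simp add: u_def m_assoc)
    then show ?thesis by (simp add: ft tt u_def)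
  qed
  have u0: "u \<noteq> \<zero>"
  proof
    assume "u = \<zero>"
    have "x i = \<zero>" if i: "i \<in> J" for i
    proof -
      have "x i = t \<otimes> (f \<otimes> x i)" using fx tx i by simp
      also have "\<dots> = u \<otimes> x i" using tc fc x i by (simp add: u_def m_assoc)
      finally show ?thesis using \<open>u = \<zero>\<close> x i by simp
    qed
    then have "\<one> \<odot>\<^bsub>P\<^esub> q = \<zero>\<^bsub>P\<^esub>" using ann[of \<one>] x by simp
    then have "h q = \<zero>\<^bsub>S\<^esub>" using P.smult_one[OF q(1)] left_module_hom_zero[OF Pl Sl hh(1)] by simp
    then show False using hq by simp
  qed
  define w where "w = f \<ominus> u"
  have wc: "w \<in> carrier R" using fc uc by (simp add: w_def)
  have "idempotent R u" using uc uu by (simp add: idempotent_def)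
  moreover have uw: "u \<otimes> w = \<zero>" "w \<otimes> u = \<zero>"
    using fc uc uu fu uf by (simp_all add: w_def minus_eq r_distr l_distr r_minus l_minus r_neg)
  moreover have "idempotent R w"
  proof -
    have "w \<otimes> w = w \<otimes> f \<ominus> w \<otimes> u"
      unfolding w_def(1) using fc uc by (simp add: minus_eq r_distr r_minus)
    also have "\<dots> = w \<otimes> f" using uw(2) wc fc by (simp add: minus_eq)
    also have "\<dots> = w" using fc uc uf by (simp add: w_def minus_eq l_distr l_minus)
    finally show ?thesis using wc by (simp add: idempotent_def)
  qed
  moreover have fuw: "f = u \<oplus> w" using fc uc by (simp add: w_def minus_eq a_lcomm r_neg)
  ultimately have "w = \<zero>" using f u0 by (auto simp: primitive_idempotent_def)
  then have "f = t \<otimes> f" using fuw uc by (simp add: u_def)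
  have inj: "b = \<zero>" if b: "b \<in> carrier R" "b \<otimes> f = b" "b \<odot>\<^bsub>P\<^esub> q = \<zero>\<^bsub>P\<^esub>" for b
  proof -
    have "b \<otimes> x i = \<zero>" if "i \<in> J" for i using ann b that by blast
    then have "b \<otimes> t = \<zero>" unfolding left_t[OF b(1)] using a
      by (simp add: finsum_cong'[of J J "\<lambda>_. \<zero>"])
    then have "b \<otimes> (t \<otimes> f) = \<zero>" using b(1) tc fc by (simp flip: m_assoc)
    then show ?thesis using b(2) \<open>f = t \<otimes> f\<close> by simp
  qed
  note I = PIdl_idempotent[OF fid]
  define \<phi> where "\<phi> y = y \<odot>\<^bsub>P\<^esub> q" for y
  have "\<phi> \<in> module_hom R (left_ideal_module R f) P"
    using q(1) P.smult_closed P.smult_l_distr P.smult_assoc1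
    by (auto simp: module_hom_def regular_module_def I \<phi>_def)
  moreover have "bij_betw \<phi> (carrier (left_ideal_module R f)) (carrier P)"
    unfolding carrier_left_ideal_module unfolding I
  proof (rule bij_betw_imageI)
    show "inj_on \<phi> {x \<in> carrier R. x \<otimes> f = x}"
    proof (rule inj_onI)
      fix y z assume yz: "y \<in> {x \<in> carrier R. x \<otimes> f = x}" "z \<in> {x \<in> carrier R. x \<otimes> f = x}" "\<phi> y = \<phi> z"
      have c: "y \<in> carrier R" "z \<in> carrier R" using yz by auto
      have "(y \<ominus> z) \<odot>\<^bsub>P\<^esub> q \<oplus>\<^bsub>P\<^esub> z \<odot>\<^bsub>P\<^esub> q = y \<odot>\<^bsub>P\<^esub> q"
        using c q(1) by (simp add: minus_eq a_assoc l_neg flip: P.smult_l_distr)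
      then have "(y \<ominus> z) \<odot>\<^bsub>P\<^esub> q = \<zero>\<^bsub>P\<^esub>" using yz(3) c q(1) P.smult_closed
        by (metis \<phi>_def P.M.add.r_cancel_one minus_closed)
      moreover have "(y \<ominus> z) \<otimes> f = y \<ominus> z" using yz fc by (auto simp: minus_eq l_distr l_minus)
      ultimately have "y \<ominus> z = \<zero>" using inj c by simp
      then show "y = z" using c by (simp add: r_right_minus_eq)
    qed
    show "\<phi> ` {x \<in> carrier R. x \<otimes> f = x} = carrier P"
    proof
      show "\<phi> ` {x \<in> carrier R. x \<otimes> f = x} \<subseteq> carrier P"
        using q(1) P.smult_closed by (auto simp: \<phi>_def)
      show "carrier P \<subseteq> \<phi> ` {x \<in> carrier R. x \<otimes> f = x}"
      proof
        fix y assume "y \<in> carrier P"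
        then obtain b where b: "b \<in> carrier R" "y = b \<odot>\<^bsub>P\<^esub> q" using gen by blast
        have "y = \<phi> (b \<otimes> f)" using b q fc by (simp add: \<phi>_def P.smult_assoc1)
        then show "y \<in> \<phi> ` {x \<in> carrier R. x \<otimes> f = x}"
          using b fc by (auto simp: m_assoc)
      qed
    qed
  qed
  ultimately show ?thesis unfolding module_isomorphic_def by blast
qed

section \<open>Central idempotents and blocks\<close>

context ring
begin

lemma center_ring: "ring (ring_center R)"
proof -
  let ?Z = "{z \<in> carrier R. \<forall>a\<in>carrier R. z \<otimes> a = a \<otimes> z}"
  have "subring ?Z R"
  proof (rule subringI)
    fix x y assume x: "x \<in> ?Z" and y: "y \<in> ?Z"
    have xc: "x \<in> carrier R" and yc: "y \<in> carrier R" using x y by blast+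
    have xa: "x \<otimes> a = a \<otimes> x" and ya: "y \<otimes> a = a \<otimes> y" if "a \<in> carrier R" for a using x y that by blast+
    show "\<ominus> x \<in> ?Z" using xc by (simp add: l_minus r_minus xa cong: conj_cong)
    show "x \<oplus> y \<in> ?Z" using xc yc by (simp add: l_distr r_distr xa ya)
    show "x \<otimes> y \<in> ?Z"
    proof (intro CollectI conjI ballI)
      fix a assume a: "a \<in> carrier R"
      have "x \<otimes> y \<otimes> a = x \<otimes> (a \<otimes> y)" using xc yc a by (simp add: m_assoc ya)
      also have "\<dots> = (x \<otimes> a) \<otimes> y" using xc yc a by (simp add: m_assoc)
      also have "\<dots> = a \<otimes> (x \<otimes> y)" using xc yc a by (simp add: m_assoc xa)
      finally show "x \<otimes> y \<otimes> a = a \<otimes> (x \<otimes> y)" .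
    qed (use xc yc in auto)
  qed auto
  then show ?thesis unfolding ring_center_def by (rule subring_is_ring)
qed

lemma center_idempotent:
  "idempotent (ring_center R) e \<longleftrightarrow> e \<in> carrier R \<and> (\<forall>a\<in>carrier R. e \<otimes> a = a \<otimes> e) \<and> e \<otimes> e = e"
  by (auto simp: idempotent_def center_simps)

lemma complement_idempotent:
  assumes "idempotent (ring_center R) e"
  shows "idempotent (ring_center R) (\<one> \<ominus> e)" "e \<otimes> (\<one> \<ominus> e) = \<zero>" "(\<one> \<ominus> e) \<otimes> e = \<zero>" "\<one> \<ominus> (\<one> \<ominus> e) = e"
    "(\<one> \<ominus> e) \<oplus> e = \<one>"
proof -
  have e: "e \<in> carrier R" "e \<otimes> e = e" using assms unfolding center_idempotent by blast+
  show z: "e \<otimes> (\<one> \<ominus> e) = \<zero>" "(\<one> \<ominus> e) \<otimes> e = \<zero>"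
    using e by (simp_all add: minus_eq r_distr l_distr r_minus l_minus r_neg)
  show "idempotent (ring_center R) (\<one> \<ominus> e)"
    unfolding center_idempotent
  proof (intro conjI ballI)
    fix a assume a: "a \<in> carrier R"
    then have "e \<otimes> a = a \<otimes> e" using assms unfolding center_idempotent by blast+
    then show "(\<one> \<ominus> e) \<otimes> a = a \<otimes> (\<one> \<ominus> e)"
      using a e(1) by (simp add: minus_eq l_distr r_distr l_minus r_minus)
  next
    have "(\<one> \<ominus> e) \<otimes> (\<one> \<ominus> e) = (\<one> \<ominus> e) \<otimes> \<one> \<ominus> (\<one> \<ominus> e) \<otimes> e"
      using e(1) r_distr[of "\<one>" "\<ominus> e" "\<one> \<ominus> e"] r_minus[of "\<one> \<ominus> e" e] unfolding minus_eq by simp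
    then show "(\<one> \<ominus> e) \<otimes> (\<one> \<ominus> e) = \<one> \<ominus> e" using z e by (simp add: minus_eq)
  qed (use e in simp)
  show "\<one> \<ominus> (\<one> \<ominus> e) = e" 
  proof -
    have "\<ominus> (\<one> \<oplus> \<ominus> e) = \<ominus> \<one> \<oplus> e" using e(1) minus_add[of "\<one>" "\<ominus> e"] by simp
    then show ?thesis using e(1) r_neg2[of "\<one>" e] by (simp add: minus_eq)
  qed
  show "(\<one> \<ominus> e) \<oplus> e = \<one>" using e by (simp add: minus_eq a_assoc l_neg)
qed

lemma two_central_idempotents_primitive:
  assumes e: "idempotent (ring_center R) e" "e \<noteq> \<zero>" "e \<noteq> \<one>"
    and all: "\<And>z. idempotent (ring_center R) z \<Longrightarrow> z \<in> {\<zero>, \<one>, e, \<one> \<ominus> e}"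
  shows "primitive_idempotent (ring_center R) e"
  unfolding primitive_idempotent_def center_simps
proof (intro conjI e, rule notI)
  let ?f = "\<one> \<ominus> e"
  have ec: "e \<in> carrier R" using e unfolding center_idempotent by blast+
  assume "\<exists>a b. idempotent (ring_center R) a \<and> idempotent (ring_center R) b \<and> a \<noteq> \<zero> \<and> b \<noteq> \<zero> \<and>
     a \<otimes> b = \<zero> \<and> b \<otimes> a = \<zero> \<and> e = a \<oplus> b"
  then obtain a b where ab: "idempotent (ring_center R) a" "idempotent (ring_center R) b" "a \<noteq> \<zero>" "b \<noteq> \<zero>"
    "a \<otimes> b = \<zero>" "b \<otimes> a = \<zero>" "e = a \<oplus> b" by blast
  have c: "a \<in> carrier R" "b \<in> carrier R" and idem: "a \<otimes> a = a" using ab(1,2) unfolding center_idempotent by blast+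
  have "a \<noteq> \<one>" "b \<noteq> \<one>" using ab c by auto
  moreover have "a \<noteq> e" using ab(4,7) c add.l_cancel_one[of a b] by auto
  moreover have "b \<noteq> e" using ab(3,7) c add.r_cancel_one[of b a] by auto
  ultimately have "a = ?f" "b = ?f" using all ab by blast+
  then show False using ab(3,5) idem by simp
qed

text \<open>With only four central idempotents, the decomposition of \<open>\<one>\<close> into primitive ones is forced: neither
  \<open>\<one>\<close> nor \<open>\<zero>\<close> is primitive, and no single summand gives \<open>\<one>\<close>.\<close>

lemma two_central_idempotents:
  assumes e: "idempotent (ring_center R) e" "e \<noteq> \<zero>" "e \<noteq> \<one>"
    and all: "\<And>z. idempotent (ring_center R) z \<Longrightarrow> z \<in> {\<zero>, \<one>, e, \<one> \<ominus> e}"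
  shows "{z. primitive_idempotent (ring_center R) z} = {\<one> \<ominus> e, e}"
    "primitive_decomposition (ring_center R) E \<longleftrightarrow> E = {\<one> \<ominus> e, e}"
    "\<one> \<ominus> e \<noteq> e"
proof -
  let ?f = "\<one> \<ominus> e"
  note co = complement_idempotent[OF e(1)]
  have ec: "e \<in> carrier R" "e \<otimes> e = e" using e unfolding center_idempotent by blast+
  have fc: "?f \<in> carrier R" using ec by simp
  have f0: "?f \<noteq> \<zero>" using e(3) ec by simp
  have f1: "?f \<noteq> \<one>"
  proof
    assume "?f = \<one>"
    then have "e \<otimes> \<one> = \<zero>" using co(2) by simp
    then show False using e(2) ec(1) by simp
  qed
  have pe: "primitive_idempotent (ring_center R) e" by (rule two_central_idempotents_primitive[OF e all])
  have pf: "primitive_idempotent (ring_center R) ?f"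
    by (rule two_central_idempotents_primitive[OF co(1) f0 f1]) (use all co(4) in auto)
  show ef: "?f \<noteq> e" using co(2) ec e(2) by metis
  have n1: "\<not> primitive_idempotent (ring_center R) \<one>"
    using co e f0 unfolding primitive_idempotent_def center_simps by metis
  have n0: "\<not> primitive_idempotent (ring_center R) \<zero>"
    by (simp add: primitive_idempotent_def center_simps)
  show prim: "{z. primitive_idempotent (ring_center R) z} = {?f, e}"
  proof (intro equalityI subsetI)
    fix z assume "z \<in> {z. primitive_idempotent (ring_center R) z}"
    then have z: "primitive_idempotent (ring_center R) z" by simp
    then have "z \<in> {\<zero>, \<one>, e, ?f}" using all by (simp add: primitive_idempotent_def)
    then show "z \<in> {?f, e}" using z n0 n1 by auto
  qed (use pe pf in auto)
  interpret Z: ring "ring_center R" by (rule center_ring)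
  have Zc: "e \<in> carrier (ring_center R)" "?f \<in> carrier (ring_center R)"
    using e co(1) by (auto simp: idempotent_def)
  have sum1: "(\<Oplus>\<^bsub>ring_center R\<^esub>z\<in>{z}. z) = z" if "z \<in> carrier (ring_center R)" for z
    using that by simp
  have sum2: "(\<Oplus>\<^bsub>ring_center R\<^esub>z\<in>{?f, e}. z) = \<one>"
    using Zc ef co(5) by (simp add: Z.finsum_insert center_simps)
  show "primitive_decomposition (ring_center R) E \<longleftrightarrow> E = {?f, e}"
  proof
    assume "E = {?f, e}"
    then show "primitive_decomposition (ring_center R) E"
      unfolding primitive_decomposition_def using pe pf co sum2 ef by (auto simp: center_simps)
  next
    assume E: "primitive_decomposition (ring_center R) E"
    then have "E \<subseteq> {?f, e}" using prim by (auto simp: primitive_decomposition_def)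
    then consider "E = {}" | "E = {e}" | "E = {?f}" | "E = {?f, e}" by blast
    then show "E = {?f, e}"
    proof cases
      case 1
      then have "\<one> = \<zero>" using E by (simp add: primitive_decomposition_def center_simps)
      then show ?thesis using e(2) ec by (metis l_null l_one)
    next
      case 2
      then show ?thesis using E e(3) sum1[OF Zc(1)] by (simp add: primitive_decomposition_def center_simps)
    next
      case 3
      then show ?thesis using E f1 sum1[OF Zc(2)] by (simp add: primitive_decomposition_def center_simps)
    qed
  qed
qed

lemma central_PIdl:
  assumes "idempotent (ring_center R) e"
  shows "PIdl e = {x \<in> carrier R. x \<otimes> e = x}"
  using assms by (intro PIdl_idempotent) (simp add: idempotent_def center_simps)

lemma central_idempotent_ideal:
  assumes "idempotent (ring_center R) e"
  shows "ideal (PIdl e) R"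
proof (rule idealI[OF ring_axioms])
  have e: "e \<in> carrier R" "\<And>a. a \<in> carrier R \<Longrightarrow> e \<otimes> a = a \<otimes> e" "e \<otimes> e = e"
    using assms unfolding center_idempotent by blast+
  note P = central_PIdl[OF assms]
  show "subgroup (PIdl e) (add_monoid R)"
    unfolding P
  proof (rule add.subgroupI)
    show "{x \<in> carrier R. x \<otimes> e = x} \<noteq> {}" using e(1,3) by blast
    fix a assume "a \<in> {x \<in> carrier R. x \<otimes> e = x}"
    then show "\<ominus> a \<in> {x \<in> carrier R. x \<otimes> e = x}" using e(1) by (auto simp: l_minus)
  qed (use e(1) in \<open>auto simp: l_distr\<close>)
  fix a x assume ax: "a \<in> PIdl e" "x \<in> carrier R"
  then have a: "a \<in> carrier R" "a \<otimes> e = a" by (auto simp: P)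
  show "x \<otimes> a \<in> PIdl e" using a ax(2) e(1) by (simp add: P m_assoc)
  have "a \<otimes> x \<otimes> e = a \<otimes> (e \<otimes> x)" using a(1) ax(2) e(1) e(2)[OF ax(2)] by (simp add: m_assoc)
  also have "\<dots> = a \<otimes> x" using a ax(2) e(1) by (simp flip: m_assoc)
  finally show "a \<otimes> x \<in> PIdl e" using a ax(2) by (simp add: P)
qed

lemma regular_left_module: "left_module R (regular_module R)"
proof -
  have "abelian_group (regular_module R)"
    by (rule abelian_groupI) (auto simp: regular_module_def a_ac intro: exI[of _ "\<ominus> _"] bexI[of _ "\<ominus> _"] l_neg)
  then show ?thesis
    by (intro left_module.intro left_module_axioms.intro ring_axioms)
      (auto simp: regular_module_def l_distr r_distr m_assoc)
qed

lemma central_idempotent_direct_sum: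
  assumes "idempotent (ring_center R) e"
  shows "internal_direct_sum R (regular_module R) (PIdl (\<one> \<ominus> e)) (PIdl e)"
proof -
  interpret M: left_module R "regular_module R" by (rule regular_left_module)
  have sub: "submodule (PIdl z) R (regular_module R)" if z: "idempotent (ring_center R) z" for z
  proof -
    interpret I: ideal "PIdl z" R by (rule central_idempotent_ideal[OF z])
    show ?thesis
      by (rule M.submodule_criterion) (auto simp: regular_module_def I.I_l_closed)
  qed
  note co = complement_idempotent[OF assms]
  have e: "e \<in> carrier R" using assms unfolding center_idempotent by blast+
  note P = central_PIdl[OF assms] central_PIdl[OF co(1)]
  have "PIdl (\<one> \<ominus> e) <+>\<^bsub>regular_module R\<^esub> PIdl e = carrier R"
  proof (intro equalityI subsetI)
    fix x assume "x \<in> PIdl (\<one> \<ominus> e) <+>\<^bsub>regular_module R\<^esub> PIdl e"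
    then show "x \<in> carrier R" by (auto simp: set_add_def set_mult_def regular_module_def P)
  next
    fix x assume x: "x \<in> carrier R"
    have "x = x \<otimes> (\<one> \<ominus> e) \<oplus> x \<otimes> e" using x e co(5) by (simp flip: r_distr)
    moreover have "x \<otimes> (\<one> \<ominus> e) \<in> PIdl (\<one> \<ominus> e)" "x \<otimes> e \<in> PIdl e"
      using x by (auto simp: cgenideal_def)
    ultimately show "x \<in> PIdl (\<one> \<ominus> e) <+>\<^bsub>regular_module R\<^esub> PIdl e"
      by (auto simp: set_add_def set_mult_def regular_module_def)
  qed
  moreover have "PIdl (\<one> \<ominus> e) \<inter> PIdl e = {\<zero>}"
  proof -
    have "x = \<zero>" if "x \<in> carrier R" "x \<otimes> (\<one> \<ominus> e) = x" "x \<otimes> e = x" for x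
    proof -
      have "x = x \<otimes> (\<one> \<ominus> e) \<otimes> e" using that by simp
      also have "\<dots> = \<zero>" using that(1) e co(3) by (simp add: m_assoc)
      finally show ?thesis .
    qed
    then show ?thesis using e by (auto simp: P)
  qed
  ultimately show ?thesis
    using sub assms co(1) by (simp add: internal_direct_sum_def regular_module_def)
qed

text \<open>On \<open>P\<close> the idempotent acts as zero or one; the epimorphism to \<open>S \<noteq> 0\<close> decides which.\<close>

lemma central_idempotent_on_cover:
  assumes e: "idempotent (ring_center R) e" and S: "simple_module R S" and cov: "projective_cover R P S"
  shows "(\<And>s. s \<in> carrier S \<Longrightarrow> e \<odot>\<^bsub>S\<^esub> s = \<zero>\<^bsub>S\<^esub>) \<Longrightarrow> \<forall>p\<in>carrier P. e \<odot>\<^bsub>P\<^esub> p = \<zero>\<^bsub>P\<^esub>"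
    "(\<And>s. s \<in> carrier S \<Longrightarrow> e \<odot>\<^bsub>S\<^esub> s = s) \<Longrightarrow> \<forall>p\<in>carrier P. e \<odot>\<^bsub>P\<^esub> p = p"
proof -
  have ind: "indecomposable_module R P" by (rule projective_cover_simple_indecomposable[OF S cov])
  have P: "left_module R P" and Sl: "left_module R S"
    using ind S by (auto simp: indecomposable_module_def simple_module_def)
  interpret P: left_module R P by fact
  interpret S: left_module R S by fact
  obtain h where h: "h \<in> module_hom R P S" "h ` carrier P = carrier S"
    using cov by (auto simp: projective_cover_def essential_epi_def)
  have ec: "e \<in> carrier R" using e unfolding center_idempotent by blast+
  have he: "h (e \<odot>\<^bsub>P\<^esub> p) = e \<odot>\<^bsub>S\<^esub> h p" if "p \<in> carrier P" for p
    using h(1) ec that by (simp add: module_hom_def)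
  have h0: "h \<zero>\<^bsub>P\<^esub> = \<zero>\<^bsub>S\<^esub>" by (rule left_module_hom_zero[OF P Sl h(1)])
  obtain s where s: "s \<in> carrier S" "s \<noteq> \<zero>\<^bsub>S\<^esub>"
    using S S.M.zero_closed unfolding simple_module_def by blast
  have "s \<in> h ` carrier P" using s(1) h(2) by simp
  then obtain p where p: "p \<in> carrier P" "h p = s" by blast
  note dich = central_idempotent_indecomposable[OF ind e]
  show "\<forall>p\<in>carrier P. e \<odot>\<^bsub>P\<^esub> p = \<zero>\<^bsub>P\<^esub>" if "\<And>s. s \<in> carrier S \<Longrightarrow> e \<odot>\<^bsub>S\<^esub> s = \<zero>\<^bsub>S\<^esub>"
    using dich he[OF p(1)] that[OF s(1)] p s(2) by auto
  show "\<forall>p\<in>carrier P. e \<odot>\<^bsub>P\<^esub> p = p" if "\<And>s. s \<in> carrier S \<Longrightarrow> e \<odot>\<^bsub>S\<^esub> s = s"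
    using dich he[OF p(1)] that[OF s(1)] p s(2) h0 by auto
qed

lemma central_action_iso:
  assumes iso: "module_isomorphic R (left_ideal_module R f) P" and f: "idempotent R f" and P: "left_module R P"
    and e: "e \<in> carrier R"
  shows "\<forall>p\<in>carrier P. e \<odot>\<^bsub>P\<^esub> p = \<zero>\<^bsub>P\<^esub> \<Longrightarrow> e \<otimes> f = \<zero>" "\<forall>p\<in>carrier P. e \<odot>\<^bsub>P\<^esub> p = p \<Longrightarrow> e \<otimes> f = f"
proof -
  interpret P: left_module R P by fact
  obtain h where h: "h \<in> module_hom R (left_ideal_module R f) P" "bij_betw h (PIdl f) (carrier P)"
    using iso by (auto simp: module_isomorphic_def regular_module_def)
  note I = PIdl_idempotent[OF f]
  have fc: "f \<in> carrier R" "f \<otimes> f = f" using f by (auto simp: idempotent_def)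
  have mem: "f \<in> PIdl f" "e \<otimes> f \<in> PIdl f" "\<zero> \<in> PIdl f" using fc e by (auto simp: I m_assoc)
  have hm: "h (r \<otimes> x) = r \<odot>\<^bsub>P\<^esub> h x" if "r \<in> carrier R" "x \<in> PIdl f" for r x
    using h(1) that by (simp add: module_hom_def regular_module_def)
  have hc: "h f \<in> carrier P" using h(2) mem by (auto simp: bij_betw_def)
  have inj: "x = y" if "h x = h y" "x \<in> PIdl f" "y \<in> PIdl f" for x y
    using h(2) that by (auto simp: bij_betw_def dest: inj_onD)
  have h0: "h \<zero> = \<zero>\<^bsub>P\<^esub>" using hm[OF _ mem(1), of \<zero>] fc hc by (simp add: P.smult_zero_left)
  show "e \<otimes> f = \<zero>" if "\<forall>p\<in>carrier P. e \<odot>\<^bsub>P\<^esub> p = \<zero>\<^bsub>P\<^esub>"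
    using hm[OF e mem(1)] that hc h0 inj[OF _ mem(2,3)] by simp
  show "e \<otimes> f = f" if "\<forall>p\<in>carrier P. e \<odot>\<^bsub>P\<^esub> p = p"
    using hm[OF e mem(1)] that hc inj[OF _ mem(2,1)] by simp
qed

lemma sum_of_block_idempotents:
  assumes E: "finite E" "E \<subseteq> carrier R" "\<one> = (\<Oplus>f\<in>E. f)" and e: "e \<in> carrier R"
    and ef: "\<And>f. f \<in> E \<Longrightarrow> e \<otimes> f = (if f \<in> E' then f else \<zero>)" and E': "E' \<subseteq> E"
  shows "(\<Oplus>f\<in>E'. f) = e"
proof -
  have "e = e \<otimes> (\<Oplus>f\<in>E. f)" unfolding E(3)[symmetric] using e by simp
  also have "\<dots> = (\<Oplus>f\<in>E. e \<otimes> f)" using E e by (intro finsum_rdistr) auto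
  also have "\<dots> = (\<Oplus>f\<in>E. if f \<in> E' then f else \<zero>)" using E ef by (intro finsum_cong') auto
  also have "\<dots> = (\<Oplus>f\<in>E'. f)"
    using E E' by (intro add.finprod_mono_neutral_cong_right) auto
  finally show ?thesis by simp
qed

end

section \<open>The alternating group of degree five\<close>

text \<open>Permutations of \<open>{1,...,5}\<close> are listed as \<open>[0, g 1, ..., g 5]\<close>; the entry 0 makes positions and
  points agree, so that composition is a plain list lookup.\<close>

definition perm_of :: "nat list \<Rightarrow> nat \<Rightarrow> nat" where
  "perm_of l i = (if i < 6 then l ! i else i)"

definition pcomp :: "nat list \<Rightarrow> nat list \<Rightarrow> nat list" where
  "pcomp p q = map ((!) p) q"

definition id5 :: "nat list" where "id5 = [0,1,2,3,4,5]"

definition c5 :: "nat list list" where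
  "c5 = [id5, [0,2,3,4,5,1], [0,3,4,5,1,2], [0,4,5,1,2,3], [0,5,1,2,3,4]]"
definition v4 :: "nat list list" where
  "v4 = [id5, [0,2,1,4,3,5], [0,3,4,1,2,5], [0,4,3,2,1,5]]"
definition c3 :: "nat list list" where
  "c3 = [id5, [0,2,3,1,4,5], [0,3,1,2,4,5]]"

text \<open>The factorization \<open>A\<^sub>5 = C\<^sub>5 V\<^sub>4 C\<^sub>3\<close> into a 5-cycle group and the two factors of the stabilizer of the point
  5. It makes evenness of the 60 products evident, and counting shows that there are no others.\<close>

definition a5 :: "nat list list" where
  "a5 = [pcomp x (pcomp y w). x \<leftarrow> c5, y \<leftarrow> v4, w \<leftarrow> c3]"

abbreviation pts :: "nat list" where "pts \<equiv> [1,2,3,4,5]"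

definition fixl :: "nat list \<Rightarrow> nat" where
  "fixl l = length (filter (\<lambda>i. l ! i = i) pts)"

lemma distinct_a5: "distinct a5"
  by code_simp

lemma a5_entries: "\<forall>l\<in>set a5. length l = 6 \<and> (\<forall>i\<in>set l. i < 6)"
  by code_simp

lemma length_a5: "length a5 = 60"
  by code_simp

lemma less_6: "(i::nat) < 6 \<longleftrightarrow> i = 0 \<or> i = 1 \<or> i = 2 \<or> i = 3 \<or> i = 4 \<or> i = 5"
  by auto

lemma atLeastAtMost_1_5: "{1..5::nat} = set pts"
  by (auto simp: set_eq_iff)

lemma perm_of_pcomp:
  assumes "length q = 6" "\<forall>i\<in>set q. i < 6"
  shows "perm_of (pcomp p q) = perm_of p \<circ> perm_of q"
  using assms by (auto simp: perm_of_def pcomp_def fun_eq_iff)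

lemma perm_of_id5: "perm_of id5 = id"
  by (auto simp: perm_of_def id5_def fun_eq_iff less_6)

lemma perm_of_inj: "inj_on perm_of (set a5)"
proof (rule inj_onI)
  fix p q assume *: "p \<in> set a5" "q \<in> set a5" "perm_of p = perm_of q"
  have "p ! i = q ! i" if "i < 6" for i
    using fun_cong[OF *(3), of i] that by (simp add: perm_of_def)
  then show "p = q" using *(1,2) a5_entries by (intro nth_equalityI) auto
qed

lemma transpose_pair_alt:
  assumes "a \<noteq> b" "c \<noteq> d" "{a,b,c,d} \<subseteq> {1..n}"
  shows "Transposition.transpose a b \<circ> Transposition.transpose c d \<in> carrier (alt_group n)"
  unfolding alt_group_carrier
proof
  show "Transposition.transpose a b \<circ> Transposition.transpose c d permutes {1..n}"
    using assms by (intro permutes_compose permutes_swap_id) auto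
  show "evenperm (Transposition.transpose a b \<circ> Transposition.transpose c d)"
    using assms by (simp add: evenperm_comp permutation_swap_id evenperm_swap)
qed

lemma alt_group_comp:
  "p \<in> carrier (alt_group n) \<Longrightarrow> q \<in> carrier (alt_group n) \<Longrightarrow> p \<circ> q \<in> carrier (alt_group n)"
  using monoid.m_closed[OF group.is_monoid[OF alt_group_is_group], of p n q]
  by (simp add: alt_group_mult)

lemma perm_of_eqI:
  assumes "\<And>i. i < 6 \<Longrightarrow> l ! i = f i" "\<And>i. i \<ge> 6 \<Longrightarrow> f i = i"
  shows "perm_of l = f"
  using assms by (auto simp: perm_of_def fun_eq_iff)

lemma generators_even:
  "perm_of [0,2,3,4,5,1] \<in> carrier (alt_group 5)"
  "perm_of [0,2,3,1,4,5] \<in> carrier (alt_group 5)"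
  "perm_of [0,2,1,4,3,5] \<in> carrier (alt_group 5)"
  "perm_of [0,3,4,1,2,5] \<in> carrier (alt_group 5)"
proof -
  have 1: "perm_of [0,2,3,4,5,1] = (Transposition.transpose 1 2 \<circ> Transposition.transpose 2 3) \<circ> (Transposition.transpose 3 4 \<circ> Transposition.transpose 4 5)"
    by (rule perm_of_eqI) (auto simp: less_6 Transposition.transpose_def)
  have 2: "perm_of [0,2,3,1,4,5] = Transposition.transpose 1 2 \<circ> Transposition.transpose 2 3"
    by (rule perm_of_eqI) (auto simp: less_6 Transposition.transpose_def)
  have 3: "perm_of [0,2,1,4,3,5] = Transposition.transpose 1 2 \<circ> Transposition.transpose 3 4"
    by (rule perm_of_eqI) (auto simp: less_6 Transposition.transpose_def)
  have 4: "perm_of [0,3,4,1,2,5] = Transposition.transpose 1 3 \<circ> Transposition.transpose 2 4"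
    by (rule perm_of_eqI) (auto simp: less_6 Transposition.transpose_def)
  show "perm_of [0,2,3,4,5,1] \<in> carrier (alt_group 5)"
    unfolding 1 by (intro alt_group_comp transpose_pair_alt) auto
  show "perm_of [0,2,3,1,4,5] \<in> carrier (alt_group 5)" "perm_of [0,2,1,4,3,5] \<in> carrier (alt_group 5)"
    "perm_of [0,3,4,1,2,5] \<in> carrier (alt_group 5)"
    unfolding 2 3 4 by (intro transpose_pair_alt; auto)+
qed

lemma pcomp_alt:
  "perm_of p \<in> carrier (alt_group 5) \<Longrightarrow> perm_of q \<in> carrier (alt_group 5) \<Longrightarrow>
   length q = 6 \<Longrightarrow> \<forall>i\<in>set q. i < 6 \<Longrightarrow> perm_of (pcomp p q) \<in> carrier (alt_group 5)"
  by (simp add: perm_of_pcomp alt_group_comp)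

lemma factors_even:
  "l \<in> set c5 \<union> set v4 \<union> set c3 \<Longrightarrow> perm_of l \<in> carrier (alt_group 5)"
proof -
  let ?r = "[0,2,3,4,5,1] :: nat list" and ?c = "[0,2,3,1,4,5] :: nat list"
  have i: "perm_of id5 \<in> carrier (alt_group 5)"
    by (simp add: perm_of_id5 alt_group_carrier permutes_id)
  have r2: "perm_of [0,3,4,5,1,2] \<in> carrier (alt_group 5)"
    using pcomp_alt[of ?r ?r] generators_even(1) by (simp add: pcomp_def)
  have r3: "perm_of [0,4,5,1,2,3] \<in> carrier (alt_group 5)"
    using pcomp_alt[of ?r "[0,3,4,5,1,2]"] generators_even(1) r2 by (simp add: pcomp_def)
  have r4: "perm_of [0,5,1,2,3,4] \<in> carrier (alt_group 5)"
    using pcomp_alt[of ?r "[0,4,5,1,2,3]"] generators_even(1) r3 by (simp add: pcomp_def)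
  have w2: "perm_of [0,3,1,2,4,5] \<in> carrier (alt_group 5)"
    using pcomp_alt[of ?c ?c] generators_even(2) by (simp add: pcomp_def)
  have v: "perm_of [0,4,3,2,1,5] \<in> carrier (alt_group 5)"
    using pcomp_alt[of "[0,2,1,4,3,5]" "[0,3,4,1,2,5]"] generators_even(3,4) by (simp add: pcomp_def)
  assume "l \<in> set c5 \<union> set v4 \<union> set c3"
  then show ?thesis
    using i r2 r3 r4 w2 v generators_even by (auto simp: c5_def v4_def c3_def)
qed

lemma carrier_alt_5: "carrier (alt_group 5) = perm_of ` set a5"
proof -
  have fin: "finite (carrier (alt_group 5))"
    by (rule finite_subset[OF _ finite_permutations[of "{1..5}"]]) (auto simp: alt_group_carrier)
  have sub: "perm_of ` set a5 \<subseteq> carrier (alt_group 5)"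
  proof
    fix g assume "g \<in> perm_of ` set a5"
    then obtain x y w where xyw: "x \<in> set c5" "y \<in> set v4" "w \<in> set c3"
      and g: "g = perm_of (pcomp x (pcomp y w))" by (auto simp: a5_def)
    have ws: "length w = 6" "\<forall>i\<in>set w. i < 6" using xyw(3) by (auto simp: c3_def id5_def)
    have ys: "length y = 6" "\<forall>i\<in>set y. i < 6" using xyw(2) by (auto simp: v4_def id5_def)
    have yw: "length (pcomp y w) = 6" "\<forall>i\<in>set (pcomp y w). i < 6"
      using ws ys by (auto simp: pcomp_def)
    show "g \<in> carrier (alt_group 5)"
      unfolding g using xyw ws yw by (intro pcomp_alt factors_even) auto
  qed
  have "card (perm_of ` set a5) = 60"
    by (simp add: card_image[OF perm_of_inj] distinct_card[OF distinct_a5] length_a5)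
  moreover have "card (carrier (alt_group 5)) = 60"
    using alt_group_card_carrier[of 5] by (simp add: fact_numeral)
  ultimately show ?thesis using card_subset_eq[OF fin sub] by simp
qed

lemma card_alt_5: "card (carrier (alt_group 5)) = 60"
  using alt_group_card_carrier[of 5] by (simp add: fact_numeral)

lemma finite_alt: "finite (carrier (alt_group n))"
  by (rule finite_subset[OF _ finite_permutations[of "{1..n}"]]) (auto simp: alt_group_carrier)

lemma sum_alt_5: "(\<Sum>g\<in>carrier (alt_group 5). f g) = (\<Sum>l\<leftarrow>a5. f (perm_of l))"
  unfolding carrier_alt_5
  by (simp add: sum.reindex[OF perm_of_inj] sum_list_distinct_conv_sum_set[OF distinct_a5])

definition fixpts :: "(nat \<Rightarrow> nat) \<Rightarrow> nat" where
  "fixpts g = card {x\<in>{1..5}. g x = x}"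

lemma fixpts_perm_of: "fixpts (perm_of l) = fixl l"
proof -
  have eq: "{x\<in>{1..5}. perm_of l x = x} = set (filter (\<lambda>i. l ! i = i) pts)"
    unfolding atLeastAtMost_1_5 set_filter by (auto simp: perm_of_def)
  show ?thesis
    unfolding fixpts_def fixl_def eq by (rule distinct_card) simp
qed

text \<open>This wrapper keeps the simplifier from duplicating its argument before it has been evaluated; the
  enumerations below would otherwise recompute the list of group elements in each instance of a bound
  variable.\<close>

definition holds_for :: "'a \<Rightarrow> ('a \<Rightarrow> bool) \<Rightarrow> bool" where
  "holds_for x P \<longleftrightarrow> P x"

text \<open>The number of \<open>u\<close> with \<open>u x = z\<close>, each counted \<open>fix(u) + 1\<close> times: this computes the action of the block
  idempotent on the permutation module modulo 2.\<close>

lemma parity_fixl: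
  "\<forall>x\<in>set pts. \<forall>z\<in>set pts.
     even (\<Sum>l\<leftarrow>a5. if l ! x = z then fixl l + 1 else 0) \<longleftrightarrow> x = z"
proof -
  have "holds_for a5 (\<lambda>L. \<forall>x\<in>set pts. \<forall>z\<in>set pts.
     even (\<Sum>l\<leftarrow>L. if l ! x = z then fixl l + 1 else 0) \<longleftrightarrow> x = z)"
  by code_simp
  then show ?thesis by (simp only: holds_for_def)
qed

lemma parity_two_point:
  "\<forall>x\<in>set pts. \<forall>y\<in>set pts. \<forall>z\<in>set pts.
     odd (\<Sum>l\<leftarrow>a5. if l ! x = x \<and> l ! y = z then 1 else 0::nat) \<longleftrightarrow> y \<noteq> x \<and> z \<noteq> x"
proof -
  have "holds_for a5 (\<lambda>L. \<forall>x\<in>set pts. holds_for (filter (\<lambda>l. l ! x = x) L) (\<lambda>H. \<forall>y\<in>set pts. \<forall>z\<in>set pts.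
     odd (\<Sum>l\<leftarrow>H. if l ! y = z then 1 else 0::nat) \<longleftrightarrow> y \<noteq> x \<and> z \<noteq> x))"
  by code_simp
  moreover have "(\<Sum>l\<leftarrow>filter (\<lambda>l. l ! x = x) L. if l ! y = z then 1 else 0::nat) =
     (\<Sum>l\<leftarrow>L. if l ! x = x \<and> l ! y = z then 1 else 0)" for x y z L
    by (induction L) auto
  ultimately show ?thesis by (simp only: holds_for_def)
qed

lemma transitive_a5:
  "\<forall>x\<in>set pts. \<forall>z\<in>set pts. \<exists>l\<in>set a5. l ! x = z"
proof -
  have "holds_for a5 (\<lambda>L. \<forall>x\<in>set pts. \<forall>z\<in>set pts. \<exists>l\<in>set L. l ! x = z)"
    by code_simp
  then show ?thesis by (simp only: holds_for_def)
qed

lemma stab_not_elementary: "\<forall>x\<in>set pts. \<exists>l\<in>set a5. l ! x = x \<and> pcomp l l \<noteq> id5"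
  by code_simp

definition pinv :: "nat list \<Rightarrow> nat list" where
  "pinv l = map (\<lambda>i. length (takeWhile (\<lambda>j. l ! j \<noteq> i) id5)) id5"

lemma pinv_a5: "\<forall>l\<in>set a5. pcomp (pinv l) l = id5 \<and> pinv l \<in> set a5"
proof -
  have "holds_for a5 (\<lambda>L. \<forall>l\<in>set L. holds_for (pinv l) (\<lambda>m. pcomp m l = id5 \<and> m \<in> set L))"
    by code_simp
  then show ?thesis by (simp only: holds_for_def)
qed

lemma stab_a5: "\<forall>s\<in>set a5. pcomp s s = id5 \<longrightarrow> s \<noteq> id5 \<longrightarrow>
   (\<exists>x\<in>set pts. s ! x = x \<and> (\<forall>h\<in>set a5. s ! x = x \<longrightarrow> h ! x = x \<longrightarrow>
      pcomp s (pcomp h (pcomp s (pinv h))) = pcomp h (pcomp s (pcomp (pinv h) s))))"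
proof -
  have "holds_for a5 (\<lambda>L. \<forall>s\<in>set L. pcomp s s = id5 \<longrightarrow> s \<noteq> id5 \<longrightarrow>
   (\<exists>x\<in>set pts. s ! x = x \<and> (\<forall>h\<in>set L. s ! x = x \<longrightarrow> h ! x = x \<longrightarrow>
      pcomp s (pcomp h (pcomp s (pinv h))) = pcomp h (pcomp s (pcomp (pinv h) s)))))"
    by code_simp
  then show ?thesis by (simp only: holds_for_def)
qed

lemma perm_of_nth: "x \<in> set pts \<Longrightarrow> perm_of l x = l ! x"
  by (auto simp: perm_of_def)

lemma perm_of_pcomp_a5: "p \<in> set a5 \<Longrightarrow> q \<in> set a5 \<Longrightarrow> perm_of (pcomp p q) = perm_of p \<circ> perm_of q"
  using a5_entries by (intro perm_of_pcomp) auto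

lemma id5_in_a5: "id5 \<in> set a5"
  by code_simp

lemma pcomp_length: "length (pcomp p q) = length q"
  by (simp add: pcomp_def)

lemma perm_of_eqD: 
  assumes "length p = 6" "length q = 6" "perm_of p = perm_of q" 
  shows "p = q"
proof -
  have "p ! i = q ! i" if "i < 6" for i
    using fun_cong[OF assms(3), of i] that by (simp add: perm_of_def)
  then show "p = q" using assms by (intro nth_equalityI) auto
qed

lemma pcomp_eq_id5: "p \<in> set a5 \<Longrightarrow> perm_of p \<circ> perm_of p = id \<longleftrightarrow> pcomp p p = id5"
  using perm_of_pcomp_a5[of p p] perm_of_eqD[of "pcomp p p" id5] a5_entries
  by (auto simp: perm_of_id5 pcomp_length) (auto simp: id5_def)

lemma perm_of_pinv:
  assumes l: "l \<in> set a5"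
  shows "inv' (perm_of l) = perm_of (pinv l)"
proof (rule inv_equality)
  fix i
  have c: "perm_of (pinv l) \<circ> perm_of l = id"
    using perm_of_pcomp_a5[of "pinv l" l] pinv_a5 l by (simp add: perm_of_id5)
  then show "perm_of (pinv l) (perm_of l i) = i" by (simp add: pointfree_idE)
  have "perm_of l permutes {1..5}" using l carrier_alt_5 alt_group_carrier by blast
  then have "surj (perm_of l)" by (rule permutes_surj)
  then obtain j where "i = perm_of l j" by (metis surjD)
  then show "perm_of l (perm_of (pinv l) i) = i"
    using c by (simp add: pointfree_idE)
qed

lemma pcomp_closed:
  assumes "p \<in> set a5" "q \<in> set a5"
  shows "pcomp p q \<in> set a5"
proof -
  have "perm_of (pcomp p q) \<in> carrier (alt_group 5)"
    unfolding perm_of_pcomp_a5[OF assms] using assms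
    by (intro alt_group_comp) (auto simp: carrier_alt_5)
  then obtain m where m: "m \<in> set a5" "perm_of (pcomp p q) = perm_of m"
    by (auto simp: carrier_alt_5)
  moreover have "pcomp p q = m"
    using m a5_entries assms by (intro perm_of_eqD) (auto simp: pcomp_length)
  ultimately show ?thesis by simp
qed

text \<open>An involution of \<open>A\<^sub>5\<close> fixes exactly one point \<open>x\<close>. Its conjugates under the stabilizer of \<open>x\<close> lie in the
  Klein four-group of the stabilizer, which is abelian.\<close>

lemma alt_5_involution_stabilizer:
  assumes "s \<in> carrier (alt_group 5)" "s \<circ> s = id" "s \<noteq> id"
  obtains x where "x \<in> {1..5}"
    "\<And>h. h \<in> carrier (alt_group 5) \<Longrightarrow> h x = x \<Longrightarrow>
       s \<circ> (h \<circ> s \<circ> inv' h) = (h \<circ> s \<circ> inv' h) \<circ> s"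
proof -
  obtain l where l: "l \<in> set a5" "s = perm_of l" using assms(1) by (auto simp: carrier_alt_5)
  have "l \<noteq> id5" "pcomp l l = id5" using assms l pcomp_eq_id5 perm_of_id5 by auto
  then obtain x where x: "x \<in> set pts" and
    H: "\<And>h. h\<in>set a5 \<Longrightarrow> h ! x = x \<Longrightarrow>
      pcomp l (pcomp h (pcomp l (pinv h))) = pcomp h (pcomp l (pcomp (pinv h) l))"
    using stab_a5 l(1) by blast
  have "s \<circ> (h \<circ> s \<circ> inv' h) = (h \<circ> s \<circ> inv' h) \<circ> s"
    if h: "h \<in> carrier (alt_group 5)" "h x = x" for h
  proof -
    obtain m where m: "m \<in> set a5" "h = perm_of m" using h by (auto simp: carrier_alt_5)
    have p: "pinv m \<in> set a5" using pinv_a5 m(1) by blast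
    have "perm_of (pcomp l (pcomp m (pcomp l (pinv m)))) = perm_of (pcomp m (pcomp l (pcomp (pinv m) l)))"
      using H[OF m(1)] h(2) perm_of_nth[OF x] m by auto
    then show ?thesis
      unfolding l(2) m(2) perm_of_pinv[OF m(1)]
      using perm_of_pcomp_a5 pcomp_closed l(1) m(1) p by (simp add: o_assoc)
  qed
  then show thesis using that[of x] x atLeastAtMost_1_5 by blast
qed

lemma alt_5_stabilizer_not_elementary:
  assumes "x \<in> {1..5}"
  obtains u where "u \<in> carrier (alt_group 5)" "u x = x" "u \<circ> u \<noteq> id"
proof -
  obtain l where "l \<in> set a5" "l ! x = x" "pcomp l l \<noteq> id5"
    using stab_not_elementary assms unfolding atLeastAtMost_1_5 by blast
  moreover have "perm_of l x = l ! x"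
    using assms unfolding atLeastAtMost_1_5 by (rule perm_of_nth)
  ultimately show thesis using that[of "perm_of l"] pcomp_eq_id5 
    by (auto simp: carrier_alt_5)
qed

lemma alt_5_transitive:
  assumes "x \<in> {1..5}" "z \<in> {1..5}"
  obtains u where "u \<in> carrier (alt_group 5)" "u x = z"
proof -
  obtain l where "l \<in> set a5" "l ! x = z" 
    using transitive_a5 assms unfolding atLeastAtMost_1_5 by blast
  moreover have "perm_of l x = l ! x"
    using assms(1) unfolding atLeastAtMost_1_5 by (rule perm_of_nth)
  ultimately show thesis using that[of "perm_of l"] 
    by (auto simp: carrier_alt_5)
qed

lemma of_nat_char2: "CHAR('k::ring_1) = 2 \<Longrightarrow> (of_nat n :: 'k) = (if even n then 0 else 1)"
proof (cases "even n")
  case False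
  assume c: "CHAR('k) = 2"
  obtain m where "n = 2 * m + 1" using False by (elim oddE)
  moreover have "(of_nat (2 * m) :: 'k) = 0" using c by (simp only: of_nat_eq_0_iff_char_dvd) auto
  ultimately show ?thesis using False by simp
qed (simp add: of_nat_eq_0_iff_char_dvd)

lemma of_nat_sum_list: "of_nat (\<Sum>l\<leftarrow>xs. f l) = (\<Sum>l\<leftarrow>xs. of_nat (f l))"
  by (induction xs) auto

lemma sum_alt_5_of_nat:
  assumes "CHAR('k::field) = 2" "\<And>l. l \<in> set a5 \<Longrightarrow> f (perm_of l) = (of_nat (F l) :: 'k)"
  shows "(\<Sum>g\<in>carrier (alt_group 5). f g) = (if even (\<Sum>l\<leftarrow>a5. F l) then 0 else 1)"
proof -
  have "(\<Sum>g\<in>carrier (alt_group 5). f g) = of_nat (\<Sum>l\<leftarrow>a5. F l)"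
    unfolding sum_alt_5 of_nat_sum_list using assms(2) by (intro arg_cong[of _ _ sum_list] map_cong) auto
  then show ?thesis by (simp only: of_nat_char2[OF assms(1)])
qed

lemma sum_two_point:
  assumes "CHAR('k::field) = 2" "x \<in> {1..5}" "y \<in> {1..5}" "z \<in> {1..5}"
  shows "(\<Sum>g\<in>carrier (alt_group 5). if g x = x \<and> g y = z then 1 else 0) = 
         (if y \<noteq> x \<and> z \<noteq> x then 1 else (0::'k))"
proof -
  have *: "odd (\<Sum>l\<leftarrow>a5. if l ! x = x \<and> l ! y = z then 1 else 0::nat) \<longleftrightarrow> y \<noteq> x \<and> z \<noteq> x"
    using parity_two_point assms unfolding atLeastAtMost_1_5 by blast
  have "(\<Sum>g\<in>carrier (alt_group 5). if g x = x \<and> g y = z then 1 else 0) = 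
     (if even (\<Sum>l\<leftarrow>a5. if l ! x = x \<and> l ! y = z then 1 else 0::nat) then 0 else (1::'k))"
    using assms(2-4) unfolding atLeastAtMost_1_5 
    by (intro sum_alt_5_of_nat[OF assms(1)]) (simp add: perm_of_nth)
  then show ?thesis using * by auto
qed

lemma sum_fixpts:
  assumes "CHAR('k::field) = 2" "x \<in> {1..5}" "z \<in> {1..5}"
  shows "(\<Sum>g\<in>carrier (alt_group 5). if g x = z then of_nat (fixpts g) + 1 else 0) = (if x = z then 0 else (1::'k))"
proof -
  have *: "even (\<Sum>l\<leftarrow>a5. if l ! x = z then fixl l + 1 else 0::nat) \<longleftrightarrow> x = z"
    using parity_fixl assms unfolding atLeastAtMost_1_5 by blast
  have "(\<Sum>g\<in>carrier (alt_group 5). if g x = z then of_nat (fixpts g) + 1 else 0) = 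
     (if even (\<Sum>l\<leftarrow>a5. if l ! x = z then fixl l + 1 else 0::nat) then 0 else (1::'k))"
    using assms(2-3) unfolding atLeastAtMost_1_5 
    by (intro sum_alt_5_of_nat[OF assms(1)]) (simp add: perm_of_nth fixpts_perm_of)
  then show ?thesis using * by auto
qed

section \<open>Idempotent class functions\<close>

definition reps :: "nat list list" where
  "reps = [id5, [0,2,1,4,3,5], [0,2,3,1,4,5], [0,2,3,4,5,1], [0,3,4,5,1,2]]"

text \<open>For a 5-cycle \<open>l\<close> this lists 1 and its successive images, that is, a permutation conjugating the
  standard 5-cycle to \<open>l\<close>. Its parity distinguishes the two classes of 5-cycles, because the
  centralizer of a 5-cycle in the symmetric group consists of even permutations.\<close>

definition cycle_list :: "nat list \<Rightarrow> nat list" where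
  "cycle_list l = [0, 1, l!1, l!(l!1), l!(l!(l!1)), l!(l!(l!(l!1)))]"

text \<open>The classes in order: identity, double transpositions, 3-cycles, and the two classes of 5-cycles. Other
  than for 5-cycles, the number of fixed points determines the class.\<close>

definition class_index :: "nat list \<Rightarrow> nat" where
  "class_index l = (let n = fixl l in
     if n = 5 then 0 else if n = 1 then 1 else if n = 2 then 2 else if cycle_list l \<in> set a5 then 3 else 4)"

lemma class_index_fixl: "\<forall>l\<in>set a5. (class_index l = 0 \<longleftrightarrow> l = id5) \<and> (odd (fixl l) \<longleftrightarrow> class_index l \<le> 1)"
proof -
  have "holds_for a5 (\<lambda>L. \<forall>l\<in>set L. (class_index l = 0 \<longleftrightarrow> l = id5) \<and> (odd (fixl l) \<longleftrightarrow> class_index l \<le> 1))"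
    by code_simp
  then show ?thesis by (simp only: holds_for_def)
qed

lemma conjugate_to_rep:
  "\<forall>l\<in>set a5. \<exists>h\<in>set a5. pcomp h l = pcomp (reps ! class_index l) h"
proof -
  have "holds_for a5 (\<lambda>L. \<forall>l\<in>set L. holds_for (reps ! class_index l) (\<lambda>r. (\<exists>h\<in>set L. pcomp h l = pcomp r h)))"
    by code_simp
  then show ?thesis by (simp only: holds_for_def)
qed

definition factorizations :: "nat list \<Rightarrow> (nat \<times> nat) list" where
  "factorizations u = map (\<lambda>l. (class_index l, class_index (pcomp (pinv l) u))) a5"

definition count_pairs :: "(nat \<times> nat) list \<Rightarrow> nat list list" where
  "count_pairs ps = map (\<lambda>a. map (\<lambda>b. length (filter ((=) (a,b)) ps) mod 2) [0,1,2,3,4]) [0,1,2,3,4]"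

text \<open>Row \<open>a\<close>, column \<open>b\<close> counts modulo 2 the factorizations of the class representative into an
  element of class \<open>a\<close> and one of class \<open>b\<close>.\<close>

lemma structure_constants:
  "count_pairs (factorizations (reps ! 0)) =
     [[1,0,0,0,0], [0,1,0,0,0], [0,0,0,0,0], [0,0,0,0,0], [0,0,0,0,0]]"
  "count_pairs (factorizations (reps ! 1)) =
     [[0,1,0,0,0], [1,0,0,0,0], [0,0,0,0,0], [0,0,0,0,0], [0,0,0,0,0]]"
  "count_pairs (factorizations (reps ! 2)) =
     [[0,0,1,0,0], [0,1,0,1,1], [1,0,1,1,1], [0,1,1,1,1], [0,1,1,1,1]]"
  "count_pairs (factorizations (reps ! 3)) =
     [[0,0,0,1,0], [0,1,1,0,1], [0,1,1,1,1], [1,0,1,1,1], [0,1,1,1,1]]"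
  "count_pairs (factorizations (reps ! 4)) =
     [[0,0,0,0,1], [0,1,1,1,0], [0,1,1,1,1], [0,1,1,1,1], [1,0,1,1,1]]"
  by code_simp+

lemma class_index_less: "class_index l < 5"
  by (simp add: class_index_def Let_def)

lemma sum_list_pairs:
  fixes f :: "nat \<Rightarrow> nat \<Rightarrow> 'k::field"
  assumes "\<forall>(a,b)\<in>set ps. a < 5 \<and> b < 5"
  shows "(\<Sum>(a,b)\<leftarrow>ps. f a b) =
    (\<Sum>a<5. \<Sum>b<5. of_nat (length (filter ((=) (a,b)) ps)) * f a b)"
  using assms
proof (induction ps)
  case (Cons p ps)
  obtain c d where p: "p = (c,d)" by (cases p)
  have cd: "c < 5" "d < 5" using Cons.prems p by auto
  have "(\<Sum>a<5. \<Sum>b<5. of_nat (length (filter ((=) (a,b)) (p # ps))) * f a b) =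
    (\<Sum>a<5. \<Sum>b<5. (if b = d then if a = c then f a b else 0 else 0) + of_nat (length (filter ((=) (a,b)) ps)) * f a b)"
    by (intro sum.cong refl) (auto simp: p algebra_simps)
  also have "\<dots> = f c d + (\<Sum>a<5. \<Sum>b<5. of_nat (length (filter ((=) (a,b)) ps)) * f a b)"
    using cd by (simp add: sum.distrib)
  finally show ?case using Cons p by simp
qed simp

lemma count_pairs_nth:
  assumes "a < 5" "b < 5"
  shows "count_pairs ps ! a ! b = length (filter ((=) (a,b)) ps) mod 2"
proof -
  have upt: "[0,1,2,3,4] = [0..<5::nat]" by code_simp
  show ?thesis using assms unfolding count_pairs_def upt by simp
qed

text \<open>Let \<open>y\<^sub>0,...,y\<^sub>4\<close> be the values of \<open>z\<close> on the classes. Mixed terms of \<open>z\<^sup>2\<close> cancel by symmetry, and the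
  squares leave \<open>y\<^sub>0 = y\<^sub>0\<^sup>2 + y\<^sub>1\<^sup>2\<close>, \<open>y\<^sub>1 = 0\<close>, and \<open>y\<^sub>2\<^sup>2 + y\<^sub>3\<^sup>2 + y\<^sub>4\<^sup>2\<close> as the common value of \<open>y\<^sub>2\<close>, \<open>y\<^sub>3\<close>, \<open>y\<^sub>4\<close>.
  So \<open>y\<^sub>0\<close> and \<open>y\<^sub>2 = y\<^sub>3 = y\<^sub>4\<close> are 0 or 1. The classes 2, 3, 4 are those where the number of fixed points
  is even.\<close>

lemma class_function_idempotent:
  fixes z :: "(nat \<Rightarrow> nat) \<Rightarrow> 'k::field"
  assumes char: "CHAR('k) = 2"
    and cf: "\<And>g h g'. g \<in> carrier (alt_group 5) \<Longrightarrow> h \<in> carrier (alt_group 5) \<Longrightarrow>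
       g' \<in> carrier (alt_group 5) \<Longrightarrow> h \<circ> g = g' \<circ> h \<Longrightarrow> z g = z g'"
    and idem: "\<And>u. u \<in> carrier (alt_group 5) \<Longrightarrow>
       (\<Sum>g\<in>carrier (alt_group 5). z g * z (inv' g \<circ> u)) = z u"
  obtains a c where "a \<in> {0,1}" "c \<in> {0,1}"
    "\<And>u. u \<in> carrier (alt_group 5) \<Longrightarrow>
       z u = (if u = id then a else 0) + c * (of_nat (fixpts u) + 1)"
proof -
  define y where "y i = z (perm_of (reps ! i))" for i
  have in_alt: "perm_of l \<in> carrier (alt_group 5)" if "l \<in> set a5" for l
    using that by (simp add: carrier_alt_5)
  have reps: "reps ! i \<in> set a5" if "i < 5" for i
  proof -
    have "\<forall>r\<in>set reps. r \<in> set a5" by code_simp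
    moreover have "length reps = 5" by (simp add: reps_def)
    ultimately show ?thesis using that by auto
  qed
  have zy: "z (perm_of l) = y (class_index l)" if l: "l \<in> set a5" for l
  proof -
    obtain h where h: "h \<in> set a5" "pcomp h l = pcomp (reps ! class_index l) h"
      using conjugate_to_rep l by blast
    have r: "reps ! class_index l \<in> set a5" using reps class_index_less by blast
    have "perm_of h \<circ> perm_of l = perm_of (reps ! class_index l) \<circ> perm_of h"
      using arg_cong[OF h(2), of perm_of]
      unfolding perm_of_pcomp_a5[OF h(1) l] perm_of_pcomp_a5[OF r h(1)] .
    then show ?thesis unfolding y_def using cf in_alt l h(1) r by blast
  qed
  have eq: "y i = (\<Sum>a<5. \<Sum>b<5. of_nat (count_pairs (factorizations (reps ! i)) ! a ! b) * (y a * y b))"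
    if i: "i < 5" for i
  proof -
    have "y i = (\<Sum>l\<leftarrow>a5. z (perm_of l) * z (inv' (perm_of l) \<circ> perm_of (reps ! i)))"
      using idem[of "perm_of (reps ! i)"] in_alt reps i unfolding y_def sum_alt_5 by simp
    also have "\<dots> = (\<Sum>l\<leftarrow>a5. y (class_index l) * y (class_index (pcomp (pinv l) (reps ! i))))"
    proof (intro arg_cong[of _ _ sum_list] map_cong refl)
      fix l assume l: "l \<in> set a5"
      have p: "pinv l \<in> set a5" using pinv_a5 l by blast
      have "inv' (perm_of l) \<circ> perm_of (reps ! i) = perm_of (pcomp (pinv l) (reps ! i))"
        unfolding perm_of_pinv[OF l] perm_of_pcomp_a5[OF p reps[OF i]] ..
      moreover have "pcomp (pinv l) (reps ! i) \<in> set a5"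
        using pcomp_closed p reps i by blast
      ultimately show "z (perm_of l) * z (inv' (perm_of l) \<circ> perm_of (reps ! i)) =
          y (class_index l) * y (class_index (pcomp (pinv l) (reps ! i)))"
        using zy l by simp
    qed
    also have "\<dots> = (\<Sum>(a,b)\<leftarrow>factorizations (reps ! i). y a * y b)"
      by (simp add: factorizations_def comp_def)
    also have "\<dots> = (\<Sum>a<5. \<Sum>b<5. of_nat (length (filter ((=) (a,b)) (factorizations (reps ! i)))) * (y a * y b))"
      by (rule sum_list_pairs) (auto simp: factorizations_def class_index_less)
    also have "\<dots> = (\<Sum>a<5. \<Sum>b<5. of_nat (count_pairs (factorizations (reps ! i)) ! a ! b) * (y a * y b))"
    proof (intro sum.cong refl)
      fix a b :: nat assume "a \<in> {..<5}" "b \<in> {..<5}"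
      moreover have "(of_nat n :: 'k) = of_nat (n mod 2)" for n
        by (simp add: of_nat_char2[OF char] mod_2_eq_odd)
      ultimately show "of_nat (length (filter ((=) (a,b)) (factorizations (reps ! i)))) * (y a * y b) =
         of_nat (count_pairs (factorizations (reps ! i)) ! a ! b) * (y a * y b)"
        by (simp add: count_pairs_nth)
    qed
    finally show ?thesis .
  qed
  have two: "x + x = (0::'k)" for x
    using of_nat_char2[OF char, of 2] by (simp flip: mult_2)
  have two': "x + (x + w) = (w::'k)" for x w
    by (simp flip: add.assoc add: two)
  have five: "(\<Sum>a<5. f a) = f 0 + f 1 + f 2 + f 3 + f (4::nat)" for f :: "nat \<Rightarrow> 'k"
    by (simp add: eval_nat_numeral)
  have y0: "y 0 * y 0 + y 1 * y 1 = y 0"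
    using eq[of 0] unfolding structure_constants five by simp
  have y1: "y 1 = 0"
    using eq[of 1] unfolding structure_constants five by (simp add: two mult.commute)
  have y2: "y 2 * y 2 + y 3 * y 3 + y 4 * y 4 = y 2"
    using eq[of 2] unfolding structure_constants five y1
    by (simp add: y1[simplified] two two' ac_simps)
  have y3: "y 2 * y 2 + y 3 * y 3 + y 4 * y 4 = y 3"
    using eq[of 3] unfolding structure_constants five y1
    by (simp add: y1[simplified] two two' ac_simps)
  have y4: "y 2 * y 2 + y 3 * y 3 + y 4 * y 4 = y 4"
    using eq[of 4] unfolding structure_constants five y1
    by (simp add: y1[simplified] two two' ac_simps)
  have a: "y 0 \<in> {0,1}"
    using y0 y1 by auto
  have c: "y 3 = y 2" "y 4 = y 2" using y2 y3 y4 by auto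
  then have "y 2 * y 2 = y 2" using y2 by (simp add: two)
  then have c': "y 2 \<in> {0,1}" by auto
  have "z u = (if u = id then y 0 else 0) + y 2 * (of_nat (fixpts u) + 1)"
    if u: "u \<in> carrier (alt_group 5)" for u
  proof -
    obtain l where l: "l \<in> set a5" "u = perm_of l" using u by (auto simp: carrier_alt_5)
    have id: "u = id \<longleftrightarrow> class_index l = 0"
      using class_index_fixl l perm_of_eqD[of l id5] a5_entries id5_in_a5 perm_of_id5 by metis
    have "class_index l = 0 \<or> class_index l = 1 \<or> class_index l = 2 \<or> class_index l = 3 \<or> class_index l = 4"
      using class_index_less[of l] by auto
    moreover have "odd (fixl l) \<longleftrightarrow> class_index l \<le> 1" using class_index_fixl l by blast
    ultimately show ?thesis
      unfolding id unfolding l(2) fixpts_perm_of of_nat_char2[OF char] zy[OF l(1)]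
      using c y1 two[of 1] by (elim disjE) simp_all
  qed
  then show thesis using that a c' by blast
qed

section \<open>The block idempotent, the trivial module and the sum zero module\<close>

abbreviation G5 :: "(nat \<Rightarrow> nat) monoid" where "G5 \<equiv> alt_group 5"

interpretation G5: finite_group G5
  by (intro finite_group.intro finite_group_axioms.intro alt_group_is_group finite_alt)

abbreviation kA5 :: "((nat \<Rightarrow> nat) \<Rightarrow> 'k::field) ring" where "kA5 \<equiv> group_algebra G5"

abbreviation kA5_mult (infixl "\<star>" 70) where "a \<star> b \<equiv> a \<otimes>\<^bsub>kA5\<^esub> b"

lemma G5_comp: "g \<in> carrier G5 \<Longrightarrow> h \<in> carrier G5 \<Longrightarrow> g \<circ> h \<in> carrier G5"
  by (rule alt_group_comp)

lemma G5_inv: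
  assumes "g \<in> carrier G5"
  shows "inv\<^bsub>G5\<^esub> g = inv' g" "inv' g \<in> carrier G5" "inv' g \<circ> g = id" "g \<circ> inv' g = id" 
    "inv' g x = y \<longleftrightarrow> g y = x" "x \<in> {1..5} \<longleftrightarrow> g x \<in> {1..5}" "inv' (inv' g) = g"
proof -
  have p: "g permutes {1..5}" using assms by (simp add: alt_group_carrier)
  show "inv\<^bsub>G5\<^esub> g = inv' g" by (rule alt_group_inv_equality[OF assms])
  show "inv' g \<in> carrier G5" by (rule alt_group_inv_closed[OF assms])
  show "inv' g \<circ> g = id" "g \<circ> inv' g = id" using permutes_inv_o[OF p] by auto
  show "inv' g x = y \<longleftrightarrow> g y = x" using permutes_inv_eq[OF p] by auto
  show "x \<in> {1..5} \<longleftrightarrow> g x \<in> {1..5}" using permutes_in_image[OF p] by auto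
  show "inv' (inv' g) = g" using permutes_inv_inv[OF p] .
qed

lemma G5_inv_comp:
  "g \<in> carrier G5 \<Longrightarrow> h \<in> carrier G5 \<Longrightarrow> inv' (g \<circ> h) = inv' h \<circ> inv' g"
  using G5.inv_mult_group[of g h] G5_inv(1) G5_comp by (simp add: alt_group_mult)

lemma linear_rep_trivial: "linear_rep G5 ((*) :: 'k::field \<Rightarrow> 'k \<Rightarrow> 'k) UNIV (\<lambda>g x. x)"
proof -
  show ?thesis
    by unfold_locales (auto simp: vector_space_over_itself.subspace_def)
qed

lemma trivial_smult:
  "carrier (trivial_module G5) = UNIV" "\<zero>\<^bsub>trivial_module G5\<^esub> = 0"
  "a \<odot>\<^bsub>trivial_module G5\<^esub> v = (\<Sum>g\<in>carrier G5. a g) * v"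
  by (simp_all add: trivial_module_def linear_module_def sum_distrib_right)

lemma simple_trivial: "simple_module kA5 (trivial_module G5 :: ((nat \<Rightarrow> nat) \<Rightarrow> 'k, 'k::field) module)"
proof -
  interpret T: linear_rep G5 "(*) :: 'k::field \<Rightarrow> 'k \<Rightarrow> 'k" UNIV "\<lambda>g x. x" by (rule linear_rep_trivial)
  have "U = {0} \<or> U = UNIV" if U: "submodule U kA5 T.M" for U
  proof (cases "\<exists>u\<in>U. u \<noteq> 0")
    case True
    then obtain u where u: "u \<in> U" "u \<noteq> 0" by blast
    have "x \<in> U" for x
      using vector_space_over_itself.subspace_scale[OF T.submodule_invariant(2)[OF U] u(1), of "x / u"] u(2) by simp
    then show ?thesis by auto
  next
    case False
    then show ?thesis using vector_space_over_itself.subspace_0[OF T.submodule_invariant(2)[OF U]] by auto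
  qed
  moreover have "(UNIV :: 'k set) \<noteq> {0}" using UNIV_I[of "1::'k"] by (metis singletonD zero_neq_one)
  ultimately show ?thesis
    unfolding simple_module_def trivial_module_def using T.left_module_M by (simp add: T.M_simps)
qed

definition block_idem :: "(nat \<Rightarrow> nat) \<Rightarrow> 'k::field" where
  "block_idem g = (if g \<in> carrier G5 then of_nat (fixpts g) + 1 else 0)"

text \<open>The matrix entries of \<open>a\<close> on the permutation module \<open>k\<^sup>5\<close>.\<close>

definition point_sum :: "((nat \<Rightarrow> nat) \<Rightarrow> 'k::field) \<Rightarrow> nat \<Rightarrow> nat \<Rightarrow> 'k" where
  "point_sum a x z = (\<Sum>g\<in>carrier G5. if g x = z then a g else 0)"

lemma block_idem_closed: "block_idem \<in> carrier kA5"
  by (simp add: G5.KG_simps block_idem_def)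

lemma of_nat_fixpts: "of_nat (fixpts g) = (\<Sum>x\<in>{1..5}. if g x = x then 1 else (0::'k::field))"
  by (simp add: fixpts_def sum.If_cases Int_def)

lemma point_sum_block_idem:
  assumes "CHAR('k::field) = 2" "x \<in> {1..5}" "z \<in> {1..5}"
  shows "point_sum block_idem x z = (if x = z then 0 else (1::'k))"
  unfolding point_sum_def sum_fixpts[OF assms, symmetric] by (intro sum.cong refl) (auto simp: block_idem_def)

lemma sum_by_image:
  assumes "x \<in> {1..5}"
  shows "(\<Sum>g\<in>carrier G5. a g) = (\<Sum>z\<in>{1..5}. point_sum a x z)"
proof -
  have "(\<Sum>z\<in>{1..5}. point_sum a x z) = (\<Sum>g\<in>carrier G5. \<Sum>z\<in>{1..5}. if g x = z then a g else 0)"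
    unfolding point_sum_def by (rule sum.swap)
  also have "\<dots> = (\<Sum>g\<in>carrier G5. a g)"
  proof (intro sum.cong refl)
    fix g assume "g \<in> carrier G5"
    then have "g x \<in> {1..5}" using assms G5_inv(6) by blast
    then show "(\<Sum>z\<in>{1..5}. if g x = z then a g else 0) = a g" by simp
  qed
  finally show ?thesis by simp
qed

text \<open>Writing \<open>fix(g\<^sup>-\<^sup>1h)\<close> as the number of points \<open>x\<close> with \<open>g x = h x\<close> expresses right multiplication by
  the block idempotent through the action on \<open>k\<^sup>5\<close> and the augmentation.\<close>

lemma mult_block_idem:
  assumes "h \<in> carrier G5"
  shows "(a \<star> block_idem) h = (\<Sum>x\<in>{1..5}. point_sum a x (h x)) + (\<Sum>g\<in>carrier G5. (a g::'k::field))"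
proof -
  have "(a \<star> block_idem) h = (\<Sum>g\<in>carrier G5. a g * (of_nat (fixpts (inv' g \<circ> h)) + 1))"
    using assms by (simp add: G5.KG_mult alt_group_mult block_idem_def G5_inv G5_comp cong: sum.cong)
  also have "\<dots> = (\<Sum>g\<in>carrier G5. (\<Sum>x\<in>{1..5}. if g x = h x then a g else 0) + a g)"
    unfolding of_nat_fixpts
    by (intro sum.cong refl) (auto simp: algebra_simps sum_distrib_left G5_inv if_distrib[of "\<lambda>c. _ * c"] cong: if_cong intro!: sum.cong)
  also have "\<dots> = (\<Sum>x\<in>{1..5}. point_sum a x (h x)) + (\<Sum>g\<in>carrier G5. a g)"
    unfolding point_sum_def sum.distrib by (subst sum.swap) simp
  finally show ?thesis .
qed

lemma char2_add_self: "CHAR('k::field) = 2 \<Longrightarrow> x + x = (0::'k)"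
  using of_nat_char2[of 2, where 'k='k] by (simp flip: mult_2)

lemma sum_block_idem:
  assumes "CHAR('k::field) = 2"
  shows "(\<Sum>g\<in>carrier G5. block_idem g :: 'k) = 0"
proof -
  have "(\<Sum>g\<in>carrier G5. block_idem g :: 'k) = (\<Sum>z\<in>{1..5::nat}. point_sum block_idem 1 z)"
    by (rule sum_by_image) simp
  also have "\<dots> = (\<Sum>z\<in>{1..5::nat}. if 1 = z then 0 else (1::'k))"
    using point_sum_block_idem[OF assms, of 1] by (intro sum.cong refl) auto
  also have "{1..5::nat} = {1,2,3,4,5}" by auto
  finally show ?thesis using of_nat_char2[OF assms, of 4] by simp
qed

text \<open>On \<open>k\<^sup>5\<close> the block idempotent sends a basis vector to the sum of the others, so \<open>mult_block_idem\<close>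
  returns at \<open>h\<close> the number of points that \<open>h\<close> moves, and \<open>5 - fix(h)\<close> is \<open>fix(h) + 1\<close> modulo 2.\<close>

lemma block_idem_square:
  assumes "CHAR('k::field) = 2"
  shows "block_idem \<star> block_idem = (block_idem :: _ \<Rightarrow> 'k)"
proof
  fix h
  show "(block_idem \<star> block_idem) h = (block_idem h :: 'k)"
  proof (cases "h \<in> carrier G5")
    case True
    then have "(block_idem \<star> block_idem) h = (\<Sum>x\<in>{1..5}. point_sum block_idem x (h x) :: 'k)"
      by (simp add: mult_block_idem sum_block_idem[OF assms])
    also have "\<dots> = (\<Sum>x\<in>{1..5}. if h x = x then 0 else 1)"
      using point_sum_block_idem[OF assms] G5_inv(6)[OF True] by (intro sum.cong refl) auto
    also have "\<dots> = (\<Sum>x\<in>{1..5}. 1 + (if h x = x then 1 else 0))"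
      using char2_add_self[OF assms, of 1] by (intro sum.cong refl) auto
    also have "\<dots> = of_nat 5 + of_nat (fixpts h)"
      unfolding sum.distrib of_nat_fixpts by simp
    also have "\<dots> = block_idem h" using True by (simp only: of_nat_char2[OF assms] block_idem_def) simp
    finally show ?thesis .
  qed (simp add: G5.KG_mult block_idem_def)
qed

lemma block_idem_class:
  assumes "g \<in> carrier G5" "h \<in> carrier G5" "g' \<in> carrier G5" "h \<circ> g = g' \<circ> h"
  shows "block_idem g = block_idem g'"
proof -
  have "bij_betw h {x\<in>{1..5}. g x = x} {x\<in>{1..5}. g' x = x}"
  proof (rule bij_betw_byWitness[where f' = "inv' h"])
    have eq: "h (g x) = g' (h x)" for x using fun_cong[OF assms(4)] by simp
    note H = G5_inv[OF assms(2)]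
    show "\<forall>a\<in>{x\<in>{1..5}. g x = x}. inv' h (h a) = a" by (simp add: H)
    have hi: "h (inv' h x) = x" for x using H(4) by (simp add: pointfree_idE)
    then show "\<forall>a'\<in>{x\<in>{1..5}. g' x = x}. h (inv' h a') = a'" by simp
    show "h ` {x\<in>{1..5}. g x = x} \<subseteq> {x\<in>{1..5}. g' x = x}" 
    proof
      fix y assume "y \<in> h ` {x\<in>{1..5}. g x = x}"
      then obtain x where x: "y = h x" "x \<in> {1..5}" "g x = x" by blast
      then show "y \<in> {x\<in>{1..5}. g' x = x}" using eq[of x] H(6)[of x] by simp
    qed
    have "g (inv' h x) = inv' h x" if "g' x = x" for x
      using eq[of "inv' h x"] hi that H(5) by metis
    moreover have "inv' h x \<in> {1..5} \<longleftrightarrow> x \<in> {1..5}" for x using H(6)[of "inv' h x"] hi by simp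
    ultimately show "inv' h ` {x\<in>{1..5}. g' x = x} \<subseteq> {x\<in>{1..5}. g x = x}"
      by (auto simp del: atLeastAtMost_iff)
  qed
  then have "fixpts g = fixpts g'" unfolding fixpts_def by (rule bij_betw_same_card)
  then show ?thesis using assms by (simp add: block_idem_def)
qed

lemma class_function_central:
  assumes "z \<in> carrier kA5"
    and "\<And>g h g'. g \<in> carrier G5 \<Longrightarrow> h \<in> carrier G5 \<Longrightarrow> g' \<in> carrier G5 \<Longrightarrow> h \<circ> g = g' \<circ> h \<Longrightarrow> z g = z g'"
  shows "z \<star> a = a \<star> (z :: _ \<Rightarrow> 'k::field)"
proof
  fix u show "(z \<star> a) u = (a \<star> z) u"
  proof (cases "u \<in> carrier G5")
    case u: True
    have "(a \<star> z) u = (\<Sum>y\<in>carrier G5. a y * z (inv' y \<circ> u))"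
      using u by (simp add: G5.KG_mult alt_group_mult G5_inv cong: sum.cong)
    also have "\<dots> = (\<Sum>y\<in>carrier G5. a y * z (u \<circ> inv' y))"
    proof (intro sum.cong refl arg_cong2[of _ _ _ _ "(*)"])
      fix y assume y: "y \<in> carrier G5"
      have "y \<circ> (inv' y \<circ> u) = (u \<circ> inv' y) \<circ> y"
        using G5_inv(3,4)[OF y] by (metis o_assoc comp_id id_comp)
      then show "z (inv' y \<circ> u) = z (u \<circ> inv' y)"
        by (rule assms(2)[OF G5_comp[OF G5_inv(2)[OF y] u] y G5_comp[OF u G5_inv(2)[OF y]]])
    qed
    also have "\<dots> = (\<Sum>x\<in>carrier G5. a (inv' x \<circ> u) * z x)"
    proof (rule sum.reindex_bij_witness[of _ "\<lambda>x. inv' x \<circ> u" "\<lambda>y. u \<circ> inv' y"])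
      fix y assume y: "y \<in> carrier G5"
      have iuy: "inv' (u \<circ> inv' y) = y \<circ> inv' u"
        using G5_inv_comp[OF u G5_inv(2)[OF y]] G5_inv(7)[OF y] by simp
      have "y \<circ> inv' u \<circ> u = y" using G5_inv(3)[OF u] by (simp add: comp_assoc)
      then show 1: "inv' (u \<circ> inv' y) \<circ> u = y" using iuy by simp
      show "u \<circ> inv' y \<in> carrier G5" by (rule G5_comp[OF u G5_inv(2)[OF y]])
      show "a (inv' (u \<circ> inv' y) \<circ> u) * z (u \<circ> inv' y) = a y * z (u \<circ> inv' y)" by (simp only: 1)
      have "inv' (inv' y \<circ> u) = inv' u \<circ> y"
        using G5_inv_comp[OF G5_inv(2)[OF y] u] G5_inv(7)[OF y] by simp
      moreover have "u \<circ> (inv' u \<circ> y) = y" using G5_inv(4)[OF u] by (simp add: o_assoc)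
      ultimately show "u \<circ> inv' (inv' y \<circ> u) = y" by simp
      show "inv' y \<circ> u \<in> carrier G5" by (rule G5_comp[OF G5_inv(2)[OF y] u])
    qed
    also have "\<dots> = (z \<star> a) u"
      using u by (simp add: G5.KG_mult alt_group_mult G5_inv mult.commute cong: sum.cong)
    finally show ?thesis by simp
  qed (simp add: G5.KG_mult)
qed

abbreviation "coord_act \<equiv> \<lambda>(g :: nat \<Rightarrow> nat) (v :: nat \<Rightarrow> 'k::field) x. v ((inv\<^bsub>G5\<^esub> g) x)"
abbreviation "coord_scale \<equiv> \<lambda>(c :: 'k::field) (v :: nat \<Rightarrow> 'k) x. c * v x"
abbreviation "sum_zero_vectors \<equiv> {v :: nat \<Rightarrow> 'k::field. (\<forall>x. x \<notin> {1..5} \<longrightarrow> v x = 0) \<and> (\<Sum>x\<in>{1..5}. v x) = 0}"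

lemma sum_zero_module_eq: "sum_zero_module G5 {1..5} = linear_module G5 sum_zero_vectors coord_scale coord_act"
  by (simp add: sum_zero_module_def permutation_module_def linear_module_def)

lemma linear_rep_sum_zero: "linear_rep G5 (coord_scale :: 'k::field \<Rightarrow> _) sum_zero_vectors coord_act"
proof -
  interpret vs: vector_space "coord_scale :: 'k \<Rightarrow> _"
    by unfold_locales (auto simp: fun_eq_iff algebra_simps)
  show ?thesis
  proof (intro linear_rep.intro linear_rep_axioms.intro G5.finite_group_axioms vs.vector_space_axioms)
    show "vs.subspace sum_zero_vectors" 
      by (auto simp: vs.subspace_def sum.distrib simp flip: sum_distrib_left)
    fix g :: "nat \<Rightarrow> nat" and v :: "nat \<Rightarrow> 'k" assume g: "g \<in> carrier G5"
    note gi = G5_inv[OF g]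
    show "coord_act g v \<in> sum_zero_vectors" if v: "v \<in> sum_zero_vectors"
    proof -
      have "(\<Sum>x\<in>{1..5}. v (inv' g x)) = (\<Sum>x\<in>{1..5}. v x)"
        using g by (intro sum.permute[symmetric, unfolded comp_def] permutes_inv) (simp add: alt_group_carrier)
      moreover have "inv' g x \<notin> {1..5}" if "x \<notin> {1..5}" for x
        using that gi(5)[of x "inv' g x"] gi(6)[of "inv' g x"] by simp
      ultimately show ?thesis using v unfolding gi(1) by auto
    qed
    fix h assume h: "h \<in> carrier G5"
    have "inv' (g \<circ> h) = inv' h \<circ> inv' g" 
      by (rule G5_inv_comp[OF g h])
    then show "coord_act (g \<otimes>\<^bsub>G5\<^esub> h) v = coord_act g (coord_act h v)"
      using G5_inv(1)[OF h] gi(1) G5_inv(1)[OF G5_comp[OF g h]] by (simp add: alt_group_mult)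
  qed (auto simp: fun_eq_iff G5_inv alt_group_one permutes_id alt_group_carrier inv_id)
qed

lemma sum_fun_apply: "(\<Sum>i\<in>I. f i) x = (\<Sum>i\<in>I. f i x)"
  by (induction I rule: infinite_finite_induct) auto

lemma sum_zero_smult:
  fixes v :: "nat \<Rightarrow> 'k::field"
  assumes v: "\<And>x. x \<notin> {1..5} \<Longrightarrow> v x = 0"
  shows "(\<Sum>g\<in>carrier G5. coord_scale (a g) (coord_act g v)) z = (\<Sum>x\<in>{1..5}. point_sum a x z * v x)"
proof -
  have "(\<Sum>g\<in>carrier G5. coord_scale (a g) (coord_act g v)) z = (\<Sum>g\<in>carrier G5. a g * v (inv' g z))"
    by (simp add: sum_fun_apply G5_inv cong: sum.cong)
  also have "\<dots> = (\<Sum>g\<in>carrier G5. \<Sum>x\<in>{1..5}. if g x = z then a g * v x else 0)"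
  proof (intro sum.cong refl)
    fix g assume g: "g \<in> carrier G5"
    have "(\<Sum>x\<in>{1..5}. if g x = z then a g * v x else 0) = (\<Sum>x\<in>{1..5}. if x = inv' g z then a g * v x else 0)"
      using G5_inv(5)[OF g] by (intro sum.cong refl) (metis)
    also have "\<dots> = a g * v (inv' g z)" using v[of "inv' g z"] by auto
    finally show "a g * v (inv' g z) = (\<Sum>x\<in>{1..5}. if g x = z then a g * v x else 0)" by simp
  qed
  also have "\<dots> = (\<Sum>x\<in>{1..5}. \<Sum>g\<in>carrier G5. if g x = z then a g * v x else 0)" by (rule sum.swap)
  also have "\<dots> = (\<Sum>x\<in>{1..5}. point_sum a x z * v x)"
    unfolding point_sum_def sum_distrib_right by (intro sum.cong refl) auto
  finally show ?thesis .
qed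

text \<open>The sum of the stabilizer of a point \<open>x\<close> sends \<open>u\<close> to \<open>u x\<close> times the vector \<open>t x\<close> with entries 0 at
  \<open>x\<close> and 1 elsewhere. So a nonzero submodule contains some \<open>t x\<close>, by transitivity all of them, and
  they span: \<open>w\<close> is the combination of the \<open>t y\<close> with coefficients \<open>w y\<close>.\<close>

lemma simple_sum_zero:
  assumes char: "CHAR('k::field) = 2"
  shows "simple_module kA5 (sum_zero_module G5 {1..5} :: (_ \<Rightarrow> 'k, _) module)"
proof -
  interpret S: linear_rep G5 "coord_scale :: 'k \<Rightarrow> _" sum_zero_vectors coord_act by (rule linear_rep_sum_zero)
  note two = char2_add_self[OF char]
  have neg: "- x = x" for x :: 'k using two[of x] by (simp add: eq_neg_iff_add_eq_0 minus_unique)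
  define t :: "nat \<Rightarrow> nat \<Rightarrow> 'k" where "t x = (\<lambda>z. if z \<in> {1..5} - {x} then 1 else 0)" for x
  have tS: "t x \<in> sum_zero_vectors" if x: "x \<in> {1..5}" for x
  proof -
    have "(\<Sum>z\<in>{1..5}. t x z) = of_nat (card ({1..5} - {x}))"
      by (simp add: t_def sum.If_cases Int_def set_diff_eq)
    also have "\<dots> = 0" using x by (simp only: of_nat_char2[OF char]) simp
    finally show ?thesis by (simp add: t_def)
  qed
  have "U = {0} \<or> U = sum_zero_vectors" if U: "submodule U kA5 S.M" for U
  proof (cases "\<exists>u\<in>U. u \<noteq> 0")
    case True
    note inv = S.submodule_invariant[OF U]
    obtain u where u: "u \<in> U" "u \<noteq> 0" using True by blast
    have uS: "u \<in> sum_zero_vectors" using u inv(1) by blast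
    then obtain x where x: "u x \<noteq> 0" "x \<in> {1..5}" using u(2) by (auto simp: fun_eq_iff)
    define a :: "(nat \<Rightarrow> nat) \<Rightarrow> 'k" where "a g = (if g \<in> carrier G5 \<and> g x = x then 1 else 0)" for g
    have "a \<in> carrier kA5" by (simp add: a_def G5.KG_simps)
    then have au: "a \<odot>\<^bsub>S.M\<^esub> u \<in> U" using inv(4) u by blast
    have "(a \<odot>\<^bsub>S.M\<^esub> u) z = u x * t x z" for z
    proof (cases "z \<in> {1..5}")
      case z: True
      have "(a \<odot>\<^bsub>S.M\<^esub> u) z = (\<Sum>y\<in>{1..5}. point_sum a y z * u y)"
        unfolding S.M_simps using uS by (intro sum_zero_smult) auto
      also have "\<dots> = (\<Sum>y\<in>{1..5}. if z = x then 0 else u y - (if y = x then u y else 0))"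
      proof (intro sum.cong refl)
        fix y assume y: "y \<in> {1..5::nat}"
        have "point_sum a y z = (\<Sum>g\<in>carrier G5. if g x = x \<and> g y = z then 1 else 0)"
          unfolding point_sum_def a_def by (intro sum.cong refl) auto
        also have "\<dots> = (if y \<noteq> x \<and> z \<noteq> x then 1 else 0)" by (rule sum_two_point[OF char x(2) y z])
        finally show "point_sum a y z * u y = (if z = x then 0 else u y - (if y = x then u y else 0))" by auto
      qed
      also have "\<dots> = (if z = x then 0 else u x)"
        using uS x(2) by (simp add: sum_subtractf neg)
      finally show ?thesis using z by (simp add: t_def)
    next
      case False
      moreover have "a \<odot>\<^bsub>S.M\<^esub> u \<in> sum_zero_vectors" using au inv(1) by blast
      ultimately show ?thesis by (auto simp: t_def)
    qed
    then have "coord_scale (inverse (u x)) (a \<odot>\<^bsub>S.M\<^esub> u) = t x" using x by (simp add: fun_eq_iff)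
    then have tx: "t x \<in> U" using S.vs.subspace_scale[OF inv(2) au, of "inverse (u x)"] by simp
    have ty: "t y \<in> U" if y: "y \<in> {1..5}" for y
    proof -
      obtain g where g: "g \<in> carrier G5" "g x = y" using alt_5_transitive[OF x(2) y] .
      have "coord_act g (t x) = t y"
      proof
        fix z
        have "inv' g z \<in> {1..5} \<longleftrightarrow> z \<in> {1..5}" using G5_inv(5,6)[OF g(1)] by metis
        moreover have "inv' g z = x \<longleftrightarrow> z = y" using G5_inv(5)[OF g(1)] g(2) by auto
        ultimately show "coord_act g (t x) z = t y z" by (simp add: t_def G5_inv(1)[OF g(1)] del: atLeastAtMost_iff)
      qed
      then show ?thesis using inv(3)[OF g(1) tx] by simp
    qed
    have "w \<in> U" if w: "w \<in> sum_zero_vectors" for w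
    proof -
      have "w = (\<Sum>y\<in>{1..5}. coord_scale (w y) (t y))"
      proof
        fix z
        show "w z = (\<Sum>y\<in>{1..5}. coord_scale (w y) (t y)) z"
        proof (cases "z \<in> {1..5}")
          case True
          then have "(\<Sum>y\<in>{1..5}. coord_scale (w y) (t y)) z = (\<Sum>y\<in>{1..5}. w y - (if y = z then w y else 0))"
            by (auto simp: sum_fun_apply t_def intro!: sum.cong)
          also have "\<dots> = w z" using True w by (simp add: sum_subtractf neg)
          finally show ?thesis by simp
        next
          case False
          then show ?thesis using w by (auto simp: sum_fun_apply t_def)
        qed
      qed
      also have "\<dots> \<in> U"
        by (intro S.vs.subspace_sum[OF inv(2)] S.vs.subspace_scale[OF inv(2)] ty)
      finally show ?thesis .
    qed
    then show ?thesis using inv(1) by blast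
  next
    case False
    then show ?thesis using S.vs.subspace_0[OF S.submodule_invariant(2)[OF U]] by auto
  qed
  moreover have "sum_zero_vectors \<noteq> {0 :: nat \<Rightarrow> 'k}"
  proof -
    have "t 1 2 \<noteq> 0" by (simp add: t_def)
    then have n: "t 1 \<notin> {0}" by auto
    have m: "t 1 \<in> sum_zero_vectors" by (rule tS) simp
    show ?thesis
    proof
      assume eq: "sum_zero_vectors = {0 :: nat \<Rightarrow> 'k}"
      show False using n m unfolding eq by (rule notE)
    qed
  qed
  ultimately show ?thesis
    unfolding simple_module_def sum_zero_module_eq S.M_simps(1,3) using S.left_module_M by blast
qed

section \<open>The two-dimensional modules\<close>

lemma mult_vec_entries: "((A::'k::field^2^2) *v v) $ 1 = A$1$1 * v$1 + A$1$2 * v$2"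
  "(A *v v) $ 2 = A$2$1 * v$1 + A$2$2 * v$2"
  by (simp_all add: matrix_vector_mult_def sum_2)

lemma mult_mat_entries: "((A::'k::field^2^2) ** B) $ i $ j = A$i$1 * B$1$j + A$i$2 * B$2$j"
  by (simp add: matrix_matrix_mult_def sum_2)

lemma one_entries: "(mat 1 :: 'k::field^2^2) $ 1 $ 1 = 1" "(mat 1 :: 'k::field^2^2) $ 2 $ 2 = 1"
   "(mat 1 :: 'k::field^2^2) $ 1 $ 2 = 0" "(mat 1 :: 'k::field^2^2) $ 2 $ 1 = 0"
  by (simp_all add: mat_def)

lemma mat2_eq_iff: "(A::'k^2^2) = B \<longleftrightarrow> A$1$1 = B$1$1 \<and> A$1$2 = B$1$2 \<and> A$2$1 = B$2$1 \<and> A$2$2 = B$2$2"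
  by (auto simp: vec_eq_iff forall_2)

lemma vec2_eq_iff: "(v::'k^2) = w \<longleftrightarrow> v$1 = w$1 \<and> v$2 = w$2"
  by (auto simp: vec_eq_iff forall_2)

text \<open>Faithful two-dimensional representations with determinant one whose image contains an upper and a lower
  transvection. Both the natural module and its Frobenius twist are of this kind.\<close>

locale sl2_rep =
  fixes \<rho> :: "(nat \<Rightarrow> nat) \<Rightarrow> 'k::field^2^2"
  assumes char: "CHAR('k) = 2"
    and rho_mult: "g \<in> carrier G5 \<Longrightarrow> h \<in> carrier G5 \<Longrightarrow> \<rho> (g \<circ> h) = \<rho> g ** \<rho> h"
    and rho_one: "\<rho> id = mat 1"
    and rho_det: "g \<in> carrier G5 \<Longrightarrow> det (\<rho> g) = 1"
    and rho_inj: "g \<in> carrier G5 \<Longrightarrow> \<rho> g = mat 1 \<Longrightarrow> g = id"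
    and upper: "\<exists>g\<in>carrier G5. \<rho> g $ 1 $ 1 = 1 \<and> \<rho> g $ 1 $ 2 = 1 \<and> \<rho> g $ 2 $ 1 = 0 \<and> \<rho> g $ 2 $ 2 = 1"
    and lower: "\<exists>g\<in>carrier G5. \<rho> g $ 1 $ 1 = 1 \<and> \<rho> g $ 1 $ 2 = 0 \<and> \<rho> g $ 2 $ 1 = 1 \<and> \<rho> g $ 2 $ 2 = 1"
begin

lemma two: "x + x = (0::'k)"
  by (rule char2_add_self[OF char])

lemma cancel: "x + (x + y) = (y::'k)"
  by (simp add: two flip: add.assoc)

lemma neg: "- x = (x::'k)"
  using two[of x] by (simp add: minus_unique)

lemma minus: "x - y = x + (y::'k)"
  using neg[of y] by (metis diff_conv_add_uminus)

lemma linear_rep: "linear_rep G5 ((*s) :: 'k \<Rightarrow> 'k^2 \<Rightarrow> 'k^2) UNIV (\<lambda>g v. \<rho> g *v v)"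
proof -
  show ?thesis
    by unfold_locales
      (auto simp: vec.subspace_def matrix_vector_right_distrib vector_scalar_commute alt_group_mult
        rho_mult rho_one alt_group_one matrix_vector_mul_assoc)
qed

lemma matrix_module_eq: "matrix_module G5 \<rho> = linear_module G5 UNIV (*s) (\<lambda>g v. \<rho> g *v v)"
  by (simp add: matrix_module_def)

text \<open>Applying the two transvections to a nonzero vector and subtracting yields multiples of both basis vectors.\<close>

lemma simple: "simple_module kA5 (matrix_module G5 \<rho>)"
proof -
  interpret S: linear_rep G5 "(*s) :: 'k \<Rightarrow> 'k^2 \<Rightarrow> 'k^2" UNIV "\<lambda>g v. \<rho> g *v v" by (rule linear_rep)
  obtain g where g: "g \<in> carrier G5" "\<rho> g $ 1 $ 1 = 1" "\<rho> g $ 1 $ 2 = 1" "\<rho> g $ 2 $ 1 = 0" "\<rho> g $ 2 $ 2 = 1"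
    using upper by blast
  obtain h where h: "h \<in> carrier G5" "\<rho> h $ 1 $ 1 = 1" "\<rho> h $ 1 $ 2 = 0" "\<rho> h $ 2 $ 1 = 1" "\<rho> h $ 2 $ 2 = 1"
    using lower by blast
  have "U = {0} \<or> U = UNIV" if U: "submodule U kA5 S.M" for U
  proof (cases "\<exists>u\<in>U. u \<noteq> 0")
    case True
    then obtain u where u: "u \<in> U" "u \<noteq> 0" by blast
    note inv = S.submodule_invariant[OF U]
    note closed = vec.subspace_add[OF inv(2)] vec.subspace_scale[OF inv(2)]
    have up: "(\<chi> i. if i = 1 then v $ 2 else 0) \<in> U" if v: "v \<in> U" for v
    proof -
      have "\<rho> g *v v + v = (\<chi> i. if i = 1 then v $ 2 else 0)"
        by (simp add: vec2_eq_iff mult_vec_entries g(2-5) two cancel ac_simps)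
      then show ?thesis using closed(1)[OF inv(3)[OF g(1) v] v] by simp
    qed
    have lo: "(\<chi> i. if i = 2 then v $ 1 else 0) \<in> U" if v: "v \<in> U" for v
    proof -
      have "\<rho> h *v v + v = (\<chi> i. if i = 2 then v $ 1 else 0)"
        by (simp add: vec2_eq_iff mult_vec_entries h(2-5) two cancel ac_simps)
      then show ?thesis using closed(1)[OF inv(3)[OF h(1) v] v] by simp
    qed
    have "\<exists>c d. c \<noteq> 0 \<and> d \<noteq> 0 \<and> (\<chi> i. if i = 1 then c else 0) \<in> U \<and> (\<chi> i. if i = 2 then d else 0) \<in> U"
    proof (cases "u $ 2 = 0")
      case False
      then show ?thesis using up[OF u(1)] lo[OF up[OF u(1)]] by (intro exI[of _ "u $ 2"]) (simp cong: if_cong)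
    next
      case True
      then have "u $ 1 \<noteq> 0" using u(2) by (simp add: vec2_eq_iff)
      then show ?thesis using lo[OF u(1)] up[OF lo[OF u(1)]] by (intro exI[of _ "u $ 1"]) (simp cong: if_cong)
    qed
    then obtain c d where cd: "c \<noteq> 0" "d \<noteq> 0" "(\<chi> i. if i = 1 then c else 0) \<in> U" "(\<chi> i. if i = 2 then d else 0) \<in> U"
      by blast
    have "v \<in> U" for v
    proof -
      have "v = (v$1 / c) *s (\<chi> i. if i = 1 then c else 0) + (v$2 / d) *s (\<chi> i. if i = 2 then d else 0)"
        using cd by (simp add: vec2_eq_iff)
      then show ?thesis using closed(1)[OF closed(2)[OF cd(3)] closed(2)[OF cd(4)]] by metis
    qed
    then show ?thesis by auto
  next
    case False
    then show ?thesis using vec.subspace_0[OF S.submodule_invariant(2)[OF U]] by auto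
  qed
  moreover have "(UNIV :: ('k^2) set) \<noteq> {0}"
  proof -
    have "(\<chi> i. (1::'k)) \<noteq> (0 :: 'k^2)" by (simp add: vec2_eq_iff)
    then show ?thesis by (metis UNIV_I singletonD)
  qed
  ultimately show ?thesis
    unfolding simple_module_def matrix_module_eq using S.left_module_M by (simp add: S.M_simps)
qed

text \<open>A matrix of determinant one with eigenvalue one has trace \<open>2 = 0\<close>; by Cayley-Hamilton its square is the
  identity.\<close>

lemma fixed_vector_square:
  assumes g: "g \<in> carrier G5" and w: "\<rho> g *v w = w" "w \<noteq> 0"
  shows "g \<circ> g = id"
proof -
  define a where "a = \<rho> g $ 1 $ 1"
  define b where "b = \<rho> g $ 1 $ 2"
  define c where "c = \<rho> g $ 2 $ 1"
  define d where "d = \<rho> g $ 2 $ 2"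
  note defs = a_def[symmetric] b_def[symmetric] c_def[symmetric] d_def[symmetric]
  have det: "a * d + b * c = 1" using rho_det[OF g] by (simp add: det_2 defs minus)
  have e1: "(a + 1) * w$1 + b * w$2 = 0" and e2: "c * w$1 + (d + 1) * w$2 = 0"
    using w(1) two[of "w$1"] two[of "w$2"] by (simp_all add: vec2_eq_iff mult_vec_entries defs algebra_simps)
  have "((a + 1) * (d + 1) + b * c) * w$1 = (d + 1) * ((a + 1) * w$1 + b * w$2) + b * (c * w$1 + (d + 1) * w$2)"
    using two[of "(d + 1) * b * w$2"] by (simp add: algebra_simps two cancel)
  then have 1: "((a + 1) * (d + 1) + b * c) * w$1 = 0" using e1 e2 by simp
  have "((a + 1) * (d + 1) + b * c) * w$2 = c * ((a + 1) * w$1 + b * w$2) + (a + 1) * (c * w$1 + (d + 1) * w$2)"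
    using two[of "(a + 1) * c * w$1"] by (simp add: algebra_simps two cancel)
  then have 2: "((a + 1) * (d + 1) + b * c) * w$2 = 0" using e1 e2 by simp
  have "(a + 1) * (d + 1) + b * c = 0" using 1 2 w(2) by (auto simp: vec2_eq_iff)
  then have "(a * d + b * c) + 1 + (a + d) = 0" by (simp add: algebra_simps)
  then have "a + d = 0" using det two[of 1] by simp
  then have d: "d = a" using two[of a] by (metis add_left_imp_eq)
  have "\<rho> g ** \<rho> g = mat 1"
    using det two[of "a * b"] two[of "c * a"] by (simp add: mat2_eq_iff mult_mat_entries one_entries defs d algebra_simps)
  then show ?thesis using rho_inj rho_mult G5_comp g by metis
qed

text \<open>The value of the sum is fixed by the whole subgroup. If it were nonzero, every element of the subgroup
  would be an involution or trivial by \<open>fixed_vector_square\<close>.\<close>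

lemma sum_subgroup_zero:
  assumes H: "H \<subseteq> carrier G5" "\<And>u h. u \<in> H \<Longrightarrow> h \<in> H \<Longrightarrow> u \<circ> h \<in> H" "\<And>u. u \<in> H \<Longrightarrow> inv' u \<in> H"
    and u: "u \<in> H" "u \<circ> u \<noteq> id"
  shows "(\<Sum>h\<in>H. \<rho> h *v v) = 0"
proof (rule ccontr)
  assume n: "(\<Sum>h\<in>H. \<rho> h *v v) \<noteq> 0"
  have uG: "u \<in> carrier G5" using u H by blast
  have "\<rho> u *v (\<Sum>h\<in>H. \<rho> h *v v) = (\<Sum>h\<in>H. \<rho> (u \<circ> h) *v v)"
    using H(1) uG by (auto simp: vec.linear_sum[OF matrix_vector_mul_linear_gen] matrix_vector_mul_assoc rho_mult intro!: sum.cong)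
  also have "\<dots> = (\<Sum>h\<in>H. \<rho> h *v v)"
  proof (rule sum.reindex_bij_witness[of _ "\<lambda>h. inv' u \<circ> h" "\<lambda>h. u \<circ> h"])
    note i = G5_inv(3,4)[OF uG]
    show "inv' u \<circ> (u \<circ> a) = a" "u \<circ> (inv' u \<circ> a) = a" for a using i by (simp_all add: o_assoc)
  qed (use H u in auto)
  finally show False using fixed_vector_square[OF uG _ n] u by blast
qed

text \<open>The block idempotent is the sum over the five point stabilizers plus the sum over the group, and
  \<open>sum_subgroup_zero\<close> applies to each of these six subgroups.\<close>

lemma block_idem_smult: "block_idem \<odot>\<^bsub>matrix_module G5 \<rho>\<^esub> v = 0"
proof -
  let ?H = "\<lambda>x. {g \<in> carrier G5. g x = x}"
  have H: "(\<Sum>g\<in>?H x. \<rho> g *v v) = 0" if x: "x \<in> {1..5}" for x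
  proof -
    obtain u where u: "u \<in> carrier G5" "u x = x" "u \<circ> u \<noteq> id"
      using alt_5_stabilizer_not_elementary[OF x] .
    show ?thesis
      by (rule sum_subgroup_zero[of _ u]) (use u G5_comp G5_inv in auto)
  qed
  obtain u where u: "u \<in> carrier G5" "u \<circ> u \<noteq> id"
    using alt_5_stabilizer_not_elementary[of 1] by auto
  have G: "(\<Sum>g\<in>carrier G5. \<rho> g *v v) = 0"
    by (rule sum_subgroup_zero[of _ u]) (use u G5_comp G5_inv in auto)
  have "block_idem \<odot>\<^bsub>matrix_module G5 \<rho>\<^esub> v = (\<Sum>g\<in>carrier G5. (of_nat (fixpts g) + 1) *s (\<rho> g *v v))"
    by (simp add: matrix_module_eq linear_module_def block_idem_def cong: sum.cong)
  also have "\<dots> = (\<Sum>g\<in>carrier G5. (\<Sum>x\<in>{1..5}. if g x = x then \<rho> g *v v else 0) + \<rho> g *v v)"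
    unfolding of_nat_fixpts
    by (intro sum.cong refl) (auto simp: vec.scale_left_distrib vec.scale_sum_left intro!: sum.cong)
  also have "\<dots> = (\<Sum>x\<in>{1..5}. \<Sum>g\<in>?H x. \<rho> g *v v)"
    unfolding sum.distrib G by (subst sum.swap) (simp add: sum.inter_filter[OF finite_alt])
  also have "\<dots> = 0" using H by simp
  finally show ?thesis .
qed

end

section \<open>The action on the affine plane over the field with four elements\<close>

locale sl2_F4 =
  fixes F :: "'k::field set" and w :: 'k and \<phi> :: "(nat \<Rightarrow> nat) \<Rightarrow> 'k^2^2"
  assumes char: "CHAR('k) = 2"
    and F: "F = {0, 1, w, w + 1}" and w: "w * w = w + 1"
    and phi_mult: "g \<in> carrier G5 \<Longrightarrow> h \<in> carrier G5 \<Longrightarrow> \<phi> (g \<circ> h) = \<phi> g ** \<phi> h"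
    and phi_det: "g \<in> carrier G5 \<Longrightarrow> det (\<phi> g) = 1"
    and phi_F: "g \<in> carrier G5 \<Longrightarrow> \<phi> g $ i $ j \<in> F"
    and phi_inj: "inj_on \<phi> (carrier G5)"
    and phi_surj: "(\<And>i j. M $ i $ j \<in> F) \<Longrightarrow> det M = 1 \<Longrightarrow> \<exists>g\<in>carrier G5. \<phi> g = M"
begin

lemma two: "x + x = (0::'k)"
  by (rule char2_add_self[OF char])

lemma cancel: "x + (x + y) = (y::'k)"
  by (simp add: two flip: add.assoc)

lemma neg: "- x = (x::'k)"
  using two[of x] by (simp add: minus_unique)

lemma minus: "x - y = x + (y::'k)"
  using neg[of y] by (metis diff_conv_add_uminus)

lemma F_closed: "x \<in> F \<Longrightarrow> y \<in> F \<Longrightarrow> x + y \<in> F" "x \<in> F \<Longrightarrow> y \<in> F \<Longrightarrow> x * y \<in> F" "0 \<in> F" "1 \<in> F" "w \<in> F"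
  by (auto simp: F algebra_simps two w cancel)

lemma F_power4: "x \<in> F \<Longrightarrow> x * x * (x * x) = x"
  by (auto simp: F algebra_simps two w cancel)

lemma finite_F: "finite F" by (simp add: F)

lemma F_cube: "x \<in> F \<Longrightarrow> x \<noteq> 0 \<Longrightarrow> x * x * x = 1"
  using F_power4[of x] by (auto simp: mult.assoc)

lemma F_inverse: "x \<in> F \<Longrightarrow> x \<noteq> 0 \<Longrightarrow> inverse x \<in> F"
  using F_cube[of x] F_closed(2)[of x x] inverse_unique[of x "x * x"] by (simp add: mult.assoc)

lemma phi_one: "\<phi> id = mat 1"
proof -
  have id: "id \<in> carrier G5" using G5.one_closed by (simp add: alt_group_one)
  obtain g where g: "g \<in> carrier G5" "\<phi> g = mat 1"
  proof -
    have "\<exists>g\<in>carrier G5. \<phi> g = mat 1"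
      by (rule phi_surj) (simp_all add: mat_def F_closed, simp flip: mat_def)
    then show ?thesis using that by blast
  qed
  have "\<phi> id = \<phi> id ** \<phi> g" by (simp add: g(2))
  also have "\<dots> = \<phi> (id \<circ> g)" by (rule phi_mult[OF id g(1), symmetric])
  also have "\<dots> = mat 1" by (simp add: g(2))
  finally show ?thesis .
qed

lemma phi_eq: "g \<in> carrier G5 \<Longrightarrow> h \<in> carrier G5 \<Longrightarrow> \<phi> g = \<phi> h \<longleftrightarrow> g = h"
  using phi_inj by (auto dest: inj_onD)

lemma phi_comp_vec: "g \<in> carrier G5 \<Longrightarrow> h \<in> carrier G5 \<Longrightarrow> \<phi> (g \<circ> h) *v z = \<phi> g *v (\<phi> h *v z)"
  by (simp add: phi_mult matrix_vector_mul_assoc)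

lemma phi_inv_vec: "g \<in> carrier G5 \<Longrightarrow> \<phi> (inv' g) *v (\<phi> g *v z) = z" 
  "g \<in> carrier G5 \<Longrightarrow> \<phi> g *v (\<phi> (inv' g) *v z) = z"
  using phi_comp_vec[of "inv' g" g z] phi_comp_vec[of g "inv' g" z] by (simp_all add: G5_inv(2-4) phi_one)

definition plane :: "('k^2) set" where "plane = {z. z $ 1 \<in> F \<and> z $ 2 \<in> F}"

lemma phi_plane: "g \<in> carrier G5 \<Longrightarrow> z \<in> plane \<Longrightarrow> \<phi> g *v z \<in> plane"
  by (simp add: plane_def mult_vec_entries F_closed phi_F)

text \<open>The map \<open>y \<mapsto> y + [z, y] z\<close> for the determinant form \<open>[z, y]\<close>.\<close>

definition transvection :: "'k^2 \<Rightarrow> 'k^2^2" where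
  "transvection z = (\<chi> i j. (if i = j then 1 else 0) + z $ i * (if j = 1 then z $ 2 else z $ 1))"

lemma transvection_entries:
  "transvection z $ 1 $ 1 = 1 + z$1 * z$2" "transvection z $ 1 $ 2 = z$1 * z$1"
  "transvection z $ 2 $ 1 = z$2 * z$2" "transvection z $ 2 $ 2 = 1 + z$1 * z$2"
  by (simp_all add: transvection_def)

lemma transvection_mult: "transvection z *v y = y + (z$1 * y$2 + z$2 * y$1) *s z"
  by (simp add: vec2_eq_iff mult_vec_entries transvection_entries algebra_simps)

text \<open>The five points correspond to the five lines in the plane. The transvection along \<open>z\<close> comes from
  an involution \<open>s\<close>; take for \<open>x\<close> the point that \<open>s\<close> fixes. For \<open>h\<close> fixing \<open>x\<close>, the transvection along \<open>y = hz\<close>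
  is a conjugate of \<open>s\<close> and commutes with \<open>s\<close>, which is only possible if \<open>y\<close> is on the line of \<open>z\<close>.\<close>

lemma line_stabilizer:
  assumes z: "z \<in> plane" "z \<noteq> 0"
  obtains x where "x \<in> {1..5}"
    "\<And>h. h \<in> carrier G5 \<Longrightarrow> h x = x \<Longrightarrow> \<exists>c\<in>F. c \<noteq> 0 \<and> \<phi> h *v z = c *s z"
proof -
  let ?T = "transvection z"
  have "det ?T = 1"
    by (simp add: det_2 transvection_entries minus algebra_simps two cancel)
  moreover have "?T $ i $ j \<in> F" for i j
    using z(1) F_closed by (cases i rule: exhaust_2[THEN disjE]; cases j rule: exhaust_2[THEN disjE]) (auto simp: plane_def transvection_entries)
  ultimately obtain s where s: "s \<in> carrier G5" "\<phi> s = ?T" using phi_surj by blast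
  have id: "id \<in> carrier G5" using G5.one_closed by (simp add: alt_group_one)
  have "?T ** ?T = mat 1"
    by (simp add: mat2_eq_iff mult_mat_entries one_entries transvection_entries algebra_simps two cancel)
  then have "\<phi> (s \<circ> s) = \<phi> id" using s by (simp add: phi_mult phi_one)
  then have ss: "s \<circ> s = id" using phi_eq s(1) id G5_comp by blast
  have sid: "s \<noteq> id"
  proof
    assume "s = id"
    then have "?T = mat 1" using s phi_one by simp
    then show False using z(2) by (simp add: mat2_eq_iff vec2_eq_iff one_entries transvection_entries)
  qed
  obtain x where x: "x \<in> {1..5}" and
    comm: "\<And>h. h \<in> carrier G5 \<Longrightarrow> h x = x \<Longrightarrow> s \<circ> (h \<circ> s \<circ> inv' h) = (h \<circ> s \<circ> inv' h) \<circ> s"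
    using alt_5_involution_stabilizer[OF s(1) ss sid] by blast
  show thesis
  proof (rule that[OF x])
    fix h assume h: "h \<in> carrier G5" "h x = x"
    define y where "y = \<phi> h *v z"
    define s' where "s' = h \<circ> s \<circ> inv' h"
    have s'G: "s' \<in> carrier G5"
      unfolding s'_def by (intro G5_comp h s G5_inv(2))
    have yF: "y \<in> plane" using phi_plane h z by (simp add: y_def)
    have y0: "y \<noteq> 0"
    proof
      assume "y = 0"
      then have "\<phi> (inv' h) *v y = 0" by simp
      then show False using phi_inv_vec(1)[OF h(1)] z(2) by (simp add: y_def)
    qed
    have Tz: "\<phi> s *v z = z" by (simp add: s(2) transvection_mult vec2_eq_iff mult.commute two)
    have s'y: "\<phi> s' *v y = y"
      unfolding s'_def y_def
      by (simp add: phi_comp_vec G5_comp h(1) s(1) G5_inv(2)[OF h(1)] phi_inv_vec[OF h(1)] Tz)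
    define c where "c = z$1 * y$2 + z$2 * y$1"
    have sy: "\<phi> s *v y = y + c *s z" by (simp add: s(2) transvection_mult c_def)
    have "\<phi> s' *v (\<phi> s *v y) = \<phi> s *v (\<phi> s' *v y)"
      using comm[OF h] by (simp add: phi_comp_vec[OF _ _, symmetric] s(1) s'G flip: s'_def)
    then have "\<phi> s' *v (y + c *s z) = y + c *s z" by (simp add: s'y sy)
    then have cz: "c *s (\<phi> s' *v z) = c *s z"
      by (simp add: matrix_vector_right_distrib vector_scalar_commute s'y)
    have c0: "c = 0"
    proof (rule ccontr)
      assume c: "c \<noteq> 0"
      then have s'z: "\<phi> s' *v z = z" using cz by (simp add: vec2_eq_iff)
      let ?a = "\<phi> s' $ 1 $ 1" and ?b = "\<phi> s' $ 1 $ 2" and ?c = "\<phi> s' $ 2 $ 1" and ?d = "\<phi> s' $ 2 $ 2"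
      have e: "?a * z$1 + ?b * z$2 = z$1" "?c * z$1 + ?d * z$2 = z$2"
        "?a * y$1 + ?b * y$2 = y$1" "?c * y$1 + ?d * y$2 = y$2"
        using s'z s'y by (simp_all add: vec2_eq_iff mult_vec_entries)
      (* z and y are two independent fixed vectors of s', as c is their determinant; Cramer's rule
         determines the matrix *)
      have "?a * c = y$2 * (?a * z$1 + ?b * z$2) + z$2 * (?a * y$1 + ?b * y$2)"
        by (simp add: c_def algebra_simps two cancel)
      also have "\<dots> = c" unfolding e by (simp add: c_def algebra_simps)
      finally have a: "?a = 1" using c by simp
      have "?b * c = y$1 * (?a * z$1 + ?b * z$2) + z$1 * (?a * y$1 + ?b * y$2)"
        by (simp add: c_def algebra_simps two cancel)
      also have "\<dots> = 0" unfolding e by (simp add: mult.commute two)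
      finally have b: "?b = 0" using c by simp
      have "?c * c = y$2 * (?c * z$1 + ?d * z$2) + z$2 * (?c * y$1 + ?d * y$2)"
        by (simp add: c_def algebra_simps two cancel)
      also have "\<dots> = 0" unfolding e by (simp add: mult.commute two)
      finally have c': "?c = 0" using c by simp
      have "?d * c = y$1 * (?c * z$1 + ?d * z$2) + z$1 * (?c * y$1 + ?d * y$2)"
        by (simp add: c_def algebra_simps two cancel)
      also have "\<dots> = c" unfolding e by (simp add: c_def algebra_simps)
      finally have d: "?d = 1" using c by simp
      have "\<phi> s' = \<phi> id" by (simp add: phi_one mat2_eq_iff one_entries a b c' d)
      then have "s' = id" using phi_eq s'G id by blast
      then have "\<phi> h *v (\<phi> s *v v) = \<phi> h *v v" for v
      proof -
        have "s' \<circ> h = h \<circ> s" using G5_inv(3)[OF h(1)] by (simp add: s'_def comp_assoc)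
        then have "h = h \<circ> s" using \<open>s' = id\<close> by simp
        then show ?thesis using phi_comp_vec[OF h(1) s(1)] by metis
      qed
      then have "\<phi> s *v v = v" for v using phi_inv_vec(1)[OF h(1)] by metis
      then have "c *s z = 0" using sy by (metis add_cancel_right_right)
      then show False using c z(2) by simp
    qed
    have "\<exists>c. y = c *s z"
    proof (cases "z$1 = 0")
      case True
      then have "y = (y$2 / z$2) *s z" using c0 z(2) by (auto simp: vec2_eq_iff c_def)
      then show ?thesis by blast
    next
      case False
      have "z$1 * y$2 = z$2 * y$1" using c0 two by (metis c_def add_eq_0_iff neg)
      then have "y = (y$1 / z$1) *s z" using False by (simp add: vec2_eq_iff field_simps)
      then show ?thesis by blast
    qed
    then obtain d where d: "y = d *s z" by blast
    have "d \<noteq> 0" using d y0 by auto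
    moreover have "d \<in> F"
    proof (cases "z$1 = 0")
      case True
      then have "d = y$2 * inverse (z$2)" using d z(2) by (simp add: vec2_eq_iff field_simps)
      then show ?thesis using F_closed(2)[OF _ F_inverse, of "y$2" "z$2"] yF z True by (simp add: plane_def vec2_eq_iff)
    next
      case False
      then have "d = y$1 * inverse (z$1)" using d by (simp add: field_simps)
      then show ?thesis using F_closed(2)[OF _ F_inverse, of "y$1" "z$1"] yF z False by (simp add: plane_def)
    qed
    moreover have "\<phi> h *v z = d *s z" using d by (simp add: y_def)
    ultimately show "\<exists>c\<in>F. c \<noteq> 0 \<and> \<phi> h *v z = c *s z" by (intro bexI[of _ d] conjI)
  qed
qed

end

section \<open>Idempotents annihilating all simple modules\<close>

text \<open>The hypotheses on \<open>f\<close> say that it acts as zero on the trivial module, on \<open>k\<^sup>5\<close>, on the natural module and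
  on its Frobenius twist.\<close>

locale killed_idempotent = sl2_F4 F w \<phi>
  for F :: "'k::field set" and w :: 'k and \<phi> :: "(nat \<Rightarrow> nat) \<Rightarrow> 'k^2^2" +
  fixes f :: "(nat \<Rightarrow> nat) \<Rightarrow> 'k"
  assumes f_closed: "f \<in> carrier kA5" and f_idem: "f \<star> f = f"
    and f_aug: "(\<Sum>g\<in>carrier G5. f g) = 0"
    and f_pts: "x \<in> {1..5} \<Longrightarrow> y \<in> {1..5} \<Longrightarrow> point_sum f x y = 0"
    and f_phi: "(\<Sum>g\<in>carrier G5. f g * \<phi> g $ i $ j) = 0"
    and f_phi2: "(\<Sum>g\<in>carrier G5. f g * (\<phi> g $ i $ j * \<phi> g $ i $ j)) = 0"
begin

text \<open>The group acts on functions by \<open>q \<mapsto> q \<circ> g\<close>. This is a right action, which is harmless since only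
  \<open>ff = f\<close> is used.\<close>

definition Op :: "('k^2 \<Rightarrow> 'k) \<Rightarrow> 'k^2 \<Rightarrow> 'k" where
  "Op q z = (\<Sum>g\<in>carrier G5. f g * q (\<phi> g *v z))"

definition killed :: "('k^2 \<Rightarrow> 'k) \<Rightarrow> bool" where
  "killed q \<longleftrightarrow> (\<forall>z\<in>plane. Op q z = 0)"

lemma Op_Op: "Op (Op q) z = Op q z"
proof -
  have "Op (Op q) z = (\<Sum>g\<in>carrier G5. \<Sum>h\<in>carrier G5. f h * f g * q (\<phi> (h \<circ> g) *v z))"
    unfolding Op_def sum_distrib_left
    by (intro sum.cong refl) (simp add: phi_comp_vec)
  also have "\<dots> = (\<Sum>h\<in>carrier G5. \<Sum>g\<in>carrier G5. f h * f g * q (\<phi> (h \<otimes>\<^bsub>G5\<^esub> g) *v z))"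
    unfolding alt_group_mult by (rule sum.swap)
  also have "\<dots> = (\<Sum>u\<in>carrier G5. (f \<star> f) u * q (\<phi> u *v z))"
    by (rule G5.KG_sum_mult[OF G5.vector_space_mult, symmetric])
  also have "\<dots> = Op q z" by (simp add: f_idem Op_def)
  finally show ?thesis .
qed

lemma killed_cong: "killed q \<Longrightarrow> (\<And>z. z \<in> plane \<Longrightarrow> q z = r z) \<Longrightarrow> killed r"
  by (simp add: killed_def Op_def phi_plane cong: sum.cong)

lemma killed_add: "killed q \<Longrightarrow> killed r \<Longrightarrow> killed (\<lambda>z. q z + r z)"
  by (simp add: killed_def Op_def algebra_simps sum.distrib)

lemma killed_scale: "killed q \<Longrightarrow> killed (\<lambda>z. c * q z)"
proof -
  have "Op (\<lambda>z. c * q z) z = c * Op q z" for z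
    by (simp add: Op_def sum_distrib_left ac_simps)
  then show "killed q \<Longrightarrow> killed (\<lambda>z. c * q z)" by (simp add: killed_def)
qed

lemma killed_sum: "(\<And>i. i \<in> I \<Longrightarrow> killed (q i)) \<Longrightarrow> killed (\<lambda>z. \<Sum>i\<in>I. q i z)"
  by (induction I rule: infinite_finite_induct) (simp_all add: killed_add, simp_all add: killed_def Op_def)

text \<open>The idempotent trick that handles extensions: \<open>Op q = Op (Op q)\<close> vanishes once \<open>Op q\<close> agrees with a
  function annihilated by \<open>f\<close>.\<close>

lemma killed_step:
  assumes "killed r" "\<And>z. z \<in> plane \<Longrightarrow> Op q z = r z"
  shows "killed q"
  unfolding killed_def
proof
  fix z assume z: "z \<in> plane"
  have "Op q z = Op (Op q) z" by (simp add: Op_Op)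
  also have "\<dots> = Op r z"
    unfolding Op_def[of "Op q"] Op_def[of r] by (intro sum.cong refl) (simp add: assms(2) phi_plane z)
  also have "\<dots> = 0" using assms(1) z by (simp add: killed_def)
  finally show "Op q z = 0" .
qed

text \<open>In these coordinates the degree filtration is visible: \<open>\<xi>\<eta>\<close> is invariant modulo \<open>\<xi>\<^sup>2\<close>, \<open>\<eta>\<^sup>2\<close>;
  its square is invariant modulo \<open>\<xi>\<^sup>4 = \<xi>\<close> and \<open>\<eta>\<^sup>4 = \<eta>\<close>; and \<open>\<xi>\<eta>\<^sup>3\<close> transforms with \<open>\<xi>\<^sup>3\<eta>\<close> by the squares
  of the matrix entries modulo lower terms. The coordinates are left abstract so that the statement also
  applies to \<open>x\<^sup>2\<close>, \<open>y\<^sup>2\<close> and with the coordinates exchanged.\<close>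

lemma killed_products:
  assumes xi: "\<And>g z. g \<in> carrier G5 \<Longrightarrow> \<xi> (\<phi> g *v z) = A g * \<xi> z + B g * \<eta> z"
    and eta: "\<And>g z. g \<in> carrier G5 \<Longrightarrow> \<eta> (\<phi> g *v z) = C g * \<xi> z + D g * \<eta> z"
    and det: "\<And>g. g \<in> carrier G5 \<Longrightarrow> A g * D g + B g * C g = 1"
    and X4: "\<And>z. z \<in> plane \<Longrightarrow> \<xi> z * \<xi> z * (\<xi> z * \<xi> z) = \<xi> z"
    and Y4: "\<And>z. z \<in> plane \<Longrightarrow> \<eta> z * \<eta> z * (\<eta> z * \<eta> z) = \<eta> z"
    and E1: "\<forall>e\<in>{A,B,C,D}. (\<Sum>g\<in>carrier G5. f g * e g) = 0"
    and E2: "\<forall>e\<in>{A,B,C,D}. (\<Sum>g\<in>carrier G5. f g * (e g * e g)) = 0"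
  shows "killed \<xi>" "killed \<eta>" "killed (\<lambda>z. \<xi> z * \<xi> z)" "killed (\<lambda>z. \<eta> z * \<eta> z)"
    "killed (\<lambda>z. \<xi> z * \<eta> z)" "killed (\<lambda>z. \<xi> z * \<xi> z * (\<eta> z * \<eta> z))"
    "killed (\<lambda>z. \<xi> z * (\<eta> z * \<eta> z * \<eta> z))"
proof -
  have lin: "(\<Sum>g\<in>carrier G5. f g * (p g * x + q g * y)) = (\<Sum>g\<in>carrier G5. f g * p g) * x + (\<Sum>g\<in>carrier G5. f g * q g) * y"
    for p q :: "(nat \<Rightarrow> nat) \<Rightarrow> 'k" and x y
    by (simp add: algebra_simps sum.distrib sum_distrib_left)
  have sq: "(x + y) * (x + y) = x * x + y * y" for x y :: 'k
    by (simp add: algebra_simps two cancel)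
  have X2: "\<xi> (\<phi> g *v z) * \<xi> (\<phi> g *v z) = A g * A g * (\<xi> z * \<xi> z) + B g * B g * (\<eta> z * \<eta> z)" if "g \<in> carrier G5" for g z
    unfolding xi[OF that] sq by (simp add: ac_simps)
  have Y2: "\<eta> (\<phi> g *v z) * \<eta> (\<phi> g *v z) = C g * C g * (\<xi> z * \<xi> z) + D g * D g * (\<eta> z * \<eta> z)" if "g \<in> carrier G5" for g z
    unfolding eta[OF that] sq by (simp add: ac_simps)
  show kX: "killed \<xi>" using E1 by (simp add: killed_def Op_def xi lin cong: sum.cong)
  show kY: "killed \<eta>" using E1 by (simp add: killed_def Op_def eta lin cong: sum.cong)
  show kX2: "killed (\<lambda>z. \<xi> z * \<xi> z)" using E2 by (simp add: killed_def Op_def X2 lin cong: sum.cong)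
  show kY2: "killed (\<lambda>z. \<eta> z * \<eta> z)" using E2 by (simp add: killed_def Op_def Y2 lin cong: sum.cong)
  have XY: "\<xi> (\<phi> g *v z) * \<eta> (\<phi> g *v z) = (A g * C g) * (\<xi> z * \<xi> z) + (B g * D g) * (\<eta> z * \<eta> z) + \<xi> z * \<eta> z"
    if g: "g \<in> carrier G5" for g z
  proof -
    have "\<xi> (\<phi> g *v z) * \<eta> (\<phi> g *v z) = (A g * C g) * (\<xi> z * \<xi> z) + (B g * D g) * (\<eta> z * \<eta> z) + (A g * D g + B g * C g) * (\<xi> z * \<eta> z)"
      unfolding xi[OF g] eta[OF g] by (simp add: algebra_simps)
    then show ?thesis by (simp add: det[OF g])
  qed
  have "Op (\<lambda>z. \<xi> z * \<eta> z) z = (\<Sum>g\<in>carrier G5. f g * (A g * C g)) * (\<xi> z * \<xi> z) + (\<Sum>g\<in>carrier G5. f g * (B g * D g)) * (\<eta> z * \<eta> z)" for z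
  proof -
    have "Op (\<lambda>z. \<xi> z * \<eta> z) z = (\<Sum>g\<in>carrier G5. f g * ((A g * C g) * (\<xi> z * \<xi> z) + (B g * D g) * (\<eta> z * \<eta> z)) + f g * (\<xi> z * \<eta> z))"
      unfolding Op_def by (intro sum.cong refl) (simp only: XY distrib_left)
    then show ?thesis by (simp add: sum.distrib lin f_aug flip: sum_distrib_right)
  qed
  then show kXY: "killed (\<lambda>z. \<xi> z * \<eta> z)"
    by (intro killed_step[OF killed_add[OF killed_scale[OF kX2] killed_scale[OF kY2]]]) blast
  have "Op (\<lambda>z. \<xi> z * \<xi> z * (\<eta> z * \<eta> z)) z = (\<Sum>g\<in>carrier G5. f g * ((A g * C g) * (A g * C g))) * \<xi> z + (\<Sum>g\<in>carrier G5. f g * ((B g * D g) * (B g * D g))) * \<eta> z"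
    if z: "z \<in> plane" for z
  proof -
    have "Op (\<lambda>z. \<xi> z * \<xi> z * (\<eta> z * \<eta> z)) z = (\<Sum>g\<in>carrier G5. f g * ((A g * C g) * (A g * C g) * \<xi> z + (B g * D g) * (B g * D g) * \<eta> z) + f g * (\<xi> z * \<xi> z * (\<eta> z * \<eta> z)))"
      unfolding Op_def
    proof (intro sum.cong refl)
      fix g assume g: "g \<in> carrier G5"
      have "\<xi> (\<phi> g *v z) * \<xi> (\<phi> g *v z) * (\<eta> (\<phi> g *v z) * \<eta> (\<phi> g *v z)) =
         (\<xi> (\<phi> g *v z) * \<eta> (\<phi> g *v z)) * (\<xi> (\<phi> g *v z) * \<eta> (\<phi> g *v z))" by (simp add: ac_simps)
      also have "\<dots> = (A g * C g) * (A g * C g) * (\<xi> z * \<xi> z * (\<xi> z * \<xi> z)) + (B g * D g) * (B g * D g) * (\<eta> z * \<eta> z * (\<eta> z * \<eta> z)) + \<xi> z * \<xi> z * (\<eta> z * \<eta> z)"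
        unfolding XY[OF g] sq by (simp add: ac_simps)
      finally show "f g * (\<xi> (\<phi> g *v z) * \<xi> (\<phi> g *v z) * (\<eta> (\<phi> g *v z) * \<eta> (\<phi> g *v z))) =
         f g * ((A g * C g) * (A g * C g) * \<xi> z + (B g * D g) * (B g * D g) * \<eta> z) + f g * (\<xi> z * \<xi> z * (\<eta> z * \<eta> z))"
        by (simp only: X4[OF z] Y4[OF z] distrib_left)
    qed
    then show ?thesis by (simp add: sum.distrib lin f_aug flip: sum_distrib_right)
  qed
  then show kX2Y2: "killed (\<lambda>z. \<xi> z * \<xi> z * (\<eta> z * \<eta> z))"
    by (rule killed_step[OF killed_add[OF killed_scale[OF kX] killed_scale[OF kY]]])
  have "Op (\<lambda>z. \<xi> z * (\<eta> z * \<eta> z * \<eta> z)) z =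
      (\<Sum>g\<in>carrier G5. f g * (A g * C g * (C g * C g))) * \<xi> z
      + ((\<Sum>g\<in>carrier G5. f g * (A g * C g * (D g * D g) + B g * D g * (C g * C g))) * (\<xi> z * \<xi> z * (\<eta> z * \<eta> z))
      + (\<Sum>g\<in>carrier G5. f g * (B g * D g * (D g * D g))) * \<eta> z)"
    if z: "z \<in> plane" for z
  proof -
    have "Op (\<lambda>z. \<xi> z * (\<eta> z * \<eta> z * \<eta> z)) z = (\<Sum>g\<in>carrier G5.
      f g * (A g * C g * (C g * C g)) * \<xi> z
      + f g * (A g * C g * (D g * D g) + B g * D g * (C g * C g)) * (\<xi> z * \<xi> z * (\<eta> z * \<eta> z))
      + f g * (B g * D g * (D g * D g)) * \<eta> z
      + f g * (C g * C g) * (\<xi> z * \<xi> z * (\<xi> z * \<eta> z)) + f g * (D g * D g) * (\<xi> z * \<eta> z * (\<eta> z * \<eta> z)))"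
      unfolding Op_def
    proof (intro sum.cong refl)
      fix g assume g: "g \<in> carrier G5"
      have "\<xi> (\<phi> g *v z) * (\<eta> (\<phi> g *v z) * \<eta> (\<phi> g *v z) * \<eta> (\<phi> g *v z)) =
         (\<xi> (\<phi> g *v z) * \<eta> (\<phi> g *v z)) * (\<eta> (\<phi> g *v z) * \<eta> (\<phi> g *v z))" by (simp add: ac_simps)
      also have "\<dots> = (A g * C g * (C g * C g)) * (\<xi> z * \<xi> z * (\<xi> z * \<xi> z))
        + (A g * C g * (D g * D g) + B g * D g * (C g * C g)) * (\<xi> z * \<xi> z * (\<eta> z * \<eta> z))
        + (B g * D g * (D g * D g)) * (\<eta> z * \<eta> z * (\<eta> z * \<eta> z))
        + (C g * C g) * (\<xi> z * \<xi> z * (\<xi> z * \<eta> z)) + (D g * D g) * (\<xi> z * \<eta> z * (\<eta> z * \<eta> z))"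
        unfolding XY[OF g] Y2[OF g] by (simp add: algebra_simps)
      finally have e: "\<xi> (\<phi> g *v z) * (\<eta> (\<phi> g *v z) * \<eta> (\<phi> g *v z) * \<eta> (\<phi> g *v z)) = (A g * C g * (C g * C g)) * \<xi> z
        + (A g * C g * (D g * D g) + B g * D g * (C g * C g)) * (\<xi> z * \<xi> z * (\<eta> z * \<eta> z))
        + (B g * D g * (D g * D g)) * \<eta> z
        + (C g * C g) * (\<xi> z * \<xi> z * (\<xi> z * \<eta> z)) + (D g * D g) * (\<xi> z * \<eta> z * (\<eta> z * \<eta> z))"
        unfolding X4[OF z] Y4[OF z] .
      show "f g * (\<xi> (\<phi> g *v z) * (\<eta> (\<phi> g *v z) * \<eta> (\<phi> g *v z) * \<eta> (\<phi> g *v z))) =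
        f g * (A g * C g * (C g * C g)) * \<xi> z
      + f g * (A g * C g * (D g * D g) + B g * D g * (C g * C g)) * (\<xi> z * \<xi> z * (\<eta> z * \<eta> z))
      + f g * (B g * D g * (D g * D g)) * \<eta> z
      + f g * (C g * C g) * (\<xi> z * \<xi> z * (\<xi> z * \<eta> z)) + f g * (D g * D g) * (\<xi> z * \<eta> z * (\<eta> z * \<eta> z))"
        unfolding e by (simp add: algebra_simps)
    qed
    also have "\<dots> = (\<Sum>g\<in>carrier G5. f g * (A g * C g * (C g * C g))) * \<xi> z
      + (\<Sum>g\<in>carrier G5. f g * (A g * C g * (D g * D g) + B g * D g * (C g * C g))) * (\<xi> z * \<xi> z * (\<eta> z * \<eta> z))
      + (\<Sum>g\<in>carrier G5. f g * (B g * D g * (D g * D g))) * \<eta> z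
      + (\<Sum>g\<in>carrier G5. f g * (C g * C g)) * (\<xi> z * \<xi> z * (\<xi> z * \<eta> z))
      + (\<Sum>g\<in>carrier G5. f g * (D g * D g)) * (\<xi> z * \<eta> z * (\<eta> z * \<eta> z))"
      by (simp only: sum.distrib sum_distrib_right)
    finally show ?thesis using E2 by (simp add: add.assoc)
  qed
  then show "killed (\<lambda>z. \<xi> z * (\<eta> z * \<eta> z * \<eta> z))"
    by (rule killed_step[OF killed_add[OF killed_scale[OF kX] killed_add[OF killed_scale[OF kX2Y2] killed_scale[OF kY]]]])
qed

text \<open>A function on the lines: along the orbit of \<open>z\<close> its value depends only on the image of the point
  attached to the line of \<open>z\<close>, so the action of \<open>f\<close> is read off from that on \<open>k\<^sup>5\<close>.\<close>

lemma killed_invariant: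
  assumes inv: "\<And>c z. c \<in> F \<Longrightarrow> c \<noteq> 0 \<Longrightarrow> z \<in> plane \<Longrightarrow> q (c *s z) = q z"
  shows "killed q"
  unfolding killed_def
proof
  fix z assume z: "z \<in> plane"
  show "Op q z = 0"
  proof (cases "z = 0")
    case True
    then show ?thesis by (simp add: Op_def f_aug flip: sum_distrib_right)
  next
    case False
    obtain x where x: "x \<in> {1..5}" and
      stab: "\<And>h. h \<in> carrier G5 \<Longrightarrow> h x = x \<Longrightarrow> \<exists>c\<in>F. c \<noteq> 0 \<and> \<phi> h *v z = c *s z"
      by (rule line_stabilizer[OF z False]) (rule that; assumption)
    have "\<exists>g\<in>carrier G5. g x = y" if "y \<in> {1..5}" for y
      using alt_5_transitive[OF x that] by blast
    then obtain k where k: "\<And>y. y \<in> {1..5} \<Longrightarrow> k y \<in> carrier G5" "\<And>y. y \<in> {1..5} \<Longrightarrow> k y x = y"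
      by metis
    have q: "q (\<phi> g *v z) = q (\<phi> (k (g x)) *v z)" if g: "g \<in> carrier G5" for g
    proof -
      have gx: "g x \<in> {1..5}" using G5_inv(6)[OF g] x by blast
      define h where "h = inv' (k (g x)) \<circ> g"
      note K = G5_inv[OF k(1)[OF gx]]
      have h: "h \<in> carrier G5" unfolding h_def by (rule G5_comp[OF K(2) g])
      have "h x = x" unfolding h_def using K(5)[of "g x" x] k(2)[OF gx] by simp
      then obtain c where c: "c \<in> F" "c \<noteq> 0" "\<phi> h *v z = c *s z" using stab h by blast
      have "g = k (g x) \<circ> h" unfolding h_def using K(4) by (simp add: o_assoc)
      then have "\<phi> g *v z = \<phi> (k (g x)) *v (\<phi> h *v z)" using phi_comp_vec[OF k(1)[OF gx] h] by metis
      also have "\<dots> = c *s (\<phi> (k (g x)) *v z)" by (simp add: c(3) vector_scalar_commute)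
      finally show ?thesis using inv[OF c(1,2) phi_plane[OF k(1)[OF gx] z]] by simp
    qed
    have "Op q z = (\<Sum>g\<in>carrier G5. \<Sum>y\<in>{1..5}. if g x = y then f g * q (\<phi> (k y) *v z) else 0)"
      unfolding Op_def
    proof (intro sum.cong refl)
      fix g assume g: "g \<in> carrier G5"
      have "g x \<in> {1..5}" using G5_inv(6)[OF g] x by blast
      then show "f g * q (\<phi> g *v z) = (\<Sum>y\<in>{1..5}. if g x = y then f g * q (\<phi> (k y) *v z) else 0)"
        using q[OF g] by simp
    qed
    also have "\<dots> = (\<Sum>y\<in>{1..5}. \<Sum>g\<in>carrier G5. if g x = y then f g * q (\<phi> (k y) *v z) else 0)"
      by (rule sum.swap)
    also have "\<dots> = (\<Sum>y\<in>{1..5}. point_sum f x y * q (\<phi> (k y) *v z))"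
      unfolding point_sum_def sum_distrib_right by (intro sum.cong refl) auto
    also have "\<dots> = 0" using f_pts[OF x] by simp
    finally show ?thesis .
  qed
qed

text \<open>Monomials of degree divisible by 3 are constant on lines. The others are linear, a Frobenius twist of
  linear ones, or covered by \<open>killed_products\<close>.\<close>

lemma killed_monomial:
  assumes "i \<le> 3" "j \<le> 3"
  shows "killed (\<lambda>z. (z$1)^i * (z$2)^j)"
proof -
  let ?a = "\<lambda>g. \<phi> g $ 1 $ 1" and ?b = "\<lambda>g. \<phi> g $ 1 $ 2" and ?c = "\<lambda>g. \<phi> g $ 2 $ 1" and ?d = "\<lambda>g. \<phi> g $ 2 $ 2"
  have det: "?a g * ?d g + ?b g * ?c g = 1" if "g \<in> carrier G5" for g
    using phi_det[OF that] by (simp add: det_2 minus)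
  have sq: "(x + y) * (x + y) = x * x + y * y" for x y :: 'k
    by (simp add: algebra_simps two cancel)
  have p4: "x * x * (x * x) = x" if "x \<in> F" for x using F_power4[OF that] .
  have f4: "(\<Sum>g\<in>carrier G5. f g * (\<phi> g $ i $ j * \<phi> g $ i $ j * (\<phi> g $ i $ j * \<phi> g $ i $ j))) = 0" for i j
    using f_phi[of i j] by (simp add: p4 phi_F cong: sum.cong)
  have k1: "killed (\<lambda>z. z$1)" "killed (\<lambda>z. z$2)" "killed (\<lambda>z. z$1 * z$1)" "killed (\<lambda>z. z$2 * z$2)"
    "killed (\<lambda>z. z$1 * z$2)" "killed (\<lambda>z. z$1 * z$1 * (z$2 * z$2))"
    "killed (\<lambda>z. z$1 * (z$2 * z$2 * z$2))"
    using killed_products[of "\<lambda>z. z$1" ?a ?b "\<lambda>z. z$2" ?c ?d] det f_phi f_phi2 p4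
    by (simp_all add: mult_vec_entries plane_def)
  have k2: "killed (\<lambda>z. z$2 * (z$1 * z$1 * z$1))"
    using killed_products(7)[of "\<lambda>z. z$2" ?d ?c "\<lambda>z. z$1" ?b ?a] det f_phi f_phi2 p4
    by (simp add: mult_vec_entries plane_def ac_simps)
  have det2: "(?a g * ?a g) * (?d g * ?d g) + (?b g * ?b g) * (?c g * ?c g) = 1" if "g \<in> carrier G5" for g
  proof -
    have "(?a g * ?a g) * (?d g * ?d g) + (?b g * ?b g) * (?c g * ?c g) = (?a g * ?d g + ?b g * ?c g) * (?a g * ?d g + ?b g * ?c g)"
      unfolding sq by (simp add: ac_simps)
    then show ?thesis by (simp add: det[OF that])
  qed
  have sqv: "(\<phi> g *v z) $ 1 * (\<phi> g *v z) $ 1 = ?a g * ?a g * (z$1 * z$1) + ?b g * ?b g * (z$2 * z$2)"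
    "(\<phi> g *v z) $ 2 * (\<phi> g *v z) $ 2 = ?c g * ?c g * (z$1 * z$1) + ?d g * ?d g * (z$2 * z$2)" for g z
    unfolding mult_vec_entries sq by (simp_all add: ac_simps)
  have p8: "x * x * (x * x) * (x * x * (x * x)) = x * x" if "x \<in> F" for x by (simp only: p4[OF that])
  have p6: "x * x * (x * x) * (x * x) = x * x * x" if "x \<in> F" for x
    by (simp only: p4[OF that]) (simp add: mult.assoc)
  have k3: "killed (\<lambda>z. (z$1 * z$1) * (z$2 * z$2 * (z$2 * z$2) * (z$2 * z$2)))"
    using killed_products(7)[of "\<lambda>z. z$1 * z$1" "\<lambda>g. ?a g * ?a g" "\<lambda>g. ?b g * ?b g" "\<lambda>z. z$2 * z$2" "\<lambda>g. ?c g * ?c g" "\<lambda>g. ?d g * ?d g"]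
      det2 f_phi2 f4 p8 sqv by (simp add: plane_def)
  have k4: "killed (\<lambda>z. (z$2 * z$2) * (z$1 * z$1 * (z$1 * z$1) * (z$1 * z$1)))"
    using killed_products(7)[of "\<lambda>z. z$2 * z$2" "\<lambda>g. ?d g * ?d g" "\<lambda>g. ?c g * ?c g" "\<lambda>z. z$1 * z$1" "\<lambda>g. ?b g * ?b g" "\<lambda>g. ?a g * ?a g"]
      det2 f_phi2 f4 p8 sqv by (simp add: plane_def ac_simps)
  have k3': "killed (\<lambda>z. (z$1 * z$1) * (z$2 * z$2 * z$2))"
    by (rule killed_cong[OF k3]) (simp add: plane_def p6)
  have k4': "killed (\<lambda>z. (z$2 * z$2) * (z$1 * z$1 * z$1))"
    by (rule killed_cong[OF k4]) (simp add: plane_def p6)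
  have c3: "c * (c * c) = 1" if "c \<in> F" "c \<noteq> 0" for c using F_cube[OF that] by (simp add: mult.assoc)
  have c3': "c * (c * (c * x)) = x" if "c \<in> F" "c \<noteq> 0" for c x
    using F_cube[OF that] by (simp flip: mult.assoc)
  have k5: "killed (\<lambda>z. 1)" "killed (\<lambda>z. z$1 * (z$2 * z$2))" "killed (\<lambda>z. z$1 * z$1 * z$2)"
    "killed (\<lambda>z. z$1 * z$1 * z$1)" "killed (\<lambda>z. z$2 * z$2 * z$2)" 
    "killed (\<lambda>z. z$1 * z$1 * z$1 * (z$2 * z$2 * z$2))"
    by (rule killed_invariant; simp add: ac_simps c3 c3')+
  have "i \<in> {0,1,2,3}" "j \<in> {0,1,2,3}" using assms by auto
  then show ?thesis
    using k1 k2 k3' k4' k5 by (auto simp: power2_eq_square power3_eq_cube ac_simps)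
qed

text \<open>Every function on the finite plane is a polynomial: \<open>1 + (x + p)\<^sup>3\<close> is the indicator of \<open>x = p\<close>.\<close>

lemma all_killed: "killed q"
proof -
  (* nonzero elements of F have cube 1, and 1 + 1 = 0 *)
  define d where "d p x = 1 + (x + p) * (x + p) * (x + p)" for p x :: 'k
  have d: "d p x = (if x = p then 1 else 0)" if "x \<in> F" "p \<in> F" for p x
  proof (cases "x = p")
    case False
    have "x + p \<noteq> 0"
    proof
      assume "x + p = 0"
      then have "p + (p + x) = p" by (simp add: add.commute)
      then show False using cancel[of p x] False by simp
    qed
    then show ?thesis using F_cube[OF F_closed(1)[OF that]] two[of 1] False by (simp add: d_def)
  qed (simp add: d_def two)
  define co where "co p i = (if i = 0 then 1 + p * p * p else if i = 1 then p * p else if i = 2 then p else (1::'k))" for p and i :: nat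
  have dsum: "d p x = (\<Sum>i\<le>3. co p i * x ^ i)" for p x
    by (simp add: d_def co_def eval_nat_numeral algebra_simps two cancel)
  have kd: "killed (\<lambda>z. d p (z$1) * d r (z$2))" for p r
  proof -
    have "killed (\<lambda>z. \<Sum>i\<in>{..3}. \<Sum>j\<in>{..3}. (co p i * co r j) * ((z$1)^i * (z$2)^j))"
      by (intro killed_sum killed_scale killed_monomial) auto
    then show ?thesis unfolding dsum sum_product by (simp add: ac_simps)
  qed
  have "killed (\<lambda>z. \<Sum>p\<in>F. \<Sum>r\<in>F. q (\<chi> i. if i = 1 then p else r) * (d p (z$1) * d r (z$2)))"
    by (intro killed_sum killed_scale kd)
  then show ?thesis
  proof (rule killed_cong)
    fix z assume z: "z \<in> plane"
    have z': "z$1 \<in> F" "z$2 \<in> F" using z by (auto simp: plane_def)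
    have "(\<Sum>p\<in>F. \<Sum>r\<in>F. q (\<chi> i. if i = 1 then p else r) * (d p (z$1) * d r (z$2))) =
      (\<Sum>p\<in>F. \<Sum>r\<in>F. if r = z$2 then (if p = z$1 then q (\<chi> i. if i = 1 then p else r) else 0) else 0)"
      using z' by (intro sum.cong refl) (auto simp: d)
    also have "\<dots> = q (\<chi> i. if i = 1 then z$1 else z$2)"
      using z' finite_F by simp
    also have "(\<chi> i. if i = 1 then z$1 else z$2) = z" by (simp add: vec2_eq_iff)
    finally show "(\<Sum>p\<in>F. \<Sum>r\<in>F. q (\<chi> i. if i = 1 then p else r) * (d p (z$1) * d r (z$2))) = q z" .
  qed
qed

end

context killed_idempotent
begin

interpretation R: ring "kA5 :: ((nat \<Rightarrow> nat) \<Rightarrow> 'k) ring" by (rule G5.KG_ring)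

lemma shift_apply:
  "s \<in> carrier G5 \<Longrightarrow> y \<in> carrier kA5 \<Longrightarrow> u \<in> carrier G5 \<Longrightarrow>
   (G5.basis s \<star> y) u = (y (inv' s \<circ> u) :: 'k)"
  by (simp add: G5.basis_mult_left alt_group_mult G5_inv(1))

lemma basis_comp:
  "s \<in> carrier G5 \<Longrightarrow> t \<in> carrier G5 \<Longrightarrow> y \<in> carrier kA5 \<Longrightarrow>
   G5.basis s \<star> (G5.basis t \<star> y) = G5.basis (s \<circ> t) \<star> (y :: _ \<Rightarrow> 'k)"
  by (simp add: R.m_assoc[symmetric] G5.basis_closed G5.basis_mult alt_group_mult)

lemma basis_id: "y \<in> carrier kA5 \<Longrightarrow> G5.basis id \<star> (y :: _ \<Rightarrow> 'k) = y"
proof -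
  assume y: "y \<in> carrier kA5"
  have "(G5.basis id :: _ \<Rightarrow> 'k) = \<one>\<^bsub>kA5\<^esub>" by (rule G5.basis_one[unfolded alt_group_one])
  then show ?thesis using y by simp
qed

text \<open>In characteristic 2 an involution \<open>s\<close> fixes \<open>y + sy\<close>, and \<open>y\<close> itself if that sum is zero. The last
  property lets the step be repeated for commuting involutions.\<close>

lemma fixed_step:
  fixes y :: "(nat \<Rightarrow> nat) \<Rightarrow> 'k"
  assumes s: "s \<in> carrier G5" "s \<circ> s = id"
    and y: "y \<in> carrier kA5" "y \<star> f = y" "y \<noteq> 0"
  obtains y' where "y' \<in> carrier kA5" "y' \<star> f = y'" "y' \<noteq> 0" "G5.basis s \<star> y' = y'"
    "\<And>t. t \<in> carrier G5 \<Longrightarrow> t \<circ> s = s \<circ> t \<Longrightarrow> G5.basis t \<star> y = y \<Longrightarrow> G5.basis t \<star> y' = y'"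
proof (cases "G5.basis s \<star> y = y")
  case True
  then show thesis using that[of y] y by blast
next
  case False
  have bc: "(G5.basis t :: _ \<Rightarrow> 'k) \<in> carrier kA5" if "t \<in> carrier G5" for t by (rule G5.basis_closed[OF that])
  define y' where "y' = y \<oplus>\<^bsub>kA5\<^esub> G5.basis s \<star> y"
  have ss: "G5.basis s \<star> (G5.basis s \<star> y) = y"
    by (simp only: basis_comp[OF s(1) s(1) y(1)] s(2) basis_id[OF y(1)])
  show thesis
  proof (rule that[of y'])
    show "y' \<in> carrier kA5" using y bc s by (simp add: y'_def)
    show "y' \<star> f = y'"
      unfolding y'_def using y bc[OF s(1)] f_closed by (simp add: R.l_distr R.m_assoc)
    show "y' \<noteq> 0"
    proof
      assume "y' = 0"
      then have "y u + (G5.basis s \<star> y) u = 0" for u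
        by (simp add: y'_def G5.KG_simps fun_eq_iff)
      then have "y u = (G5.basis s \<star> y) u" for u
        using cancel[of "(G5.basis s \<star> y) u" "y u"] by (simp add: add.commute)
      then show False using False by (simp add: fun_eq_iff)
    qed
    show "G5.basis s \<star> y' = y'"
      unfolding y'_def using y bc[OF s(1)] by (simp add: R.r_distr ss R.a_comm)
    fix t assume t: "t \<in> carrier G5" "t \<circ> s = s \<circ> t" "G5.basis t \<star> y = y"
    have "G5.basis t \<star> (G5.basis s \<star> y) = G5.basis s \<star> y"
      by (simp only: basis_comp[OF t(1) s(1) y(1)] t(2) basis_comp[OF s(1) t(1) y(1), symmetric] t(3))
    then show "G5.basis t \<star> y' = y'"
      unfolding y'_def using y bc[OF s(1)] bc[OF t(1)] t(3) by (simp add: R.r_distr)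
  qed
qed

text \<open>If \<open>f \<noteq> 0\<close>, two applications of \<open>fixed_step\<close> give \<open>W \<noteq> 0\<close> in \<open>Af\<close> fixed by the stabilizer of the
  first basis vector \<open>b1\<close>. The element \<open>(xg)W\<close> depends only on the vector \<open>xg b1\<close>, so \<open>f(gW)\<close> is
  computed from the action of \<open>f\<close> on functions on the plane and vanishes. By symmetry of the trace form,
  the coefficient of \<open>gW = (gW)f\<close> at the identity is that of \<open>f(gW) = 0\<close>, and for varying \<open>g\<close> these are all
  coefficients of \<open>W\<close>.\<close>

lemma f_zero: "f = 0"
proof (rule ccontr)
  assume f0: "f \<noteq> 0"
  define b1 :: "'k^2" where "b1 = (\<chi> i. if i = 1 then 1 else 0)"
  have b1: "b1 $ 1 = 1" "b1 $ 2 = 0" by (simp_all add: b1_def)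
  have b1F: "b1 \<in> plane" by (simp add: plane_def b1 F_closed)
  define T :: "'k \<Rightarrow> 'k^2^2" where "T c = (\<chi> i j. if i = j then 1 else if i = 1 then c else 0)" for c
  have T: "T c $ 1 $ 1 = 1" "T c $ 1 $ 2 = c" "T c $ 2 $ 1 = 0" "T c $ 2 $ 2 = 1" for c
    by (simp_all add: T_def)
  have Tex: "\<exists>g\<in>carrier G5. \<phi> g = T c" if "c \<in> F" for c
    by (rule phi_surj) (use that F_closed(3,4) in \<open>auto simp: T_def det_2\<close>)
  obtain s where s: "s \<in> carrier G5" "\<phi> s = T 1" using Tex[OF F_closed(4)] by blast
  obtain t where t: "t \<in> carrier G5" "\<phi> t = T w" using Tex[OF F_closed(5)] by blast
  have TT: "T c ** T d = T (c + d)" for c d by (simp add: mat2_eq_iff mult_mat_entries T add.commute)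
  have T0: "T 0 = mat 1" by (simp add: mat2_eq_iff T one_entries)
  have id: "id \<in> carrier G5" using G5.one_closed by (simp add: alt_group_one)
  have eqI: "g = h" if "g \<in> carrier G5" "h \<in> carrier G5" "\<phi> g = \<phi> h" for g h
    using phi_eq that by blast
  have ss: "s \<circ> s = id"
    by (rule eqI[OF G5_comp[OF s(1) s(1)] id]) (simp add: phi_mult[OF s(1) s(1)] s(2) TT two T0 phi_one)
  have tt: "t \<circ> t = id"
    by (rule eqI[OF G5_comp[OF t(1) t(1)] id]) (simp add: phi_mult[OF t(1) t(1)] t(2) TT two T0 phi_one)
  have st: "s \<circ> t = t \<circ> s"
    by (rule eqI[OF G5_comp[OF s(1) t(1)] G5_comp[OF t(1) s(1)]])
       (simp add: phi_mult[OF s(1) t(1)] phi_mult[OF t(1) s(1)] s(2) t(2) TT add.commute)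
  obtain y where y: "y \<in> carrier kA5" "y \<star> f = y" "y \<noteq> 0" "G5.basis s \<star> y = y"
    using fixed_step[OF s(1) ss f_closed f_idem f0] by blast
  obtain W where W: "W \<in> carrier kA5" "W \<star> f = W" "W \<noteq> 0" "G5.basis t \<star> W = W"
    "G5.basis s \<star> W = W"
  proof (rule fixed_step[OF t(1) tt y(1-3)])
    fix W assume "W \<in> carrier kA5" "W \<star> f = W" "W \<noteq> 0" "G5.basis t \<star> W = W"
      and "\<And>r. r \<in> carrier G5 \<Longrightarrow> r \<circ> t = t \<circ> r \<Longrightarrow> G5.basis r \<star> y = y \<Longrightarrow> G5.basis r \<star> W = W"
    then show thesis using that[of W] s(1) st y(4) by blast
  qed
  have stab: "v \<in> {id, s, t, s \<circ> t}" if v: "v \<in> carrier G5" "\<phi> v *v b1 = b1" for v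
  proof -
    have c: "\<phi> v $ 1 $ 1 = 1" "\<phi> v $ 2 $ 1 = 0" using v(2) by (simp_all add: vec2_eq_iff mult_vec_entries b1)
    then have "\<phi> v $ 2 $ 2 = 1" using phi_det[OF v(1)] by (simp add: det_2)
    then have vT: "\<phi> v = T (\<phi> v $ 1 $ 2)" using c by (simp add: mat2_eq_iff T)
    have "\<phi> v $ 1 $ 2 \<in> {0, 1, w, 1 + w}" using phi_F[OF v(1), of 1 2] by (auto simp: F add.commute)
    then have "\<phi> v \<in> {T 0, T 1, T w, T (1 + w)}" using vT by fastforce
    then have "\<phi> v = \<phi> id \<or> \<phi> v = \<phi> s \<or> \<phi> v = \<phi> t \<or> \<phi> v = \<phi> (s \<circ> t)"
      using s t by (simp add: phi_mult TT T0 phi_one)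
    then show ?thesis using phi_eq v(1) id s(1) t(1) G5_comp by blast
  qed
  have fixW: "G5.basis v \<star> W = W" if "v \<in> carrier G5" "\<phi> v *v b1 = b1" for v
    using stab[OF that] W basis_comp[OF s(1) t(1) W(1)] basis_id[OF W(1)] by auto
  have Wv: "W (v \<circ> u) = W u" if v: "v \<in> carrier G5" "\<phi> v *v b1 = b1" and u: "u \<in> carrier G5" for u v
  proof -
    have "W (v \<circ> u) = (G5.basis v \<star> W) (v \<circ> u)" by (simp add: fixW[OF v])
    also have "\<dots> = W (inv' v \<circ> (v \<circ> u))" by (rule shift_apply[OF v(1) W(1) G5_comp[OF v(1) u]])
    also have "\<dots> = W u" using G5_inv(3)[OF v(1)] by (simp add: o_assoc)
    finally show ?thesis .
  qed
  define k where "k z = (SOME g. g \<in> carrier G5 \<and> \<phi> g *v b1 = z)" for z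
  have k: "k (\<phi> g *v b1) \<in> carrier G5" "\<phi> (k (\<phi> g *v b1)) *v b1 = \<phi> g *v b1" if "g \<in> carrier G5" for g
    unfolding atomize_conj k_def by (rule someI[of _ g]) (simp add: that)
  define q where "q z = W (inv' (k z))" for z
  have q: "q (\<phi> g *v b1) = W (inv' g)" if g: "g \<in> carrier G5" for g
  proof -
    let ?k = "k (\<phi> g *v b1)"
    define v where "v = inv' ?k \<circ> g"
    note K = k[OF g]
    have v: "v \<in> carrier G5" unfolding v_def by (rule G5_comp[OF G5_inv(2)[OF K(1)] g])
    have "\<phi> v *v b1 = \<phi> (inv' ?k) *v (\<phi> ?k *v b1)"
      unfolding v_def phi_comp_vec[OF G5_inv(2)[OF K(1)] g] K(2) ..
    then have vb: "\<phi> v *v b1 = b1" by (simp add: phi_inv_vec(1)[OF K(1)])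
    have "v \<circ> inv' g = inv' ?k" using G5_inv(4)[OF g] by (simp add: v_def comp_assoc)
    then show ?thesis using Wv[OF v vb G5_inv(2)[OF g]] by (simp add: q_def)
  qed
  have bc: "(G5.basis g :: _ \<Rightarrow> 'k) \<in> carrier kA5" if "g \<in> carrier G5" for g by (rule G5.basis_closed[OF that])
  have "W (inv' g) = 0" if g: "g \<in> carrier G5" for g
  proof -
    let ?gW = "G5.basis g \<star> W"
    have "W (inv' g) = ?gW id" using shift_apply[OF g W(1) id] by simp
    also have "?gW = ?gW \<star> f"
      using W(1,2) bc[OF g] f_closed by (simp add: R.m_assoc)
    also have "(?gW \<star> f) id = (f \<star> ?gW) id"
      using G5.KG_symmetric[of ?gW f] by (simp add: alt_group_one)
    also have "\<dots> = (\<Sum>x\<in>carrier G5. f x * ?gW (inv' x))"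
      using id by (simp add: G5.KG_mult[of f] G5_inv(1) alt_group_mult cong: sum.cong)
    also have "\<dots> = (\<Sum>x\<in>carrier G5. f x * q (\<phi> x *v (\<phi> g *v b1)))"
    proof (intro sum.cong refl)
      fix x assume x: "x \<in> carrier G5"
      have "?gW (inv' x) = W (inv' (x \<circ> g))"
        using shift_apply[OF g W(1) G5_inv(2)[OF x]] G5_inv_comp[OF x g] by simp
      also have "\<dots> = q (\<phi> (x \<circ> g) *v b1)" by (rule q[OF G5_comp[OF x g], symmetric])
      also have "\<dots> = q (\<phi> x *v (\<phi> g *v b1))" by (simp add: phi_comp_vec[OF x g])
      finally show "f x * ?gW (inv' x) = f x * q (\<phi> x *v (\<phi> g *v b1))" by simp
    qed
    also have "\<dots> = Op q (\<phi> g *v b1)" by (simp add: Op_def)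
    also have "\<dots> = 0" using all_killed phi_plane[OF g b1F] by (simp add: killed_def)
    finally show ?thesis .
  qed
  then have "W g = 0" if "g \<in> carrier G5" for g using G5_inv(2,7)[OF that] by metis
  then have "W = 0" using W(1) by (auto simp: G5.KG_simps fun_eq_iff)
  then show False using W(3) by simp
qed

end

section \<open>The blocks\<close>

lemma ring_kA5: "ring (kA5 :: ((nat \<Rightarrow> nat) \<Rightarrow> 'k::field) ring)"
  by (rule G5.KG_ring)

lemma block_idem_central:
  assumes "CHAR('k::field) = 2"
  shows "idempotent (ring_center kA5) (block_idem :: _ \<Rightarrow> 'k)"
proof -
  interpret R: ring "kA5 :: (_ \<Rightarrow> 'k) ring" by (rule ring_kA5)
  have "block_idem \<star> a = a \<star> (block_idem :: _ \<Rightarrow> 'k)" for a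
    by (rule class_function_central[OF block_idem_closed block_idem_class])
  then show ?thesis
    unfolding R.center_idempotent using block_idem_closed block_idem_square[OF assms] by blast
qed

text \<open>Commuting with the group elements means being a class function.\<close>

lemma central_idempotents_kA5:
  fixes z :: "(nat \<Rightarrow> nat) \<Rightarrow> 'k::field"
  assumes char: "CHAR('k) = 2" and z: "idempotent (ring_center kA5) z"
  shows "z \<in> {\<zero>\<^bsub>kA5\<^esub>, \<one>\<^bsub>kA5\<^esub>, block_idem, \<one>\<^bsub>kA5\<^esub> \<ominus>\<^bsub>kA5\<^esub> block_idem}"
proof -
  interpret R: ring "kA5 :: (_ \<Rightarrow> 'k) ring" by (rule ring_kA5)
  have zc: "z \<in> carrier kA5" and zcomm: "\<And>a. a \<in> carrier kA5 \<Longrightarrow> z \<star> a = a \<star> z"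
    and zz: "z \<star> z = z" using z unfolding R.center_idempotent by blast+
  have cf: "z g = z g'" if G: "g \<in> carrier G5" "h \<in> carrier G5" "g' \<in> carrier G5" and e: "h \<circ> g = g' \<circ> h" for g h g'
  proof -
    have hg: "h \<circ> g \<in> carrier G5" by (rule G5_comp[OF G(2,1)])
    have "z g = (G5.basis h \<star> z) (h \<circ> g)"
      using hg G5_inv(3)[OF G(2)] by (simp add: G5.basis_mult_left[OF G(2) zc] alt_group_mult G5_inv(1)[OF G(2)] o_assoc)
    also have "\<dots> = (z \<star> G5.basis h) (h \<circ> g)"
      using zcomm[OF G5.basis_closed[OF G(2)]] by simp
    also have "\<dots> = z (g' \<circ> h \<circ> inv' h)"
      using hg by (simp add: G5.mult_basis_right[OF G(2) zc] alt_group_mult G5_inv(1)[OF G(2)] e)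
    also have "\<dots> = z g'" using G5_inv(4)[OF G(2)] by (simp add: comp_assoc)
    finally show ?thesis .
  qed
  have idem: "(\<Sum>g\<in>carrier G5. z g * z (inv' g \<circ> u)) = z u" if u: "u \<in> carrier G5" for u
  proof -
    have "(z \<star> z) u = (\<Sum>g\<in>carrier G5. z g * z (inv' g \<circ> u))"
      using u by (simp add: G5.KG_mult alt_group_mult G5_inv(1) cong: sum.cong)
    then show ?thesis by (simp add: zz)
  qed
  obtain a c where a: "a \<in> {0,1}" and c: "c \<in> {0,1}" and
    zu: "\<And>u. u \<in> carrier G5 \<Longrightarrow> z u = (if u = id then a else 0) + c * (of_nat (fixpts u) + 1)"
    by (rule class_function_idempotent[OF char cf idem]) (assumption | rule that)+
  have id: "id \<in> carrier G5" using G5.one_closed by (simp add: alt_group_one)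
  have neg: "- x = x" for x :: 'k using char2_add_self[OF char, of x] by (simp add: minus_unique)
  have "\<ominus>\<^bsub>kA5\<^esub> block_idem = (block_idem :: _ \<Rightarrow> 'k)"
    by (rule R.minus_equality)
      (use block_idem_closed char2_add_self[OF char] in \<open>auto simp: G5.KG_simps(2,3) fun_eq_iff\<close>)
  then have m: "\<one>\<^bsub>kA5\<^esub> \<ominus>\<^bsub>kA5\<^esub> block_idem = (\<lambda>u. (if u = id then 1 else 0) + (block_idem u :: 'k))"
    by (simp add: R.minus_eq G5.KG_simps alt_group_one fun_eq_iff)
  have "z = (\<lambda>u. (if u = id then a else 0) + c * block_idem u)"
  proof
    fix u show "z u = (if u = id then a else 0) + c * block_idem u"
      using zu[of u] zc id by (cases "u \<in> carrier G5") (auto simp: block_idem_def G5.KG_simps)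
  qed
  then show ?thesis
    unfolding m using a c by (auto simp: G5.KG_simps alt_group_one fun_eq_iff)
qed

lemma block_idem_nontrivial:
  assumes "CHAR('k::field) = 2"
  shows "(block_idem :: _ \<Rightarrow> 'k) \<noteq> \<zero>\<^bsub>kA5\<^esub>" "(block_idem :: _ \<Rightarrow> 'k) \<noteq> \<one>\<^bsub>kA5\<^esub>"
proof -
  have "point_sum block_idem 1 2 = (1 :: 'k)" using point_sum_block_idem[OF assms, of 1 2] by simp
  then show "(block_idem :: _ \<Rightarrow> 'k) \<noteq> \<zero>\<^bsub>kA5\<^esub>"
    by (auto simp: G5.KG_simps point_sum_def cong: if_cong)
  have "(\<Sum>g\<in>carrier G5. \<one>\<^bsub>kA5\<^esub> g) = (1::'k)"
    using G5.fin G5.one_closed by (simp add: G5.KG_simps)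
  then show "(block_idem :: _ \<Rightarrow> 'k) \<noteq> \<one>\<^bsub>kA5\<^esub>" using sum_block_idem[OF assms] by auto
qed

abbreviation "main_idem \<equiv> \<one>\<^bsub>kA5\<^esub> \<ominus>\<^bsub>kA5\<^esub> block_idem"

lemma blocks_kA5:
  assumes char: "CHAR('k::field) = 2"
  shows "{z. primitive_idempotent (ring_center kA5) z} = {main_idem, block_idem :: _ \<Rightarrow> 'k}"
    "primitive_decomposition (ring_center kA5) E \<longleftrightarrow> E = {main_idem, block_idem :: _ \<Rightarrow> 'k}"
    "main_idem \<noteq> (block_idem :: _ \<Rightarrow> 'k)"
  using ring.two_central_idempotents[OF ring_kA5 block_idem_central[OF char] block_idem_nontrivial[OF char]
      central_idempotents_kA5[OF char]] by blast+

lemma PIdl_main_neq: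
  assumes char: "CHAR('k::field) = 2"
  shows "PIdl\<^bsub>kA5\<^esub> (main_idem :: _ \<Rightarrow> 'k) \<noteq> PIdl\<^bsub>kA5\<^esub> block_idem"
proof
  interpret R: ring "kA5 :: (_ \<Rightarrow> 'k) ring" by (rule ring_kA5)
  note bc = block_idem_central[OF char]
  assume e: "PIdl\<^bsub>kA5\<^esub> (main_idem :: _ \<Rightarrow> 'k) = PIdl\<^bsub>kA5\<^esub> block_idem"
  have "block_idem \<in> PIdl\<^bsub>kA5\<^esub> (main_idem :: _ \<Rightarrow> 'k)"
    unfolding e R.central_PIdl[OF bc] using block_idem_closed block_idem_square[OF char] by blast
  then have "block_idem \<star> main_idem = (block_idem :: _ \<Rightarrow> 'k)"
    unfolding R.central_PIdl[OF R.complement_idempotent(1)[OF bc]] by blast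
  then show False using R.complement_idempotent(2)[OF bc] block_idem_nontrivial(1)[OF char] by metis
qed

lemma blocks_set:
  assumes char: "CHAR('k::field) = 2"
  shows "blocks (kA5 :: (_ \<Rightarrow> 'k) ring) = {PIdl\<^bsub>kA5\<^esub> main_idem, PIdl\<^bsub>kA5\<^esub> block_idem}"
  unfolding blocks_def using blocks_kA5(2)[OF char] by auto

section \<open>The principal block and annihilators of the simple modules\<close>

lemma main_idem_action:
  assumes "left_module kA5 M" "m \<in> carrier M"
  shows "block_idem \<odot>\<^bsub>M\<^esub> m = \<zero>\<^bsub>M\<^esub> \<Longrightarrow> main_idem \<odot>\<^bsub>M\<^esub> m = m"
    "block_idem \<odot>\<^bsub>M\<^esub> m = m \<Longrightarrow> main_idem \<odot>\<^bsub>M\<^esub> m = \<zero>\<^bsub>M\<^esub>"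
proof -
  interpret left_module "kA5 :: (_ \<Rightarrow> 'a::field) ring" M by fact
  note bc = block_idem_closed[where 'a='a]
  have s: "main_idem \<odot>\<^bsub>M\<^esub> m \<oplus>\<^bsub>M\<^esub> block_idem \<odot>\<^bsub>M\<^esub> m = m"
  proof -
    have "(main_idem \<oplus>\<^bsub>kA5\<^esub> block_idem) = (\<one>\<^bsub>kA5\<^esub> :: _ \<Rightarrow> 'a)"
      using bc by (simp add: R.minus_eq R.a_assoc R.l_neg)
    then show ?thesis using smult_l_distr[OF _ bc assms(2), of main_idem] bc smult_one[OF assms(2)] by simp
  qed
  have mc: "main_idem \<odot>\<^bsub>M\<^esub> m \<in> carrier M" using bc assms(2) smult_closed by simp
  show "block_idem \<odot>\<^bsub>M\<^esub> m = \<zero>\<^bsub>M\<^esub> \<Longrightarrow> main_idem \<odot>\<^bsub>M\<^esub> m = m" using s mc by simp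
  show "block_idem \<odot>\<^bsub>M\<^esub> m = m \<Longrightarrow> main_idem \<odot>\<^bsub>M\<^esub> m = \<zero>\<^bsub>M\<^esub>"
    using s mc assms(2) M.add.r_cancel_one[of m "main_idem \<odot>\<^bsub>M\<^esub> m"] by simp
qed

lemma block_idem_trivial:
  assumes "CHAR('k::field) = 2"
  shows "block_idem \<odot>\<^bsub>trivial_module G5\<^esub> v = (0::'k)"
  by (simp add: trivial_smult sum_block_idem[OF assms])

text \<open>The block idempotent has augmentation zero, so it acts as zero on the trivial module.\<close>

lemma principal_block_kA5:
  assumes char: "CHAR('k::field) = 2"
  shows "principal_block G5 = PIdl\<^bsub>kA5\<^esub> (main_idem :: _ \<Rightarrow> 'k)"
  unfolding principal_block_def
proof (rule the_equality)
  let ?T = "trivial_module G5 :: ((nat \<Rightarrow> nat) \<Rightarrow> 'k, 'k) module"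
  have sT: "simple_module kA5 ?T" by (rule simple_trivial)
  then have T: "left_module kA5 ?T" by (simp add: simple_module_def)
  have ind: "indecomposable_module kA5 ?T"
    unfolding indecomposable_module_def
  proof (intro conjI allI impI T)
    show "carrier ?T \<noteq> {\<zero>\<^bsub>?T\<^esub>}" using sT unfolding simple_module_def by blast
    fix U V assume "internal_direct_sum kA5 ?T U V"
    then have UV: "submodule U kA5 ?T" "submodule V kA5 ?T" "U \<inter> V = {\<zero>\<^bsub>?T\<^esub>}"
      by (auto simp: internal_direct_sum_def)
    then have "U = {\<zero>\<^bsub>?T\<^esub>} \<or> U = carrier ?T" using sT unfolding simple_module_def by blast
    then show "U = {\<zero>\<^bsub>?T\<^esub>} \<or> V = {\<zero>\<^bsub>?T\<^esub>}" using UV(3) submodule_subset[OF UV(2)] by blast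
  qed
  have z: "block_idem \<odot>\<^bsub>?T\<^esub> m = \<zero>\<^bsub>?T\<^esub>" for m
    using block_idem_trivial[OF char] by (simp add: trivial_smult)
  have "(\<lambda>m. main_idem \<odot>\<^bsub>?T\<^esub> m) ` carrier ?T = carrier ?T"
    using main_idem_action(1)[OF T _ z] by simp
  then show "belongs_to_block kA5 ?T (PIdl\<^bsub>kA5\<^esub> main_idem)"
    unfolding belongs_to_block_def blocks_kA5(2)[OF char] using ind by blast
  fix B assume "belongs_to_block kA5 ?T B"
  then obtain e where e: "e \<in> {main_idem, block_idem}" "B = PIdl\<^bsub>kA5\<^esub> e"
    "carrier ?T = (\<lambda>m. e \<odot>\<^bsub>?T\<^esub> m) ` carrier ?T"
    unfolding belongs_to_block_def blocks_kA5(2)[OF char] by blast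
  have "e \<noteq> block_idem"
  proof
    assume "e = block_idem"
    then have ez: "e \<odot>\<^bsub>?T\<^esub> m = \<zero>\<^bsub>?T\<^esub>" for m using z by (simp only:)
    have "m = \<zero>\<^bsub>?T\<^esub>" if "m \<in> carrier ?T" for m
    proof -
      have "m \<in> (\<lambda>m. e \<odot>\<^bsub>?T\<^esub> m) ` carrier ?T" by (rule subst[OF e(3), of "\<lambda>C. m \<in> C"]) (rule that)
      then show ?thesis unfolding ez by blast
    qed
    moreover have "\<zero>\<^bsub>?T\<^esub> \<in> carrier ?T" by (simp add: trivial_smult)
    ultimately have "carrier ?T = {\<zero>\<^bsub>?T\<^esub>}" by blast
    then show False using sT unfolding simple_module_def by blast
  qed
  then show "B = PIdl\<^bsub>kA5\<^esub> main_idem" using e by blast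
qed

lemma block_idem_sum_zero:
  assumes char: "CHAR('k::field) = 2" and v: "v \<in> carrier (sum_zero_module G5 {1..5} :: (_ \<Rightarrow> 'k, _) module)"
  shows "block_idem \<odot>\<^bsub>sum_zero_module G5 {1..5}\<^esub> v = v"
proof
  fix z
  interpret S: linear_rep G5 "coord_scale :: 'k \<Rightarrow> _" sum_zero_vectors coord_act by (rule linear_rep_sum_zero)
  have vS: "v \<in> sum_zero_vectors" using v unfolding sum_zero_module_eq S.M_simps(1) .
  have neg: "- x = x" for x :: 'k using char2_add_self[OF char, of x] by (simp add: minus_unique)
  have c: "block_idem \<odot>\<^bsub>S.M\<^esub> v \<in> sum_zero_vectors" using S.smult_closed_M[OF vS] .
  show "(block_idem \<odot>\<^bsub>sum_zero_module G5 {1..5}\<^esub> v) z = v z"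
    unfolding sum_zero_module_eq
  proof (cases "z \<in> {1..5}")
    case True
    have "(block_idem \<odot>\<^bsub>S.M\<^esub> v) z = (\<Sum>x\<in>{1..5}. point_sum block_idem x z * v x)"
      unfolding S.M_simps using vS by (intro sum_zero_smult) auto
    also have "\<dots> = (\<Sum>x\<in>{1..5}. v x - (if x = z then v x else 0))"
      using True by (intro sum.cong refl) (simp add: point_sum_block_idem[OF char])
    also have "\<dots> = v z" using True vS by (simp add: sum_subtractf neg)
    finally show "(block_idem \<odot>\<^bsub>S.M\<^esub> v) z = v z" .
  next
    case False
    then show "(block_idem \<odot>\<^bsub>S.M\<^esub> v) z = v z" using c vS by simp
  qed
qed

text \<open>Acting as zero on the differences of basis vectors makes the matrix entries independent of \<open>x\<close>. The
  square of such a matrix has the column sum as a factor, which is the augmentation and vanishes.\<close>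

lemma point_sum_zero:
  fixes f :: "(nat \<Rightarrow> nat) \<Rightarrow> 'k::field"
  assumes char: "CHAR('k) = 2" and idem: "f \<star> f = f" and aug: "(\<Sum>g\<in>carrier G5. f g) = 0"
    and S4: "\<And>v. v \<in> carrier (sum_zero_module G5 {1..5}) \<Longrightarrow> f \<odot>\<^bsub>sum_zero_module G5 {1..5}\<^esub> v = 0"
    and xz: "x \<in> {1..5}" "z \<in> {1..5}"
  shows "point_sum f x z = 0"
proof -
  interpret S: linear_rep G5 "coord_scale :: 'k \<Rightarrow> _" sum_zero_vectors coord_act by (rule linear_rep_sum_zero)
  have eq: "point_sum f y z = point_sum f x z" if y: "y \<in> {1..5}" for y
  proof (cases "y = x")
    case False
    define v :: "nat \<Rightarrow> 'k" where "v = (\<lambda>i. (if i = x then 1 else 0) + (if i = y then 1 else 0))"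
    have vS: "v \<in> sum_zero_vectors" using xz(1) y char2_add_self[OF char, of 1] by (auto simp: v_def sum.distrib)
    then have "f \<odot>\<^bsub>S.M\<^esub> v = 0" using S4[unfolded sum_zero_module_eq S.M_simps(1)] by blast
    then have "0 = (f \<odot>\<^bsub>S.M\<^esub> v) z" by simp
    also have "\<dots> = (\<Sum>i\<in>{1..5}. point_sum f i z * v i)"
      unfolding S.M_simps using vS by (intro sum_zero_smult) auto
    also have "\<dots> = (\<Sum>i\<in>{1..5}. (if i = x then point_sum f i z else 0) + (if i = y then point_sum f i z else 0))"
      by (intro sum.cong refl) (simp add: v_def distrib_left)
    also have "\<dots> = point_sum f x z + point_sum f y z" using xz(1) y by (simp add: sum.distrib)
    finally have "point_sum f x z + point_sum f y z = 0" by simp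
    then show ?thesis using char2_add_self[OF char, of "point_sum f x z"] by (metis add_left_imp_eq)
  qed simp
  have vs: "vector_space ((*) :: 'k \<Rightarrow> 'k \<Rightarrow> 'k)" by (rule G5.vector_space_mult)
  have "point_sum f x z = (\<Sum>u\<in>carrier G5. (f \<star> f) u * (if u x = z then 1 else 0))"
    unfolding idem point_sum_def by (intro sum.cong refl) auto
  also have "\<dots> = (\<Sum>g\<in>carrier G5. \<Sum>h\<in>carrier G5. f g * f h * (if (g \<otimes>\<^bsub>G5\<^esub> h) x = z then 1 else 0))"
    by (rule G5.KG_sum_mult[OF vs])
  also have "\<dots> = (\<Sum>h\<in>carrier G5. \<Sum>g\<in>carrier G5. f g * f h * (if (g \<otimes>\<^bsub>G5\<^esub> h) x = z then 1 else 0))"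
    by (rule sum.swap)
  also have "\<dots> = (\<Sum>h\<in>carrier G5. f h * point_sum f (h x) z)"
    unfolding point_sum_def sum_distrib_left alt_group_mult by (intro sum.cong refl) simp
  also have "\<dots> = (\<Sum>h\<in>carrier G5. f h * point_sum f x z)"
  proof (intro sum.cong refl)
    fix h assume "h \<in> carrier G5"
    then have "h x \<in> {1..5}" using G5_inv(6) xz(1) by blast
    then show "f h * point_sum f (h x) z = f h * point_sum f x z" by (simp add: eq)
  qed
  also have "\<dots> = 0" by (simp add: aug flip: sum_distrib_right)
  finally show ?thesis .
qed

lemma matrix_entry:
  fixes \<rho> :: "(nat \<Rightarrow> nat) \<Rightarrow> 'k::field^2^2"
  shows "(f \<odot>\<^bsub>matrix_module G5 \<rho>\<^esub> axis j 1) $ i = (\<Sum>g\<in>carrier G5. f g * \<rho> g $ i $ j)"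
  by (simp add: matrix_module_def linear_module_def matrix_vector_mult_def axis_def
      if_distrib[of "\<lambda>c. _ * c"] cong: if_cong)

section \<open>The field with four elements and its special linear group\<close>

lemma F4_structure:
  fixes F :: "'k::field set"
  assumes char: "CHAR('k) = 2" and F: "subfield F ring_of_type_algebra" "card F = 4"
  obtains w where "F = {0, 1, w, w + 1}" "w * w = w + 1"
proof -
  have R: "subring F (ring_of_type_algebra :: 'k ring)"
    using F(1) by (simp add: subfield_def subdomain_def subcring_def)
  note closed = subringE[OF R, unfolded ring_of_type_algebra_def, simplified]
  have two: "x + x = (0::'k)" for x by (rule char2_add_self[OF char])
  have cancel: "x + (x + y) = y" for x y :: 'k by (simp add: two flip: add.assoc)
  have c: "0 \<in> F" "1 \<in> F" "\<And>x y. x \<in> F \<Longrightarrow> y \<in> F \<Longrightarrow> x + y \<in> F" "\<And>x y. x \<in> F \<Longrightarrow> y \<in> F \<Longrightarrow> x * y \<in> F"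
    using closed by auto
  have fin: "finite F" using F(2) by (metis card.infinite zero_neq_numeral)
  have "\<not> F \<subseteq> {0,1}"
  proof
    assume "F \<subseteq> {0,1}"
    then have "card F \<le> card {0::'k,1}" by (intro card_mono) auto
    then show False using F(2) by simp
  qed
  then obtain w where w: "w \<in> F" "w \<noteq> 0" "w \<noteq> 1" by blast
  have w1: "w + 1 \<noteq> 0" "w + 1 \<noteq> 1" "w + 1 \<noteq> w"
  proof -
    show "w + 1 \<noteq> 0"
    proof
      assume "w + 1 = 0"
      then have "1 + (1 + w) = 1" by (simp only: add.commute[of 1 w]) simp
      then show False using w(3) unfolding cancel by simp
    qed
  qed (use w in simp_all)
  have sub: "{0, 1, w, w + 1} \<subseteq> F" using c w by auto
  moreover have "card {0, 1, w, w + 1} = 4" using w w1 by auto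
  ultimately have plane: "F = {0, 1, w, w + 1}" using card_subset_eq[OF fin sub] F(2) by simp
  have "w * w \<in> F" using c w by blast
  moreover have "w * w \<noteq> 0" "w * w \<noteq> w" using w by auto
  moreover have "w * w \<noteq> 1"
  proof
    assume "w * w = 1"
    then have "(w + 1) * (w + 1) = 0" by (simp add: algebra_simps two cancel)
    then show False using w1 by simp
  qed
  ultimately have "w * w = w + 1" using plane by auto
  then show thesis using that plane by blast
qed

text \<open>The only nontrivial automorphism exchanges \<open>w\<close> and \<open>w + 1 = w\<^sup>2\<close>, so it is the Frobenius map.\<close>

lemma F4_automorphism:
  fixes F :: "'k::field set"
  assumes char: "CHAR('k) = 2" and F: "F = {0, 1, w, w + 1}" and w: "w * w = w + 1"
    and \<sigma>: "\<sigma> \<in> ring_iso (subfield_ring F) (subfield_ring F)" "\<exists>x\<in>F. \<sigma> x \<noteq> x"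
    and x: "x \<in> F"
  shows "\<sigma> x = x * x"
proof -
  have two: "x + x = (0::'k)" for x by (rule char2_add_self[OF char])
  have cancel: "x + (x + y) = y" for x y :: 'k by (simp add: two flip: add.assoc)
  have hom: "\<sigma> (a + b) = \<sigma> a + \<sigma> b" if "a \<in> F" "b \<in> F" for a b
    using \<sigma>(1) that by (auto simp: ring_iso_def ring_hom_def ring_of_type_algebra_def)
  have one: "\<sigma> 1 = 1"
    using \<sigma>(1) by (auto simp: ring_iso_def ring_hom_def ring_of_type_algebra_def)
  have bij: "bij_betw \<sigma> F F" using \<sigma>(1) by (simp add: ring_iso_def)
  have zero: "\<sigma> 0 = 0" using hom[of 0 0] F two by simp
  have w01: "w \<noteq> 0" "w \<noteq> 1" using w two[of 1] by auto
  have F': "0 \<in> F" "1 \<in> F" "w \<in> F" "w + 1 \<in> F" using F by auto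
  have "\<sigma> w \<in> F" using bij F'(3) by (auto simp: bij_betw_def)
  moreover have "\<sigma> w \<noteq> 0" "\<sigma> w \<noteq> 1"
    using bij F' w01 zero one unfolding bij_betw_def by (metis inj_onD)+
  moreover have w1: "\<sigma> (w + 1) = \<sigma> w + 1" using hom[of w 1] F' one by simp
  moreover have "\<sigma> w \<noteq> w" using \<sigma>(2) w1 zero one F by auto
  ultimately have "\<sigma> w = w + 1" using F by auto
  then show ?thesis using x zero one w1 w unfolding F by (auto simp: algebra_simps two cancel)
qed

lemma SL2_iso:
  assumes "\<phi> \<in> iso G5 (SL2 F)"
  shows "g \<in> carrier G5 \<Longrightarrow> h \<in> carrier G5 \<Longrightarrow> \<phi> (g \<circ> h) = \<phi> g ** \<phi> h"
    "g \<in> carrier G5 \<Longrightarrow> det (\<phi> g) = 1" "g \<in> carrier G5 \<Longrightarrow> \<phi> g $ i $ j \<in> F" "inj_on \<phi> (carrier G5)"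
    "(\<And>i j. M $ i $ j \<in> F) \<Longrightarrow> det M = 1 \<Longrightarrow> \<exists>g\<in>carrier G5. \<phi> g = M"
proof -
  have h: "\<phi> \<in> hom G5 (SL2 F)" and b: "bij_betw \<phi> (carrier G5) (carrier (SL2 F))"
    using assms by (auto simp: iso_def)
  show "g \<in> carrier G5 \<Longrightarrow> h \<in> carrier G5 \<Longrightarrow> \<phi> (g \<circ> h) = \<phi> g ** \<phi> h"
    using hom_mult[OF h, of g h] by (simp add: alt_group_mult SL2_def)
  show "g \<in> carrier G5 \<Longrightarrow> det (\<phi> g) = 1" "g \<in> carrier G5 \<Longrightarrow> \<phi> g $ i $ j \<in> F"
    using hom_in_carrier[OF h, of g] by (auto simp: SL2_def)
  show "inj_on \<phi> (carrier G5)" using b by (simp add: bij_betw_def)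
  assume M: "\<And>i j. M $ i $ j \<in> F" "det M = 1"
  have "M \<in> \<phi> ` carrier G5" using b M by (simp add: bij_betw_def SL2_def)
  then show "\<exists>g\<in>carrier G5. \<phi> g = M" by blast
qed

context sl2_F4
begin

lemma natural_rep: "sl2_rep \<phi>"
proof
  show "\<exists>g\<in>carrier G5. \<phi> g $ 1 $ 1 = 1 \<and> \<phi> g $ 1 $ 2 = 1 \<and> \<phi> g $ 2 $ 1 = 0 \<and> \<phi> g $ 2 $ 2 = 1"
  proof -
    have "\<exists>g\<in>carrier G5. \<phi> g = (\<chi> i j. if i = 2 \<and> j = 1 then 0 else 1)"
      by (rule phi_surj) (simp_all add: F_closed(3,4) det_2)
    then show ?thesis by (elim bexE, intro bexI) auto
  qed
  show "\<exists>g\<in>carrier G5. \<phi> g $ 1 $ 1 = 1 \<and> \<phi> g $ 1 $ 2 = 0 \<and> \<phi> g $ 2 $ 1 = 1 \<and> \<phi> g $ 2 $ 2 = 1"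
  proof -
    have "\<exists>g\<in>carrier G5. \<phi> g = (\<chi> i j. if i = 1 \<and> j = 2 then 0 else 1)"
      by (rule phi_surj) (simp_all add: F_closed(3,4) det_2)
    then show ?thesis by (elim bexE, intro bexI) auto
  qed
  show "\<And>g. g \<in> carrier G5 \<Longrightarrow> \<phi> g = mat 1 \<Longrightarrow> g = id"
    using phi_eq[of _ id] G5.one_closed phi_one by (simp add: alt_group_one)
qed (simp_all add: char phi_mult phi_one phi_det)

lemma twisted_rep:
  assumes \<sigma>: "\<And>x. x \<in> F \<Longrightarrow> \<sigma> x = x * x"
  shows "sl2_rep (\<lambda>g. map_matrix \<sigma> (\<phi> g))"
proof -
  interpret N: sl2_rep \<phi> by (rule natural_rep)
  have e: "\<sigma> (\<phi> g $ i $ j) = \<phi> g $ i $ j * \<phi> g $ i $ j" if "g \<in> carrier G5" for g i j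
    by (simp add: \<sigma> phi_F that)
  have sq: "(x + y) * (x + y) = x * x + y * y" for x y :: 'k
    by (simp add: algebra_simps two cancel)
  have id: "id \<in> carrier G5" using G5.one_closed by (simp add: alt_group_one)
  have sq_eq: "x * x = y * y \<longleftrightarrow> x = y" for x y :: 'k
    using square_eq_iff[of x y] neg[of y] by auto
  show ?thesis
  proof
    fix g h assume g: "g \<in> carrier G5" and h: "h \<in> carrier G5"
    show "map_matrix \<sigma> (\<phi> (g \<circ> h)) = map_matrix \<sigma> (\<phi> g) ** map_matrix \<sigma> (\<phi> h)"
      by (simp add: mat2_eq_iff mult_mat_entries g h phi_mult \<sigma> phi_F F_closed(1,2) sq ac_simps)
  next
    fix g assume g: "g \<in> carrier G5"
    have "det (map_matrix \<sigma> (\<phi> g)) = det (\<phi> g) * det (\<phi> g)"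
      by (simp add: det_2 e g minus sq ac_simps)
    then show "det (map_matrix \<sigma> (\<phi> g)) = 1" by (simp add: phi_det g)
    assume "map_matrix \<sigma> (\<phi> g) = mat 1"
    then have "\<phi> g = mat 1"
      using sq_eq[of _ 1] by (simp add: mat2_eq_iff e g one_entries)
    then show "g = id" by (rule N.rho_inj[OF g])
  next
    show "map_matrix \<sigma> (\<phi> id) = mat 1" by (simp add: mat2_eq_iff phi_one one_entries \<sigma> F_closed(3,4))
    show "\<exists>g\<in>carrier G5. map_matrix \<sigma> (\<phi> g) $ 1 $ 1 = 1 \<and> map_matrix \<sigma> (\<phi> g) $ 1 $ 2 = 1 \<and>
        map_matrix \<sigma> (\<phi> g) $ 2 $ 1 = 0 \<and> map_matrix \<sigma> (\<phi> g) $ 2 $ 2 = 1"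
      using N.upper by (elim bexE, intro bexI) (auto simp: \<sigma> F_closed(3,4))
    show "\<exists>g\<in>carrier G5. map_matrix \<sigma> (\<phi> g) $ 1 $ 1 = 1 \<and> map_matrix \<sigma> (\<phi> g) $ 1 $ 2 = 0 \<and>
        map_matrix \<sigma> (\<phi> g) $ 2 $ 1 = 1 \<and> map_matrix \<sigma> (\<phi> g) $ 2 $ 2 = 1"
      using N.lower by (elim bexE, intro bexI) (auto simp: \<sigma> F_closed(3,4))
  qed (rule char)
qed

lemma idempotent_detected:
  assumes \<sigma>: "\<And>x. x \<in> F \<Longrightarrow> \<sigma> x = x * x"
    and f: "idempotent kA5 f"
    and S1: "\<And>v. f \<odot>\<^bsub>trivial_module G5\<^esub> v = (0 :: 'k)"
    and S2: "\<And>v. f \<odot>\<^bsub>matrix_module G5 \<phi>\<^esub> v = 0"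
    and S3: "\<And>v. f \<odot>\<^bsub>matrix_module G5 (\<lambda>g. map_matrix \<sigma> (\<phi> g))\<^esub> v = 0"
    and S4: "\<And>v. v \<in> carrier (sum_zero_module G5 {1..5}) \<Longrightarrow> f \<odot>\<^bsub>sum_zero_module G5 {1..5}\<^esub> v = 0"
  shows "f = 0"
proof -
  have fc: "f \<in> carrier kA5" "f \<star> f = f" using f by (auto simp: idempotent_def)
  have aug: "(\<Sum>g\<in>carrier G5. f g) = 0" using S1[of 1] by (simp add: trivial_smult)
  have m2: "(\<Sum>g\<in>carrier G5. f g * (\<phi> g $ i $ j * \<phi> g $ i $ j)) = 0" for i j
  proof -
    have "(\<Sum>g\<in>carrier G5. f g * map_matrix \<sigma> (\<phi> g) $ i $ j) = 0"
      using matrix_entry[of "\<lambda>g. map_matrix \<sigma> (\<phi> g)" f j i] S3 by simp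
    then show ?thesis by (simp add: map_matrix_def \<sigma> phi_F cong: sum.cong)
  qed
  interpret K: killed_idempotent where F = F and w = w and \<phi> = \<phi> and f = f
  proof
    show "point_sum f x y = 0" if "x \<in> {1..5}" "y \<in> {1..5}" for x y
      by (rule point_sum_zero[OF char fc(2) aug S4 that])
    show "(\<Sum>g\<in>carrier G5. f g * \<phi> g $ i $ j) = 0" for i j
      using matrix_entry[of \<phi> f j i] S2 by simp
  qed (use fc aug m2 in auto)
  show ?thesis by (rule K.f_zero)
qed

end

section \<open>Projective covers and primitive decompositions\<close>

text \<open>The sums over the two parts of \<open>E\<close> are identified by multiplying \<open>\<one> = \<Sum> f\<close> with the block idempotent: it
  fixes the \<open>f\<close> with \<open>Af \<cong> P\<^sub>4\<close> and annihilates the others.\<close>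

lemma alt_5_blocks:
  fixes F :: "'k::field set" and \<phi> :: "(nat \<Rightarrow> nat) \<Rightarrow> 'k^2^2"
    and P1 P2 P3 P4 :: "((nat \<Rightarrow> nat) \<Rightarrow> 'k, 'p) module"
  assumes char: "CHAR('k) = 2"
    and F: "subfield F ring_of_type_algebra" "card F = 4"
    and \<phi>: "\<phi> \<in> iso G5 (SL2 F)"
    and \<sigma>: "\<sigma> \<in> ring_iso (subfield_ring F) (subfield_ring F)" "\<exists>x\<in>F. \<sigma> x \<noteq> x"
    and P1: "projective_cover kA5 P1 (trivial_module G5)"
    and P2: "projective_cover kA5 P2 (matrix_module G5 \<phi>)"
    and P3: "projective_cover kA5 P3 (matrix_module G5 (\<lambda>g. map_matrix \<sigma> (\<phi> g)))"
    and P4: "projective_cover kA5 P4 (sum_zero_module G5 {1..5})"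
  shows "\<forall>P\<in>{P1,P2,P3}. belongs_to_block kA5 P (PIdl\<^bsub>kA5\<^esub> main_idem)"
    "belongs_to_block kA5 P4 (PIdl\<^bsub>kA5\<^esub> block_idem)"
    "primitive_decomposition kA5 E \<Longrightarrow>
      (\<Oplus>\<^bsub>kA5\<^esub>f \<in> {f \<in> E. module_isomorphic kA5 (left_ideal_module kA5 f) P1 \<or>
          module_isomorphic kA5 (left_ideal_module kA5 f) P2 \<or>
          module_isomorphic kA5 (left_ideal_module kA5 f) P3}. f) = main_idem"
    "primitive_decomposition kA5 E \<Longrightarrow>
      (\<Oplus>\<^bsub>kA5\<^esub>f \<in> {f \<in> E. module_isomorphic kA5 (left_ideal_module kA5 f) P4}. f) = block_idem"
proof -
  interpret R: ring "kA5 :: (_ \<Rightarrow> 'k) ring" by (rule ring_kA5)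
  obtain w where w: "F = {0, 1, w, w + 1}" "w * w = w + 1"
    by (rule F4_structure[OF char F])
  interpret N: sl2_F4 F w \<phi>
    by unfold_locales (rule char, rule w(1), rule w(2), rule SL2_iso(1)[OF \<phi>], assumption+, rule SL2_iso(2)[OF \<phi>], assumption,
      rule SL2_iso(3)[OF \<phi>], assumption, rule SL2_iso(4)[OF \<phi>], rule SL2_iso(5)[OF \<phi>])
  have \<sigma>2: "\<sigma> x = x * x" if "x \<in> F" for x by (rule F4_automorphism[OF char w \<sigma> that])
  interpret S2: sl2_rep \<phi> by (rule N.natural_rep)
  interpret S3: sl2_rep "\<lambda>g. map_matrix \<sigma> (\<phi> g)" by (rule N.twisted_rep[OF \<sigma>2])
  let ?S1 = "trivial_module G5 :: ((nat \<Rightarrow> nat) \<Rightarrow> 'k, 'k) module"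
  let ?S2 = "matrix_module G5 \<phi>"
  let ?S3 = "matrix_module G5 (\<lambda>g. map_matrix \<sigma> (\<phi> g))"
  let ?S4 = "sum_zero_module G5 {1..5} :: ((nat \<Rightarrow> nat) \<Rightarrow> 'k, nat \<Rightarrow> 'k) module"
  have s1: "simple_module kA5 ?S1" by (rule simple_trivial)
  have s2: "simple_module kA5 ?S2" by (rule S2.simple)
  have s3: "simple_module kA5 ?S3" by (rule S3.simple)
  have s4: "simple_module kA5 ?S4" by (rule simple_sum_zero[OF char])
  have z2: "\<zero>\<^bsub>?S2\<^esub> = 0" and z3: "\<zero>\<^bsub>?S3\<^esub> = 0"
    by (simp_all add: matrix_module_def linear_module_def)
  have z4: "\<zero>\<^bsub>?S4\<^esub> = 0"
    unfolding sum_zero_module_eq by (simp add: linear_module_def)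
  have bc: "idempotent (ring_center kA5) (block_idem :: _ \<Rightarrow> 'k)" by (rule block_idem_central[OF char])
  have b1: "\<forall>p\<in>carrier P1. block_idem \<odot>\<^bsub>P1\<^esub> p = \<zero>\<^bsub>P1\<^esub>"
    by (rule R.central_idempotent_on_cover(1)[OF bc s1 P1]) (simp only: trivial_smult(2) block_idem_trivial[OF char])
  have b2: "\<forall>p\<in>carrier P2. block_idem \<odot>\<^bsub>P2\<^esub> p = \<zero>\<^bsub>P2\<^esub>"
    by (rule R.central_idempotent_on_cover(1)[OF bc s2 P2]) (simp only: z2 S2.block_idem_smult)
  have b3: "\<forall>p\<in>carrier P3. block_idem \<odot>\<^bsub>P3\<^esub> p = \<zero>\<^bsub>P3\<^esub>"
    by (rule R.central_idempotent_on_cover(1)[OF bc s3 P3]) (simp only: z3 S3.block_idem_smult)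
  have b4: "\<forall>p\<in>carrier P4. block_idem \<odot>\<^bsub>P4\<^esub> p = p"
    by (rule R.central_idempotent_on_cover(2)[OF bc s4 P4]) (rule block_idem_sum_zero[OF char])
  have i1: "indecomposable_module kA5 P1" by (rule projective_cover_simple_indecomposable[OF s1 P1])
  have i2: "indecomposable_module kA5 P2" by (rule projective_cover_simple_indecomposable[OF s2 P2])
  have i3: "indecomposable_module kA5 P3" by (rule projective_cover_simple_indecomposable[OF s3 P3])
  have i4: "indecomposable_module kA5 P4" by (rule projective_cover_simple_indecomposable[OF s4 P4])
  have l: "left_module kA5 P1" "left_module kA5 P2" "left_module kA5 P3" "left_module kA5 P4"
    using i1 i2 i3 i4 by (simp_all add: indecomposable_module_def)
  have member: "belongs_to_block kA5 P (PIdl\<^bsub>kA5\<^esub> e)"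
    if "indecomposable_module kA5 P" "e \<in> {main_idem, block_idem}" "\<And>p. p \<in> carrier P \<Longrightarrow> e \<odot>\<^bsub>P\<^esub> p = p"
    for e :: "(nat \<Rightarrow> nat) \<Rightarrow> 'k" and P :: "((nat \<Rightarrow> nat) \<Rightarrow> 'k, 'p) module"
  proof -
    have "carrier P = (\<lambda>p. e \<odot>\<^bsub>P\<^esub> p) ` carrier P" using that(3) by force
    then show ?thesis unfolding belongs_to_block_def blocks_kA5(2)[OF char] using that(1,2) by blast
  qed
  have "belongs_to_block kA5 P1 (PIdl\<^bsub>kA5\<^esub> main_idem)"
    by (rule member[OF i1]) (use main_idem_action(1)[OF l(1)] b1 in auto)
  moreover have "belongs_to_block kA5 P2 (PIdl\<^bsub>kA5\<^esub> main_idem)"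
    by (rule member[OF i2]) (use main_idem_action(1)[OF l(2)] b2 in auto)
  moreover have "belongs_to_block kA5 P3 (PIdl\<^bsub>kA5\<^esub> main_idem)"
    by (rule member[OF i3]) (use main_idem_action(1)[OF l(3)] b3 in auto)
  ultimately show "\<forall>P\<in>{P1,P2,P3}. belongs_to_block kA5 P (PIdl\<^bsub>kA5\<^esub> main_idem)" by simp
  show "belongs_to_block kA5 P4 (PIdl\<^bsub>kA5\<^esub> block_idem)"
    by (rule member[OF i4]) (use b4 in auto)
  assume E: "primitive_decomposition kA5 E"
  have fin: "finite E" and prim: "\<And>f. f \<in> E \<Longrightarrow> primitive_idempotent kA5 f"
    and one: "\<one>\<^bsub>kA5\<^esub> = (\<Oplus>\<^bsub>kA5\<^esub>f\<in>E. f)" using E by (auto simp: primitive_decomposition_def)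
  have idem: "idempotent kA5 f" and n0: "f \<noteq> \<zero>\<^bsub>kA5\<^esub>" if "f \<in> E" for f
    using prim[OF that] by (auto simp: primitive_idempotent_def)
  have Ec: "E \<subseteq> carrier kA5" using idem by (auto simp: idempotent_def)
  let ?iso = "\<lambda>f P. module_isomorphic kA5 (left_ideal_module kA5 f) P"
  have some: "?iso f P1 \<or> ?iso f P2 \<or> ?iso f P3 \<or> ?iso f P4" if f: "f \<in> E" for f
  proof (rule ccontr)
    assume neg: "\<not> ?thesis"
    note cover = R.primitive_ideal_is_cover[OF prim[OF f]]
    have "f = 0"
    proof (rule N.idempotent_detected[OF \<sigma>2 idem[OF f]])
      show "f \<odot>\<^bsub>?S1\<^esub> v = 0" for v
        using cover[OF s1 P1, of v] neg by (auto simp: trivial_smult(1,2))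
      show "f \<odot>\<^bsub>?S2\<^esub> v = 0" for v
        using cover[OF s2 P2, of v] neg z2 by (auto simp: matrix_module_def linear_module_def)
      show "f \<odot>\<^bsub>?S3\<^esub> v = 0" for v
        using cover[OF s3 P3, of v] neg z3 by (auto simp: matrix_module_def linear_module_def)
      show "f \<odot>\<^bsub>?S4\<^esub> v = 0" if "v \<in> carrier ?S4" for v
        using cover[OF s4 P4 that] neg z4 by auto
    qed
    then show False using n0[OF f] by (simp add: G5.KG_simps)
  qed
  note act = R.central_action_iso[OF _ idem _ block_idem_closed]
  have A123: "block_idem \<star> f = \<zero>\<^bsub>kA5\<^esub>" if "f \<in> E" "?iso f P1 \<or> ?iso f P2 \<or> ?iso f P3" for f
    using that(2) act(1)[OF _ that(1) l(1) b1] act(1)[OF _ that(1) l(2) b2] act(1)[OF _ that(1) l(3) b3] by blast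
  have A4: "block_idem \<star> f = f" if "f \<in> E" "?iso f P4" for f
    using that(2) act(2)[OF _ that(1) l(4) b4] by blast
  have excl: "?iso f P4 \<longleftrightarrow> \<not> (?iso f P1 \<or> ?iso f P2 \<or> ?iso f P3)" if "f \<in> E" for f
    using some[OF that] A123[OF that] A4[OF that] n0[OF that] by metis
  have main: "main_idem \<star> f = f \<ominus>\<^bsub>kA5\<^esub> block_idem \<star> f" if "f \<in> carrier kA5" for f :: "_ \<Rightarrow> 'k"
    using that block_idem_closed[where 'a='k] by (simp add: R.minus_eq R.l_distr R.l_minus)
  show "(\<Oplus>\<^bsub>kA5\<^esub>f \<in> {f \<in> E. ?iso f P4}. f) = block_idem"
    by (rule R.sum_of_block_idempotents[OF fin Ec one block_idem_closed])
       (use A4 A123 some in auto)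
  show "(\<Oplus>\<^bsub>kA5\<^esub>f \<in> {f \<in> E. ?iso f P1 \<or> ?iso f P2 \<or> ?iso f P3}. f) = main_idem"
  proof (rule R.sum_of_block_idempotents[OF fin Ec one])
    show "main_idem \<in> carrier (kA5 :: (_ \<Rightarrow> 'k) ring)" using block_idem_closed[where 'a='k] by simp
    fix f assume f: "f \<in> E"
    have fc: "f \<in> carrier kA5" using f Ec by blast
    show "main_idem \<star> f = (if f \<in> {f \<in> E. ?iso f P1 \<or> ?iso f P2 \<or> ?iso f P3} then f else \<zero>\<^bsub>kA5\<^esub>)"
    proof (cases "?iso f P1 \<or> ?iso f P2 \<or> ?iso f P3")
      case True
      then show ?thesis using f fc A123[OF f True] unfolding main[OF fc] by (simp add: R.minus_eq)
    next
      case False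
      then have "?iso f P4" using some f by blast
      then show ?thesis using False fc A4[OF f] unfolding main[OF fc] by (simp add: R.minus_eq R.r_neg)
    qed
  qed blast
qed

theorem mainTheorem9:
  fixes A :: "((nat \<Rightarrow> nat) \<Rightarrow> 'k::alg_closed_field) ring"
  assumes char: "CHAR('k) = 2"
    and A: "A = group_algebra (alt_group 5)"
  shows "card (blocks A) = 2 \<and>
    (\<forall>(F :: 'k set) (\<phi> :: (nat \<Rightarrow> nat) \<Rightarrow> 'k^2^2) (\<sigma> :: 'k \<Rightarrow> 'k)
      (P1 :: ((nat \<Rightarrow> nat) \<Rightarrow> 'k, 'p) module) (P2 :: ((nat \<Rightarrow> nat) \<Rightarrow> 'k, 'p) module)
      (P3 :: ((nat \<Rightarrow> nat) \<Rightarrow> 'k, 'p) module) (P4 :: ((nat \<Rightarrow> nat) \<Rightarrow> 'k, 'p) module).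
       subfield F ring_of_type_algebra \<and> card F = 4 \<and>
       \<phi> \<in> iso (alt_group 5) (SL2 F) \<and>
       \<sigma> \<in> ring_iso (subfield_ring F) (subfield_ring F) \<and> (\<exists>x\<in>F. \<sigma> x \<noteq> x) \<and>
       projective_cover A P1 (trivial_module (alt_group 5)) \<and>
       projective_cover A P2 (matrix_module (alt_group 5) \<phi>) \<and>
       projective_cover A P3 (matrix_module (alt_group 5) (\<lambda>g. map_matrix \<sigma> (\<phi> g))) \<and>
       projective_cover A P4 (sum_zero_module (alt_group 5) {1..5})
       \<longrightarrow>
       belongs_to_block A P1 (principal_block (alt_group 5)) \<and>
       belongs_to_block A P2 (principal_block (alt_group 5)) \<and>
       belongs_to_block A P3 (principal_block (alt_group 5)) \<and>
       (\<exists>B \<in> blocks A. B \<noteq> principal_block (alt_group 5) \<and> belongs_to_block A P4 B) \<and>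
       (\<forall>E. primitive_decomposition A E \<longrightarrow>
         (let e1 = (\<Oplus>\<^bsub>A\<^esub>f \<in> {f \<in> E. module_isomorphic A (left_ideal_module A f) P1 \<or>
                                     module_isomorphic A (left_ideal_module A f) P2 \<or>
                                     module_isomorphic A (left_ideal_module A f) P3}. f);
              e2 = (\<Oplus>\<^bsub>A\<^esub>f \<in> {f \<in> E. module_isomorphic A (left_ideal_module A f) P4}. f)
          in e1 \<noteq> e2 \<and>
             primitive_decomposition (ring_center A) {e1, e2} \<and>
             {e. primitive_idempotent (ring_center A) e} = {e1, e2} \<and>
             blocks A = {PIdl\<^bsub>A\<^esub> e1, PIdl\<^bsub>A\<^esub> e2} \<and>
             ideal (PIdl\<^bsub>A\<^esub> e1) A \<and> ideal (PIdl\<^bsub>A\<^esub> e2) A \<and>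
             internal_direct_sum A (regular_module A) (PIdl\<^bsub>A\<^esub> e1) (PIdl\<^bsub>A\<^esub> e2) \<and>
             principal_block (alt_group 5) = PIdl\<^bsub>A\<^esub> e1)))"
  unfolding A
proof (intro conjI allI impI; (elim conjE)?)
  interpret R: ring "kA5 :: (_ \<Rightarrow> 'k) ring" by (rule ring_kA5)
  note bc = block_idem_central[OF char]
  note pb = principal_block_kA5[OF char]
  show "card (blocks (kA5 :: (_ \<Rightarrow> 'k) ring)) = 2"
    unfolding blocks_set[OF char] using PIdl_main_neq[OF char] by simp
  fix F :: "'k set" and \<phi> :: "(nat \<Rightarrow> nat) \<Rightarrow> 'k^2^2" and \<sigma>
    and P1 P2 P3 P4 :: "((nat \<Rightarrow> nat) \<Rightarrow> 'k, 'p) module"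
  assume hyps: "subfield F ring_of_type_algebra" "card F = 4" "\<phi> \<in> iso G5 (SL2 F)"
       "\<sigma> \<in> ring_iso (subfield_ring F) (subfield_ring F)" "\<exists>x\<in>F. \<sigma> x \<noteq> x"
       "projective_cover kA5 P1 (trivial_module G5)"
       "projective_cover kA5 P2 (matrix_module G5 \<phi>)"
       "projective_cover kA5 P3 (matrix_module G5 (\<lambda>g. map_matrix \<sigma> (\<phi> g)))"
       "projective_cover kA5 P4 (sum_zero_module G5 {1..5})"
  note main = alt_5_blocks[OF char hyps]
  show "belongs_to_block kA5 P1 (principal_block G5)" "belongs_to_block kA5 P2 (principal_block G5)"
    "belongs_to_block kA5 P3 (principal_block G5)"
    using main(1) unfolding pb by blast+
  show "\<exists>B \<in> blocks kA5. B \<noteq> principal_block G5 \<and> belongs_to_block kA5 P4 B"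
    unfolding pb blocks_set[OF char] using PIdl_main_neq[OF char] main(2) by blast
  fix E :: "((nat \<Rightarrow> nat) \<Rightarrow> 'k) set"
  assume E: "primitive_decomposition kA5 E"
  show "let e1 = (\<Oplus>\<^bsub>kA5\<^esub>f \<in> {f \<in> E. module_isomorphic kA5 (left_ideal_module kA5 f) P1 \<or>
                                     module_isomorphic kA5 (left_ideal_module kA5 f) P2 \<or>
                                     module_isomorphic kA5 (left_ideal_module kA5 f) P3}. f);
              e2 = (\<Oplus>\<^bsub>kA5\<^esub>f \<in> {f \<in> E. module_isomorphic kA5 (left_ideal_module kA5 f) P4}. f)
          in e1 \<noteq> e2 \<and>
             primitive_decomposition (ring_center kA5) {e1, e2} \<and>
             {e. primitive_idempotent (ring_center kA5) e} = {e1, e2} \<and>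
             blocks kA5 = {PIdl\<^bsub>kA5\<^esub> e1, PIdl\<^bsub>kA5\<^esub> e2} \<and>
             ideal (PIdl\<^bsub>kA5\<^esub> e1) kA5 \<and> ideal (PIdl\<^bsub>kA5\<^esub> e2) kA5 \<and>
             internal_direct_sum kA5 (regular_module kA5) (PIdl\<^bsub>kA5\<^esub> e1) (PIdl\<^bsub>kA5\<^esub> e2) \<and>
             principal_block G5 = PIdl\<^bsub>kA5\<^esub> e1"
    unfolding main(3)[OF E] main(4)[OF E] Let_def
    using blocks_kA5[OF char] blocks_set[OF char] pb
      R.central_idempotent_ideal[OF bc] R.central_idempotent_ideal[OF R.complement_idempotent(1)[OF bc]]
      R.central_idempotent_direct_sum[OF bc]
    by blast
qed

end
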